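(* Let $g\ge1$ and let $u=u(t_1,t_3,\dots,t_{2g+1})$, $t_1=x$, be a solution of the PI hierarchy with associated matrices $V(\lambda),U_n(\lambda)$ (see context). On a domain where the roots $\lambda_1,\dots,\lambda_g$ of $\beta(\lambda)$ are distinct, put $\mu_j=\alpha(\lambda_j)$. For $n=0,1,\dots,g-1$ and $j=1,\dots,g$, the equations of motion $$\partial_{2n+1}\lambda_j=\frac{2\mu_j\mathrm B_n(\lambda_j)}{\beta'(\lambda_j)}-\frac{\mathrm B_n'(\lambda_j)}{\beta'(\lambda_j)},\qquad \partial_{2n+1}\mu_j=\frac{h'(\lambda_j)\mathrm B_n(\lambda_j)}{\beta'(\lambda_j)}-\frac{\alpha'(\lambda_j)\mathrm B_n'(\lambda_j)}{\beta'(\lambda_j)}+\mathrm A_n'(\lambda_j)$$ (which follow from the Lax equations of the hierarchy) can be cast into the Hamiltonian form $$\partial_{2n+1}\lambda_j=\{\lambda_j,K_{n+1}\},\qquad \partial_{2n+1}\mu_j=\{\mu_j,K_{n+1}\},$$ where $\{\lambda_j,\lambda_k\}=\{\mu_j,\mu_k\}=0$, $\{\lambda_j,\mu_k\}=\delta_{jk}$ (so that $\{\lambda_j,K\}=\partial K/\partial\mu_j$, $\{\mu_j,K\}=-\partial K/\partial\lambda_j$), and the Hamiltonians are $$K_{n+1}=\sum_{j=1}^g\frac{\mu_j^2-I_0(\lambda_j)}{\beta'(\lambda_j)}R_n(\lambda_j)-\sum_{j=1}^g\frac{\mu_jR_n'(\lambda_j)}{\beta'(\lambda_j)},$$ regarded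 as functions of $\lambda_1,\dots,\lambda_g,\mu_1,\dots,\mu_g$ and the time variables as explained in the context.
   Context: **PI hierarchy.** Fix $g\ge1$. The independent variables are $t_1=x,t_3,\dots,t_{2g+1}$, with $\partial_{2n+1}=\partial/\partial t_{2n+1}$; a subscript $x$ means $\partial_x$. The Gelfand–Dickey polynomials $R_n$ are the differential polynomials in $u$ defined as follows: $R_{n+1}$ is the coefficient of $\partial_x^{-1}$ in the pseudo-differential operator $Q^{n+1/2}$, $Q=\partial_x^2+u$, and $R_0=1$. Thus $R_1=\frac u2$, $R_2=\frac18u_{xx}+\frac38u^2$, and they satisfy $R_{n+1,x}=\frac14R_{n,xxx}+uR_{n,x}+\frac12u_xR_n$. Put $R_n(\lambda)=\lambda^n+R_1\lambda^{n-1}+\cdots+R_n$. Put $c_0(t)=1$ and $c_n(t)=\frac{2(g-n)+3}{2}\,t_{2(g-n)+3}$ for $n=1,\dots,g$. A solution of the PI hierarchy is a smooth (or holomorphic) function $u$ on an open domain satisfying $$2R_{g+1}+2c_1(t)R_g+\cdots+2c_g(t)R_1+x=0,\qquad \partial_{2n+1}u=2R_{n+1,x}\quad (n=1,\dots,g).$$ **Matrices.** $$U_n(\lambda)=\begin{pmatrix}\mathrm A_n(\lambda)&\mathrm B_n(\lambda)\\ \Gamma_n(\lambda)&-\mathrm A_n(\lambda)\end{pmatrix},\quad \mathrm B_n(\lambda)=R_n(\lambda),\quad \mathrm A_n(\lambda)=-\tfrac12R_n(\lambda)_x,\quad \Gamma_n(\lambda)=-\tfrac12R_n(\lambda)_{xx}+(\lambda-u)R_n(\lambda),$$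 $$V(\lambda)=\begin{pmatrix}\alpha(\lambda)&\beta(\lambda)\\ \gamma(\lambda)&-\alpha(\lambda)\end{pmatrix}=U_g(\lambda)+c_1(t)U_{g-1}(\lambda)+\cdots+c_g(t)U_0(\lambda),\qquad h(\lambda)=\alpha(\lambda)^2+\beta(\lambda)\gamma(\lambda).$$ The hierarchy in matrix form is the system of Lax equations $\partial_{2n+1}V(\lambda)=[U_n(\lambda),V(\lambda)]+\partial_\lambda U_n(\lambda)$, $n=0,\dots,g$, satisfied by every solution. A prime denotes $\partial_\lambda$. **Reading $K_{n+1}$ as a function of $(\lambda_j,\mu_j,t)$.** Here $\beta(\lambda)=\prod_{j=1}^g(\lambda-\lambda_j)=\lambda^g+\beta_1\lambda^{g-1}+\cdots+\beta_g$, so the $\beta_n$ are (signed) elementary symmetric functions of the $\lambda_j$. In $R_n(\lambda)=\lambda^n+R_1\lambda^{n-1}+\cdots+R_n$, the $R_1,R_2,\dots$ are regarded as the functions of the $\lambda_j$ and $t$ determined by $$\beta_n=R_n+c_1(t)R_{n-1}+\cdots+c_n(t)R_0,\qquad n=1,\dots,g$$ (e.g. $R_1=\beta_1-c_1(t)$); these relations hold along every solution. $R_n(\lambda_j)$, $R_n'(\lambda_j)$ denote the polynomial $R_n(\lambda)$ and its $\lambda$-derivative at $\lambda=\lambda_j$. Finally $$I_0(\lambda)=\sum_{k=0}^{g}\Bigl(\sum_{m=0}^{k}c_m(t)c_{k-m}(t)\Bigr)\lambda^{2g+1-k}+\Bigl(\sum_{m=1}^{g}c_m(t)c_{g+1-m}(t)+x\Bigr)\lambda^g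 .$$ Partial derivatives of $K_{n+1}$ with respect to $\lambda_j,\mu_j$ are taken with the time variables fixed. *)

theory Defs
  imports "HOL-Analysis.Analysis" "HOL-Computational_Algebra.Computational_Algebra"
    "HOL-Library.Poly_Mapping"
begin

section \<open>Differential polynomials\<close>

text \<open>
  Differential polynomials over the complex numbers in one indeterminate u: a monomial maps i to
  the exponent of the i-th x-derivative of u.
\<close>

type_synonym dpoly = "(nat \<Rightarrow>\<^sub>0 nat) \<Rightarrow>\<^sub>0 complex"

definition dp_const :: "complex \<Rightarrow> dpoly" where
  "dp_const a = Poly_Mapping.single 0 a"

definition dp_u :: dpoly where
  "dp_u = Poly_Mapping.single (Poly_Mapping.single 0 1) 1"

text \<open>The derivation sending the i-th derivative of u to the (i+1)-st and killing constants.\<close>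

definition dp_dx :: "dpoly \<Rightarrow> dpoly" where
  "dp_dx p = (\<Sum>m\<in>Poly_Mapping.keys p. \<Sum>i\<in>Poly_Mapping.keys m.
     Poly_Mapping.single (m - Poly_Mapping.single i 1 + Poly_Mapping.single (Suc i) 1)
       (Poly_Mapping.lookup p m * of_nat (Poly_Mapping.lookup m i)))"

text \<open>Evaluation, with \<open>y i\<close> in place of the i-th derivative of u.\<close>

definition dp_eval :: "(nat \<Rightarrow> complex) \<Rightarrow> dpoly \<Rightarrow> complex" where
  "dp_eval y p = (\<Sum>m\<in>Poly_Mapping.keys p.
     Poly_Mapping.lookup p m * (\<Prod>i\<in>Poly_Mapping.keys m. y i ^ Poly_Mapping.lookup m i))"


section \<open>Pseudo-differential operators and the Gelfand--Dickey polynomials\<close>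

text \<open>
  \<open>A :: psdo\<close> stands for the formal series of the terms \<open>A i\<close> times the i-th power of d/dx,
  where \<open>A i = 0\<close> for all large i.  The product is determined by the Leibniz rule: the i-th power
  of d/dx composed with multiplication by b is the sum over \<open>k \<ge> 0\<close> of (i gchoose k) times the
  k-th derivative of b times the (i-k)-th power of d/dx.  The sum below is finite for operators of
  bounded order.
\<close>

type_synonym psdo = "int \<Rightarrow> dpoly"

definition psdo_mult :: "psdo \<Rightarrow> psdo \<Rightarrow> psdo" where
  "psdo_mult A B m =
     (\<Sum>(i, k) \<in> {(i, k :: nat). A i \<noteq> 0 \<and> B (m + int k - i) \<noteq> 0}.
        dp_const ((of_int i :: complex) gchoose k) * A i * (dp_dx ^^ k) (B (m + int k - i)))"

definition psdo_Q :: psdo where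
  "psdo_Q i = (if i = 2 then 1 else if i = 0 then dp_u else 0)"

definition psdo_sqrt_Q :: psdo where
  "psdo_sqrt_Q = (THE S. S 1 = 1 \<and> (\<forall>i>1. S i = 0) \<and> psdo_mult S S = psdo_Q)"

text \<open>The (2n+1)-st power of the square root of Q.\<close>

definition psdo_Q_half_pow :: "nat \<Rightarrow> psdo" where
  "psdo_Q_half_pow n = (psdo_mult psdo_sqrt_Q ^^ (2 * n)) psdo_sqrt_Q"

definition gelfand_dickey :: "nat \<Rightarrow> dpoly" where
  "gelfand_dickey n = (case n of 0 \<Rightarrow> 1 | Suc k \<Rightarrow> psdo_Q_half_pow k (-1))"


section \<open>Functions of the times\<close>

text \<open>
  A point of time is \<open>t :: nat \<Rightarrow> complex\<close>, where \<open>t (2 * n + 1)\<close> for \<open>n \<le> g\<close> is the variable with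
  that index and all other entries are 0.  The set \<open>K\<close> is either the reals (smooth complex-valued
  functions of real times) or \<open>UNIV\<close> (holomorphic functions of complex times).
\<close>

definition time_indices :: "nat \<Rightarrow> nat set" where
  "time_indices g = {2 * n + 1 | n. n \<le> g}"

definition time_space :: "complex set \<Rightarrow> nat \<Rightarrow> (nat \<Rightarrow> complex) set" where
  "time_space K g = {t. \<forall>k. if k \<in> time_indices g then t k \<in> K else t k = 0}"

definition open_times :: "complex set \<Rightarrow> nat \<Rightarrow> (nat \<Rightarrow> complex) set \<Rightarrow> bool" where
  "open_times K g D \<longleftrightarrow> openin (top_of_set (time_space K g)) D"

definition has_partial ::
    "complex set \<Rightarrow> nat \<Rightarrow> ((nat \<Rightarrow> complex) \<Rightarrow> complex) \<Rightarrow> complex \<Rightarrow> (nat \<Rightarrow> complex) \<Rightarrow> bool" where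
  "has_partial K k f d t \<longleftrightarrow> ((\<lambda>s. f (t(k := s))) has_field_derivative d) (at (t k) within K)"

definition partial ::
    "complex set \<Rightarrow> nat \<Rightarrow> ((nat \<Rightarrow> complex) \<Rightarrow> complex) \<Rightarrow> (nat \<Rightarrow> complex) \<Rightarrow> complex" where
  "partial K k f t = (THE d. has_partial K k f d t)"

text \<open>
  All iterated partial derivatives exist and are continuous: infinite differentiability if \<open>K\<close> is
  the set of reals, holomorphy if \<open>K\<close> is \<open>UNIV\<close>.
\<close>

definition smooth_on_times ::
    "complex set \<Rightarrow> nat \<Rightarrow> (nat \<Rightarrow> complex) set \<Rightarrow> ((nat \<Rightarrow> complex) \<Rightarrow> complex) \<Rightarrow> bool" where
  "smooth_on_times K g D f \<longleftrightarrow>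
     (\<forall>ks. set ks \<subseteq> time_indices g \<longrightarrow>
        continuous_on D (foldr (partial K) ks f) \<and>
        (\<forall>k\<in>time_indices g. \<forall>t\<in>D. \<exists>d. has_partial K k (foldr (partial K) ks f) d t))"


section \<open>The PI hierarchy\<close>

definition R_fun :: "complex set \<Rightarrow> ((nat \<Rightarrow> complex) \<Rightarrow> complex) \<Rightarrow> nat \<Rightarrow> (nat \<Rightarrow> complex) \<Rightarrow> complex" where
  "R_fun K u n t = dp_eval (\<lambda>i. (partial K 1 ^^ i) u t) (gelfand_dickey n)"

definition c_time :: "nat \<Rightarrow> nat \<Rightarrow> (nat \<Rightarrow> complex) \<Rightarrow> complex" where
  "c_time g n t = (if n = 0 then 1
     else of_nat (2 * (g - n) + 3) / 2 * t (2 * (g - n) + 3))"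

definition PI_solution ::
    "complex set \<Rightarrow> nat \<Rightarrow> (nat \<Rightarrow> complex) set \<Rightarrow> ((nat \<Rightarrow> complex) \<Rightarrow> complex) \<Rightarrow> bool" where
  "PI_solution K g D u \<longleftrightarrow>
     open_times K g D \<and> smooth_on_times K g D u \<and>
     (\<forall>t\<in>D. 2 * R_fun K u (g + 1) t + (\<Sum>m=1..g. 2 * c_time g m t * R_fun K u (g + 1 - m) t) + t 1 = 0) \<and>
     (\<forall>n\<in>{1..g}. \<forall>t\<in>D. partial K (2 * n + 1) u t = 2 * partial K 1 (R_fun K u (n + 1)) t)"


section \<open>The matrices\<close>

text \<open>Polynomials in the spectral parameter; their derivatives by it are \<open>pderiv\<close>.\<close>

definition lambda_poly :: "nat \<Rightarrow> (nat \<Rightarrow> complex) \<Rightarrow> complex poly" where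
  "lambda_poly n a = (\<Sum>k\<le>n. monom (a k) (n - k))"

context
  fixes K :: "complex set" and u :: "(nat \<Rightarrow> complex) \<Rightarrow> complex"
begin

definition B_poly :: "nat \<Rightarrow> (nat \<Rightarrow> complex) \<Rightarrow> complex poly" where
  "B_poly n t = lambda_poly n (\<lambda>k. R_fun K u k t)"

definition A_poly :: "nat \<Rightarrow> (nat \<Rightarrow> complex) \<Rightarrow> complex poly" where
  "A_poly n t = smult (-1/2) (lambda_poly n (\<lambda>k. partial K 1 (R_fun K u k) t))"

definition Gamma_poly :: "nat \<Rightarrow> (nat \<Rightarrow> complex) \<Rightarrow> complex poly" where
  "Gamma_poly n t =
     smult (-1/2) (lambda_poly n (\<lambda>k. partial K 1 (partial K 1 (R_fun K u k)) t))
     + [:- u t, 1:] * B_poly n t"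

definition U_mat :: "nat \<Rightarrow> (nat \<Rightarrow> complex) \<Rightarrow> complex poly ^ 2 ^ 2" where
  "U_mat n t = vector [vector [A_poly n t, B_poly n t], vector [Gamma_poly n t, - A_poly n t]]"

definition V_mat :: "nat \<Rightarrow> (nat \<Rightarrow> complex) \<Rightarrow> complex poly ^ 2 ^ 2" where
  "V_mat g t = (\<Sum>m\<le>g. \<chi> i j. smult (c_time g m t) (U_mat (g - m) t $ i $ j))"

definition alpha_poly :: "nat \<Rightarrow> (nat \<Rightarrow> complex) \<Rightarrow> complex poly" where
  "alpha_poly g t = V_mat g t $ 1 $ 1"

definition beta_poly :: "nat \<Rightarrow> (nat \<Rightarrow> complex) \<Rightarrow> complex poly" where
  "beta_poly g t = V_mat g t $ 1 $ 2"

definition gamma_poly :: "nat \<Rightarrow> (nat \<Rightarrow> complex) \<Rightarrow> complex poly" where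
  "gamma_poly g t = V_mat g t $ 2 $ 1"

definition h_poly :: "nat \<Rightarrow> (nat \<Rightarrow> complex) \<Rightarrow> complex poly" where
  "h_poly g t = (alpha_poly g t)\<^sup>2 + beta_poly g t * gamma_poly g t"

end


section \<open>The Hamiltonians\<close>

text \<open>
  Below \<open>l, m :: nat \<Rightarrow> complex\<close> are the canonical coordinates (only the entries with index in
  \<open>{1..g}\<close> matter), independent of the times \<open>t\<close>.
\<close>

definition beta_of_roots :: "nat \<Rightarrow> (nat \<Rightarrow> complex) \<Rightarrow> complex poly" where
  "beta_of_roots g l = (\<Prod>j=1..g. [:- l j, 1:])"

fun R_of_roots :: "nat \<Rightarrow> (nat \<Rightarrow> complex) \<Rightarrow> (nat \<Rightarrow> complex) \<Rightarrow> nat \<Rightarrow> complex" where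
  "R_of_roots g l t n = (if n = 0 then 1
     else coeff (beta_of_roots g l) (g - n) - (\<Sum>k=1..n. c_time g k t * R_of_roots g l t (n - k)))"

declare R_of_roots.simps [simp del]

lemma R_of_roots_0: "R_of_roots g l t 0 = 1"
  by (simp add: R_of_roots.simps)

text \<open>The defining relations of \<open>R_of_roots\<close>.\<close>

lemma coeff_beta_of_roots:
  assumes "n \<in> {1..g}"
  shows "coeff (beta_of_roots g l) (g - n) = (\<Sum>k\<le>n. c_time g k t * R_of_roots g l t (n - k))"
proof -
  have "{..n} = insert 0 {1..n}" by auto
  hence "(\<Sum>k\<le>n. c_time g k t * R_of_roots g l t (n - k)) =
      R_of_roots g l t n + (\<Sum>k=1..n. c_time g k t * R_of_roots g l t (n - k))"
    by (simp add: c_time_def)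
  also have "R_of_roots g l t n = coeff (beta_of_roots g l) (g - n)
      - (\<Sum>k=1..n. c_time g k t * R_of_roots g l t (n - k))"
    using assms by (subst R_of_roots.simps) simp
  finally show ?thesis by simp
qed

definition R_poly_of_roots ::
    "nat \<Rightarrow> nat \<Rightarrow> (nat \<Rightarrow> complex) \<Rightarrow> (nat \<Rightarrow> complex) \<Rightarrow> complex poly" where
  "R_poly_of_roots g n l t = lambda_poly n (R_of_roots g l t)"

definition I0 :: "nat \<Rightarrow> (nat \<Rightarrow> complex) \<Rightarrow> complex poly" where
  "I0 g t = (\<Sum>k\<le>g. monom (\<Sum>m\<le>k. c_time g m t * c_time g (k - m) t) (2 * g + 1 - k))
     + monom ((\<Sum>m=1..g. c_time g m t * c_time g (g + 1 - m) t) + t 1) g"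

text \<open>\<open>Ham g n\<close> is the Hamiltonian with index n+1.\<close>

definition Ham ::
    "nat \<Rightarrow> nat \<Rightarrow> (nat \<Rightarrow> complex) \<Rightarrow> (nat \<Rightarrow> complex) \<Rightarrow> (nat \<Rightarrow> complex) \<Rightarrow> complex" where
  "Ham g n t l m =
     (\<Sum>j=1..g. ((m j)\<^sup>2 - poly (I0 g t) (l j)) / poly (pderiv (beta_of_roots g l)) (l j)
        * poly (R_poly_of_roots g n l t) (l j))
     - (\<Sum>j=1..g. m j * poly (pderiv (R_poly_of_roots g n l t)) (l j)
        / poly (pderiv (beta_of_roots g l)) (l j))"

text \<open>The Poisson bracket, evaluated at the point \<open>(l, m)\<close>.\<close>

definition d_l :: "nat \<Rightarrow> ((nat \<Rightarrow> complex) \<Rightarrow> (nat \<Rightarrow> complex) \<Rightarrow> complex) \<Rightarrow>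
    (nat \<Rightarrow> complex) \<Rightarrow> (nat \<Rightarrow> complex) \<Rightarrow> complex" where
  "d_l k F l m = deriv (\<lambda>z. F (l(k := z)) m) (l k)"

definition d_m :: "nat \<Rightarrow> ((nat \<Rightarrow> complex) \<Rightarrow> (nat \<Rightarrow> complex) \<Rightarrow> complex) \<Rightarrow>
    (nat \<Rightarrow> complex) \<Rightarrow> (nat \<Rightarrow> complex) \<Rightarrow> complex" where
  "d_m k F l m = deriv (\<lambda>z. F l (m(k := z))) (m k)"

definition poisson :: "nat \<Rightarrow> ((nat \<Rightarrow> complex) \<Rightarrow> (nat \<Rightarrow> complex) \<Rightarrow> complex) \<Rightarrow>
    ((nat \<Rightarrow> complex) \<Rightarrow> (nat \<Rightarrow> complex) \<Rightarrow> complex) \<Rightarrow>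
    (nat \<Rightarrow> complex) \<Rightarrow> (nat \<Rightarrow> complex) \<Rightarrow> complex" where
  "poisson g F G l m = (\<Sum>k=1..g. d_l k F l m * d_m k G l m - d_m k F l m * d_l k G l m)"

definition coord_l :: "nat \<Rightarrow> (nat \<Rightarrow> complex) \<Rightarrow> (nat \<Rightarrow> complex) \<Rightarrow> complex" where
  "coord_l j l m = l j"

definition coord_m :: "nat \<Rightarrow> (nat \<Rightarrow> complex) \<Rightarrow> (nat \<Rightarrow> complex) \<Rightarrow> complex" where
  "coord_m j l m = m j"

lemma d_coord [simp]:
  "d_l k (coord_l j) l m = (if k = j then 1 else 0)"
  "d_m k (coord_l j) l m = 0"
  "d_l k (coord_m j) l m = 0"
  "d_m k (coord_m j) l m = (if k = j then 1 else 0)"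
  by (auto simp: d_l_def d_m_def coord_l_def coord_m_def)

lemma poisson_coord:
  assumes "j \<in> {1..g}"
  shows "poisson g (coord_l j) F l m = d_m j F l m"
    and "poisson g (coord_m j) F l m = - d_l j F l m"
  using assms by (simp_all add: poisson_def if_distrib[of "\<lambda>x. x * _"] sum_negf sum.delta cong: if_cong)

lemma poisson_canonical:
  assumes "j \<in> {1..g}" "k \<in> {1..g}"
  shows "poisson g (coord_l j) (coord_l k) l m = 0"
    and "poisson g (coord_m j) (coord_m k) l m = 0"
    and "poisson g (coord_l j) (coord_m k) l m = (if j = k then 1 else 0)"
  using assms by (simp_all add: poisson_coord)

end

theory Submission
  imports Defs
begin

text \<open>
  The square root of \<open>Q\<close> commutes with \<open>Q\<close>, which gives the Lenard recursion for the residues \<open>R\<^sub>n\<close>; integrated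
  once (the kernel of the derivation on differential polynomials consists of the constants) it becomes a
  quadratic relation for the generating function \<open>R\<close> of the \<open>R\<^sub>n\<close>.  That relation determines \<open>R\<close> without
  integration, so a derivation commuting with d/dx is determined on \<open>R\<close> by its value at \<open>u\<close>.  For the flows
  this yields the zero curvature equations, for the partial derivative by \<open>u\<close> it yields \<open>(n + 1/2) R\<^sub>n\<close> as the
  derivative of the next coefficient.  By the string equation the combination of the flows with
  coefficients \<open>c\<^sub>m\<close> acts as minus the derivative by \<open>u\<close>, and the two facts combine to the equations of
  motion of \<open>\<beta>\<close>; those of \<open>\<alpha>\<close> follow by d/dx, and those of the \<open>\<lambda>\<^sub>j\<close>, \<open>\<mu>\<^sub>j\<close> by implicit differentiation.

  The quadratic relation and the string equation also show that \<open>h - I\<^sub>0\<close> has degree less than \<open>g\<close>, so that both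
  \<open>h\<close> and \<open>\<alpha>\<close> are given by Lagrange interpolation at the \<open>\<lambda>\<^sub>j\<close>.  As a function of a single root,
  \<open>R\<^sub>n(\<lambda>) = (\<lambda> - \<lambda>\<^sub>j) E(\<lambda>) + \<phi>\<close> with \<open>E\<close> and \<open>\<phi>\<close> independent of \<open>\<lambda>\<^sub>j\<close>; hence the Hamiltonian is an explicit rational
  function of \<open>\<lambda>\<^sub>j\<close>, whose derivative agrees term by term with the interpolation formulas.
\<close>

text \<open>The recursion determines only the x-derivative of each new coefficient, so every
  comparison based on it would leave an undetermined constant. In the quadratic relation the new
  coefficient occurs undifferentiated with the factor 4, while all derivatives carry a factor X,
  which stands for 1/lambda; hence the linearization is injective.

  The inhomogeneous term in the Lax equations, the lambda-derivative of \<open>U_n\<close>, has two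
  sources. The time with index 2n+1 occurs explicitly in c_(g+1-n) and contributes n + 1/2; the
  derivative by u contributes -(j + 1/2) at R_j. Their sum n - j is the exponent brought down by
  differentiating R_n(lambda).

  The Hamiltonian contains only I_0, the part of h that is an explicit function of the times; the
  remaining g coefficients of h are encoded in h(lambda_k) = mu_k^2. The term A_n' in the equation
  for mu_j arises because A_n is obtained from alpha by the same linear truncation that describes
  how R_n depends on one root.\<close>

section \<open>Differential polynomials as a polynomial ring in the jet variables\<close>

definition dp_var :: "nat \<Rightarrow> dpoly" where
  "dp_var i = Poly_Mapping.single (Poly_Mapping.single i 1) 1"

lemma dp_const_simps [simp]:
  "dp_const 0 = 0" "dp_const 1 = 1" "dp_const (numeral k) = numeral k"
  by (simp_all add: dp_const_def)

lemma dp_const_add: "dp_const (a + b) = dp_const a + dp_const b"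
  by (simp add: dp_const_def single_add)

lemma dp_const_mult: "dp_const (a * b) = dp_const a * dp_const b"
  by (simp add: dp_const_def mult_single)

lemma dp_const_uminus: "dp_const (- a) = - dp_const a"
  by (simp add: dp_const_def single_uminus)

lemma dp_const_sum: "dp_const (sum f A) = (\<Sum>i\<in>A. dp_const (f i))"
  by (induction A rule: infinite_finite_induct) (simp_all add: dp_const_add)

lemma dp_const_of_nat: "dp_const (of_nat n) = of_nat n"
  by (simp add: dp_const_def)

lemma poly_mapping_sum_single:
  "p = (\<Sum>m\<in>Poly_Mapping.keys p. Poly_Mapping.single m (Poly_Mapping.lookup p m))"
proof (rule poly_mapping_eqI)
  fix k
  show "Poly_Mapping.lookup p k =
      Poly_Mapping.lookup (\<Sum>m\<in>Poly_Mapping.keys p. Poly_Mapping.single m (Poly_Mapping.lookup p m)) k"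
    by (cases "k \<in> Poly_Mapping.keys p")
      (auto simp: lookup_sum lookup_single when_def sum.delta not_in_keys_iff_lookup_eq_zero
        intro!: sum.neutral)
qed

lemma single_sum_index:
  assumes "finite A"
  shows "(Poly_Mapping.single (sum f A) (1 :: 'b :: comm_semiring_1) :: ('a::comm_monoid_add) \<Rightarrow>\<^sub>0 'b)
    = (\<Prod>i\<in>A. Poly_Mapping.single (f i) 1)"
  using assms
proof (induction A rule: finite_induct)
  case (insert x F)
  then show ?case using mult_single[of "f x" "1::'b" "sum f F" 1] by simp
qed simp

lemma single_single_power:
  "Poly_Mapping.single (Poly_Mapping.single i n) 1 = dp_var i ^ n"
proof (induction n)
  case (Suc n)
  have "Poly_Mapping.single i (Suc n) = Poly_Mapping.single i 1 + Poly_Mapping.single i n"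
    by (simp flip: single_add)
  then show ?case using Suc mult_single[of "Poly_Mapping.single i 1" "1::complex" "Poly_Mapping.single i n" 1]
    by (simp add: dp_var_def)
qed simp

lemma single_monomial:
  "Poly_Mapping.single m c = dp_const c * (\<Prod>i\<in>Poly_Mapping.keys m. dp_var i ^ Poly_Mapping.lookup m i)"
proof -
  have "Poly_Mapping.single m (1::complex) =
    Poly_Mapping.single (\<Sum>i\<in>Poly_Mapping.keys m. Poly_Mapping.single i (Poly_Mapping.lookup m i)) 1"
    by (subst poly_mapping_sum_single[of m]) (rule refl)
  also have "\<dots> = (\<Prod>i\<in>Poly_Mapping.keys m. dp_var i ^ Poly_Mapping.lookup m i)"
    by (simp add: single_sum_index single_single_power)
  finally have "(\<Prod>i\<in>Poly_Mapping.keys m. dp_var i ^ Poly_Mapping.lookup m i) = Poly_Mapping.single m 1" by simp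
  then show ?thesis by (simp add: dp_const_def mult_single)
qed

text \<open>Jet variables and constants generate the ring. Commuting derivations, time derivatives
  along a solution and the string equation are all reduced to the jets of u in this way.\<close>

lemma dpoly_induct [case_names const var add mult]:
  assumes "\<And>c. P (dp_const c)" and "\<And>i. P (dp_var i)"
    and add: "\<And>p q. P p \<Longrightarrow> P q \<Longrightarrow> P (p + q)" and mult: "\<And>p q. P p \<Longrightarrow> P q \<Longrightarrow> P (p * q)"
  shows "P p"
proof -
  have one: "P 1" using assms(1)[of 1] by simp
  have zero: "P 0" using assms(1)[of 0] by simp
  have pow: "P (dp_var i ^ n)" for i n by (induction n) (auto simp: one assms)
  have prod: "P (\<Prod>i\<in>A. dp_var i ^ f i)" for f and A :: "nat set"
    by (induction A rule: infinite_finite_induct) (auto simp: one pow mult)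
  have "P (Poly_Mapping.single m c)" for m c
    unfolding single_monomial by (intro mult prod assms)
  then have "P (\<Sum>m\<in>A. Poly_Mapping.single m (f m))" for A f
    by (induction A rule: infinite_finite_induct) (auto simp: zero add)
  then show ?thesis by (subst poly_mapping_sum_single)
qed

section \<open>Evaluation\<close>

definition mon_eval :: "(nat \<Rightarrow> complex) \<Rightarrow> (nat \<Rightarrow>\<^sub>0 nat) \<Rightarrow> complex" where
  "mon_eval y m = (\<Prod>i\<in>Poly_Mapping.keys m. y i ^ Poly_Mapping.lookup m i)"

lemma mon_eval_superset:
  assumes "finite A" "Poly_Mapping.keys m \<subseteq> A"
  shows "mon_eval y m = (\<Prod>i\<in>A. y i ^ Poly_Mapping.lookup m i)"
  unfolding mon_eval_def using assms
  by (intro prod.mono_neutral_left) (auto simp: not_in_keys_iff_lookup_eq_zero)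

lemma mon_eval_add: "mon_eval y (m + m') = mon_eval y m * mon_eval y m'"
proof -
  define A where "A = Poly_Mapping.keys m \<union> Poly_Mapping.keys m'"
  have "finite A" "Poly_Mapping.keys m \<subseteq> A" "Poly_Mapping.keys m' \<subseteq> A"
    "Poly_Mapping.keys (m + m') \<subseteq> A"
    using Poly_Mapping.keys_add[of m m'] by (auto simp: A_def)
  then show ?thesis
    by (simp add: mon_eval_superset[of A] lookup_add power_add prod.distrib)
qed

lemma dp_eval_alt: "dp_eval y p = (\<Sum>m\<in>Poly_Mapping.keys p. Poly_Mapping.lookup p m * mon_eval y m)"
  by (simp add: dp_eval_def mon_eval_def)

lemma dp_eval_add: "dp_eval y (p + q) = dp_eval y p + dp_eval y q"
  unfolding dp_eval_alt by (rule setsum_keys_plus_distrib) (auto simp: algebra_simps)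

lemma dp_eval_0 [simp]: "dp_eval y 0 = 0"
  by (simp add: dp_eval_alt)

lemma dp_eval_single: "dp_eval y (Poly_Mapping.single m c) = c * mon_eval y m"
  by (cases "c = 0") (simp_all add: dp_eval_alt)

lemma dp_eval_sum: "dp_eval y (sum f A) = (\<Sum>i\<in>A. dp_eval y (f i))"
  by (induction A rule: infinite_finite_induct) (simp_all add: dp_eval_add)

text \<open>Reduces multiplicativity of evaluation and the Leibniz rule to pairs of
  monomials.\<close>

lemma bilinear_eqI:
  fixes F G :: "('a \<Rightarrow>\<^sub>0 'b::comm_monoid_add) \<Rightarrow> ('a \<Rightarrow>\<^sub>0 'b) \<Rightarrow> 'c::comm_monoid_add"
  assumes "\<And>p p' q. F (p + p') q = F p q + F p' q" "\<And>p q q'. F p (q + q') = F p q + F p q'"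
    "\<And>p p' q. G (p + p') q = G p q + G p' q" "\<And>p q q'. G p (q + q') = G p q + G p q'"
    "\<And>q. F 0 q = 0" "\<And>p. F p 0 = 0" "\<And>q. G 0 q = 0" "\<And>p. G p 0 = 0"
    "\<And>m a m' b. F (Poly_Mapping.single m a) (Poly_Mapping.single m' b)
       = G (Poly_Mapping.single m a) (Poly_Mapping.single m' b)"
  shows "F p q = G p q"
proof -
  have 1: "F (\<Sum>m\<in>A. Poly_Mapping.single m (f m)) (Poly_Mapping.single m' b) =
      G (\<Sum>m\<in>A. Poly_Mapping.single m (f m)) (Poly_Mapping.single m' b)" for A f m' b
    by (induction A rule: infinite_finite_induct) (simp_all add: assms)
  have 2: "F p (Poly_Mapping.single m' b) = G p (Poly_Mapping.single m' b)" for m' b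
    by (subst (1 2) poly_mapping_sum_single[of p]) (rule 1)
  have 3: "F p (\<Sum>m\<in>A. Poly_Mapping.single m (f m)) = G p (\<Sum>m\<in>A. Poly_Mapping.single m (f m))" for A f
    by (induction A rule: infinite_finite_induct) (simp_all add: assms 2)
  show ?thesis by (subst (1 2) poly_mapping_sum_single[of q]) (rule 3)
qed

lemma dp_eval_mult: "dp_eval y (p * q) = dp_eval y p * dp_eval y q"
  by (rule bilinear_eqI[where F = "\<lambda>p q. dp_eval y (p * q)" and G = "\<lambda>p q. dp_eval y p * dp_eval y q"])
    (simp_all add: algebra_simps dp_eval_add mult_single dp_eval_single mon_eval_add)

lemma mon_eval_0 [simp]: "mon_eval y 0 = 1"
  by (simp add: mon_eval_def)

lemma dp_eval_const [simp]: "dp_eval y (dp_const c) = c"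
  by (simp add: dp_const_def dp_eval_single)

lemma dp_eval_1 [simp]: "dp_eval y 1 = 1"
  using dp_eval_const[of y 1] by simp

lemma dp_eval_var [simp]: "dp_eval y (dp_var i) = y i"
  by (simp add: dp_var_def dp_eval_single mon_eval_def)

lemma dp_eval_uminus: "dp_eval y (- p) = - dp_eval y p"
  using dp_eval_add[of y p "- p"] by (simp add: eq_neg_iff_add_eq_0 add.commute)

lemma dp_eval_diff: "dp_eval y (p - q) = dp_eval y p - dp_eval y q"
  using dp_eval_add[of y p "- q"] by (simp add: dp_eval_uminus)

lemma dp_eval_numeral [simp]: "dp_eval y (numeral k) = numeral k"
  using dp_eval_const[of y "numeral k"] by simp

section \<open>Derivations\<close>

definition derivation :: "('a::comm_ring_1 \<Rightarrow> 'a) \<Rightarrow> bool" where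
  "derivation d \<longleftrightarrow> (\<forall>p q. d (p + q) = d p + d q) \<and> (\<forall>p q. d (p * q) = d p * q + p * d q)"

lemma derivationD:
  assumes "derivation d"
  shows "d (p + q) = d p + d q" "d (p * q) = d p * q + p * d q"
  using assms by (auto simp: derivation_def)

lemma derivation_0: assumes "derivation d" shows "d 0 = 0"
  using derivationD(1)[OF assms, of 0 0] by simp

lemma derivation_1: assumes "derivation d" shows "d 1 = 0"
  using derivationD(2)[OF assms, of 1 1] by simp

lemma derivation_uminus: assumes "derivation d" shows "d (- p) = - d p"
  using derivationD(1)[OF assms, of p "- p"] derivation_0[OF assms]
  by (simp add: eq_neg_iff_add_eq_0 add.commute)

lemma derivation_diff: assumes "derivation d" shows "d (p - q) = d p - d q"
  using derivationD(1)[OF assms, of p "- q"] derivation_uminus[OF assms] by simp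

lemma derivation_sum: assumes "derivation d" shows "d (sum f A) = (\<Sum>i\<in>A. d (f i))"
  by (induction A rule: infinite_finite_induct)
    (simp_all add: derivation_0[OF assms] derivationD[OF assms])

lemma derivation_commuteI:
  assumes d: "derivation d" and e: "derivation e"
    and "\<And>c. d (e (dp_const c)) = e (d (dp_const c))" "\<And>i. d (e (dp_var i)) = e (d (dp_var i))"
  shows "d (e p) = e (d p)"
  by (induction p rule: dpoly_induct)
    (simp_all add: assms(3,4) derivationD[OF d] derivationD[OF e] algebra_simps)

text \<open>The truncated subtraction of exponents is harmless, since an index outside
  \<open>keys m\<close> would carry the coefficient 0. d/dx, the flows and the derivative by u are
  all instances of \<open>dp_der\<close>, so they share one Leibniz rule.\<close>

definition mon_der :: "(nat \<Rightarrow> dpoly) \<Rightarrow> (nat \<Rightarrow>\<^sub>0 nat) \<Rightarrow> dpoly" where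
  "mon_der q m = (\<Sum>i\<in>Poly_Mapping.keys m.
     Poly_Mapping.single (m - Poly_Mapping.single i 1) (of_nat (Poly_Mapping.lookup m i)) * q i)"

definition dp_der :: "(nat \<Rightarrow> dpoly) \<Rightarrow> dpoly \<Rightarrow> dpoly" where
  "dp_der q p = (\<Sum>m\<in>Poly_Mapping.keys p. dp_const (Poly_Mapping.lookup p m) * mon_der q m)"

lemma mon_der_superset:
  assumes "finite A" "Poly_Mapping.keys m \<subseteq> A"
  shows "mon_der q m = (\<Sum>i\<in>A.
     Poly_Mapping.single (m - Poly_Mapping.single i 1) (of_nat (Poly_Mapping.lookup m i)) * q i)"
  unfolding mon_der_def using assms
  by (intro sum.mono_neutral_left) (auto simp: not_in_keys_iff_lookup_eq_zero)

lemma mon_der_add: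
  "mon_der q (m + m') = Poly_Mapping.single m' 1 * mon_der q m + Poly_Mapping.single m 1 * mon_der q m'"
proof -
  define A where "A = Poly_Mapping.keys m \<union> Poly_Mapping.keys m'"
  have A: "finite A" "Poly_Mapping.keys m \<subseteq> A" "Poly_Mapping.keys m' \<subseteq> A"
    "Poly_Mapping.keys (m + m') \<subseteq> A"
    using Poly_Mapping.keys_add[of m m'] by (auto simp: A_def)
  have *: "Poly_Mapping.single ((m + m') - Poly_Mapping.single i 1) (of_nat (Poly_Mapping.lookup m i))
    = Poly_Mapping.single m' 1 *
        Poly_Mapping.single (m - Poly_Mapping.single i 1) (of_nat (Poly_Mapping.lookup m i) :: complex)" for m m' i
  proof (cases "Poly_Mapping.lookup m i = 0")
    case False
    then have "(m + m') - Poly_Mapping.single i 1 = m' + (m - Poly_Mapping.single i 1)"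
      by (intro poly_mapping_eqI) (auto simp: lookup_minus lookup_add lookup_single when_def)
    then show ?thesis by (simp add: mult_single)
  qed simp
  have "mon_der q (m + m') = (\<Sum>i\<in>A.
       (Poly_Mapping.single ((m + m') - Poly_Mapping.single i 1) (of_nat (Poly_Mapping.lookup m i)) +
        Poly_Mapping.single ((m' + m) - Poly_Mapping.single i 1) (of_nat (Poly_Mapping.lookup m' i))) * q i)"
    using A by (simp add: mon_der_superset[of A] lookup_add single_add[symmetric] add.commute)
  also have "\<dots> = Poly_Mapping.single m' 1 * mon_der q m + Poly_Mapping.single m 1 * mon_der q m'"
    unfolding * using A by (simp add: mon_der_superset[of A] sum_distrib_left algebra_simps sum.distrib)
  finally show ?thesis .
qed

lemma dp_der_add: "dp_der q (p + p') = dp_der q p + dp_der q p'"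
  unfolding dp_der_def by (rule setsum_keys_plus_distrib) (auto simp: algebra_simps dp_const_add)

lemma dp_der_single: "dp_der q (Poly_Mapping.single m c) = dp_const c * mon_der q m"
  by (cases "c = 0") (simp_all add: dp_der_def)

lemma dp_der_0 [simp]: "dp_der q 0 = 0"
  by (simp add: dp_der_def)

lemma derivation_dp_der: "derivation (dp_der q)"
proof -
  have "dp_der q (a * b) = dp_der q a * b + a * dp_der q b" for a b
  proof (rule bilinear_eqI[where F = "\<lambda>a b. dp_der q (a * b)" and G = "\<lambda>a b. dp_der q a * b + a * dp_der q b"])
    fix m m' a b
    have single: "Poly_Mapping.single m a = dp_const a * Poly_Mapping.single m 1" for m :: "nat \<Rightarrow>\<^sub>0 nat" and a
      by (simp add: dp_const_def mult_single)
    have "dp_der q (Poly_Mapping.single m a * Poly_Mapping.single m' b) =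
      dp_const a * dp_const b * (Poly_Mapping.single m' 1 * mon_der q m + Poly_Mapping.single m 1 * mon_der q m')"
      by (simp add: mult_single dp_der_single mon_der_add dp_const_mult)
    also have "\<dots> = dp_const a * mon_der q m * (dp_const b * Poly_Mapping.single m' 1)
        + dp_const a * Poly_Mapping.single m 1 * (dp_const b * mon_der q m')"
      by (simp add: algebra_simps)
    finally show "dp_der q (Poly_Mapping.single m a * Poly_Mapping.single m' b) =
      dp_der q (Poly_Mapping.single m a) * Poly_Mapping.single m' b +
      Poly_Mapping.single m a * dp_der q (Poly_Mapping.single m' b)"
      by (simp only: dp_der_single single[symmetric])
  qed (simp_all add: algebra_simps dp_der_add)
  then show ?thesis by (simp add: derivation_def dp_der_add)
qed

lemma dp_der_const [simp]: "dp_der q (dp_const c) = 0"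
  by (simp add: dp_const_def dp_der_single mon_der_def)

lemma dp_der_var [simp]: "dp_der q (dp_var i) = q i"
  by (simp add: dp_var_def dp_der_single mon_der_def)

lemma dp_dx_eq_der: "dp_dx = dp_der (\<lambda>i. dp_var (Suc i))"
proof
  fix p
  show "dp_dx p = dp_der (\<lambda>i. dp_var (Suc i)) p"
    by (simp add: dp_dx_def dp_der_def mon_der_def dp_var_def sum_distrib_left dp_const_def mult_single)
qed

lemma derivation_dx: "derivation dp_dx"
  by (simp add: dp_dx_eq_der derivation_dp_der)

lemmas dp_dx_simps = derivationD[OF derivation_dx] derivation_0[OF derivation_dx]
  derivation_1[OF derivation_dx] derivation_uminus[OF derivation_dx] derivation_diff[OF derivation_dx]

lemma dp_dx_const [simp]: "dp_dx (dp_const c) = 0"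
  by (simp add: dp_dx_eq_der)

lemma dp_dx_var [simp]: "dp_dx (dp_var i) = dp_var (Suc i)"
  by (simp add: dp_dx_eq_der)

lemma dp_u_eq_var: "dp_u = dp_var 0"
  by (simp add: dp_u_def dp_var_def)

text \<open>A derivative has no constant term: each of its monomials contains a jet
  variable.\<close>

lemma dp_eval_zero_dx: "dp_eval (\<lambda>_. 0) (dp_dx p) = 0"
  by (induction p rule: dpoly_induct) (simp_all add: dp_dx_simps dp_eval_add dp_eval_mult)

text \<open>Differentiating one factor of the highest jet variable \<open>N\<close> creates the
  variable \<open>Suc N\<close>, which no monomial of \<open>p\<close> contains; the monomial so
  obtained cannot cancel.\<close>

lemma dp_dx_eq_0_imp_const:
  assumes "dp_dx p = 0"
  shows "p = dp_const (dp_eval (\<lambda>_. 0) p)"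
proof -
  define A where "A = (\<Union>m\<in>Poly_Mapping.keys p. Poly_Mapping.keys m)"
  have fin: "finite A" by (simp add: A_def)
  have "A = {}"
  proof (rule ccontr)
    assume "A \<noteq> {}"
    define N where "N = Max A"
    have "N \<in> A" using fin \<open>A \<noteq> {}\<close> by (simp add: N_def)
    then obtain m where m: "m \<in> Poly_Mapping.keys p" "N \<in> Poly_Mapping.keys m" by (auto simp: A_def)
    have le: "i \<le> N" if "m' \<in> Poly_Mapping.keys p" "i \<in> Poly_Mapping.keys m'" for i m'
      unfolding N_def by (rule Max_ge) (use fin that in \<open>auto simp: A_def\<close>)
    define m1 where "m1 = m - Poly_Mapping.single N 1 + Poly_Mapping.single (Suc N) 1"
    have Nm: "Poly_Mapping.lookup m' (Suc N) = 0" if "m' \<in> Poly_Mapping.keys p" for m'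
      using le[OF that, of "Suc N"] by (auto simp: in_keys_iff)
    \<comment> \<open>The factor of index \<open>Suc N\<close> in \<open>m1\<close> can only come
      from differentiating a factor of index \<open>N\<close>; this fixes \<open>i\<close>, and then
      \<open>m'\<close> can be read off.\<close>
    have key: "m' - Poly_Mapping.single i 1 + Poly_Mapping.single (Suc i) 1 = m1 \<longleftrightarrow> m' = m \<and> i = N"
      if *: "m' \<in> Poly_Mapping.keys p" "i \<in> Poly_Mapping.keys m'" for m' i
    proof
      assume eq: "m' - Poly_Mapping.single i 1 + Poly_Mapping.single (Suc i) 1 = m1"
      then have l: "Poly_Mapping.lookup (m' - Poly_Mapping.single i 1 + Poly_Mapping.single (Suc i) 1) k
        = Poly_Mapping.lookup m1 k" for k by simp
      from l[of "Suc N"] have [simp]: "i = N" using Nm[OF *(1)] Nm[OF m(1)]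
        by (auto simp: m1_def lookup_add lookup_minus lookup_single when_def split: if_splits)
      have "m' = m"
      proof (rule poly_mapping_eqI)
        fix k show "Poly_Mapping.lookup m' k = Poly_Mapping.lookup m k"
          using l[of k] m(2) *(2)
          by (auto simp: m1_def lookup_add lookup_minus lookup_single when_def in_keys_iff split: if_splits)
      qed
      then show "m' = m \<and> i = N" by simp
    qed (auto simp: m1_def)
    have "Poly_Mapping.lookup (dp_dx p) m1 =
      (\<Sum>m'\<in>Poly_Mapping.keys p. \<Sum>i\<in>Poly_Mapping.keys m'.
        if m' = m \<and> i = N then Poly_Mapping.lookup p m' * of_nat (Poly_Mapping.lookup m' i) else 0)"
      unfolding dp_dx_def lookup_sum
      by (intro sum.cong refl) (auto simp: lookup_single when_def key[unfolded One_nat_def])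
    also have "\<dots> = (\<Sum>m'\<in>Poly_Mapping.keys p. if m' = m then (\<Sum>i\<in>Poly_Mapping.keys m.
        if i = N then Poly_Mapping.lookup p m * of_nat (Poly_Mapping.lookup m i) else 0) else 0)"
      by (intro sum.cong refl) auto
    also have "\<dots> = Poly_Mapping.lookup p m * of_nat (Poly_Mapping.lookup m N)"
      using m by simp
    also have "\<dots> \<noteq> 0" using m by (simp add: in_keys_iff)
    finally show False using assms by simp
  qed
  then have *: "Poly_Mapping.keys p \<subseteq> {0}"
    unfolding A_def using keys_eq_empty by blast
  have z: "Poly_Mapping.lookup p k = 0" if "k \<noteq> 0" for k
    using * that by (auto simp: in_keys_iff)
  have p: "p = dp_const (Poly_Mapping.lookup p 0)"
    by (intro poly_mapping_eqI) (simp add: dp_const_def lookup_single when_def z)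
  have "q = dp_const (dp_eval (\<lambda>_. 0) q)" if "q = dp_const c" for q c
    using that by simp
  from this[OF p] show ?thesis .
qed

section \<open>Pseudo-differential operators\<close>

lemma dx_pow_0 [simp]: "(dp_dx ^^ k) 0 = 0"
  by (induction k) (simp_all add: dp_dx_simps)

lemma dx_pow_add: "(dp_dx ^^ k) (p + q) = (dp_dx ^^ k) p + (dp_dx ^^ k) q"
  by (induction k) (simp_all add: dp_dx_simps)

lemma dx_pow_sum: "(dp_dx ^^ k) (sum f A) = (\<Sum>i\<in>A. (dp_dx ^^ k) (f i))"
  by (induction A rule: infinite_finite_induct) (simp_all add: dx_pow_add)

lemma dp_dx_const_mult: "dp_dx (dp_const c * p) = dp_const c * dp_dx p"
  by (simp add: dp_dx_simps)

lemma dx_pow_const_mult: "(dp_dx ^^ k) (dp_const c * p) = dp_const c * (dp_dx ^^ k) p"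
  by (induction k) (simp_all add: dp_dx_const_mult)

lemma dx_pow_1: "(dp_dx ^^ k) 1 = (if k = 0 then 1 else 0)"
  by (cases k) (simp_all add: funpow_swap1 dp_dx_simps del: funpow.simps(2) add: funpow_Suc_right)

lemma dx_pow_mult:
  "(dp_dx ^^ k) (b * c) = (\<Sum>a\<le>k. of_nat (k choose a) * (dp_dx ^^ a) b * (dp_dx ^^ (k - a)) c)"
proof (induction k)
  case (Suc k)
  define f where "f = (\<lambda>a. (dp_dx ^^ a) b)"
  define h where "h = (\<lambda>a. (dp_dx ^^ a) c)"
  have [simp]: "dp_dx (f a) = f (Suc a)" "dp_dx (h a) = h (Suc a)" for a by (simp_all add: f_def h_def)
  have nat: "dp_dx (of_nat n * p * q) = of_nat n * dp_dx p * q + of_nat n * p * dp_dx q" for n p q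
    using dp_dx_const_mult[of "of_nat n" p] by (simp add: dp_const_of_nat dp_dx_simps(2))
  have "(dp_dx ^^ Suc k) (b * c) = dp_dx (\<Sum>a\<le>k. of_nat (k choose a) * f a * h (k - a))"
    using Suc by (simp add: f_def h_def)
  also have "\<dots> = (\<Sum>a\<le>k. of_nat (k choose a) * f (Suc a) * h (k - a))
      + (\<Sum>a\<le>k. of_nat (k choose a) * f a * h (Suc (k - a)))"
    by (simp add: derivation_sum[OF derivation_dx] nat sum.distrib)
  also have "(\<Sum>a\<le>k. of_nat (k choose a) * f a * h (Suc (k - a)))
      = (\<Sum>a\<le>Suc k. of_nat (k choose a) * f a * h (Suc k - a))"
    by (simp add: Suc_diff_le)
  also have "\<dots> = f 0 * h (Suc k) + (\<Sum>a\<le>k. of_nat (k choose Suc a) * f (Suc a) * h (k - a))"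
    by (subst sum.atMost_Suc_shift) simp
  also have "(\<Sum>a\<le>k. of_nat (k choose a) * f (Suc a) * h (k - a)) + \<dots> =
      (\<Sum>a\<le>Suc k. of_nat (Suc k choose a) * f a * h (Suc k - a))"
    unfolding sum.atMost_Suc_shift[of _ k] by (simp add: sum.distrib algebra_simps)
  finally show ?case by (simp add: f_def h_def)
qed simp

text \<open>The product of operators in terms of their coefficients counted downwards from the formal leading
  ones, \<open>x\<close> being the order of the left factor.\<close>

definition pprod :: "complex \<Rightarrow> (nat \<Rightarrow> dpoly) \<Rightarrow> (nat \<Rightarrow> dpoly) \<Rightarrow> nat \<Rightarrow> dpoly" where
  "pprod x a b n = (\<Sum>(i, j)\<in>{(i, j). i + j \<le> n}.
     dp_const ((x - of_nat i) gchoose (n - i - j)) * a i * (dp_dx ^^ (n - i - j)) (b j))"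

lemma finite_triangle: "finite {(i, j). i + j \<le> (n :: nat)}"
  by (rule finite_subset[of _ "{..n} \<times> {..n}"]) auto

text \<open>Both sides are the coefficient t steps below the top in the composition of the x-th
  power of d/dx, b, the y-th power of d/dx and c, bracketed in the two ways. After the Leibniz rule
  and an exchange of sums, trinomial revision and the Vandermonde convolution match the
  binomials.\<close>

lemma pprod_assoc_inner:
  "(\<Sum>k\<le>t. dp_const ((x gchoose k) * ((x + y - of_nat k) gchoose (t - k))) * (dp_dx ^^ k) b * (dp_dx ^^ (t - k)) c)
   = (\<Sum>k\<le>t. dp_const ((x gchoose k) * (y gchoose (t - k))) * (dp_dx ^^ k) (b * (dp_dx ^^ (t - k)) c))"
proof -
  have "(\<Sum>k\<le>t. dp_const ((x gchoose k) * (y gchoose (t - k))) * (dp_dx ^^ k) (b * (dp_dx ^^ (t - k)) c))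
    = (\<Sum>k\<le>t. \<Sum>a\<le>k. dp_const ((x gchoose k) * (y gchoose (t - k)) * of_nat (k choose a)) * (dp_dx ^^ a) b * (dp_dx ^^ (t - a)) c)"
  proof (intro sum.cong refl)
    fix k assume "k \<in> {..t}"
    then have "(dp_dx ^^ (k - a)) ((dp_dx ^^ (t - k)) c) = (dp_dx ^^ (t - a)) c" if "a \<le> k" for a
      using that by (simp flip: funpow_add[THEN fun_cong, unfolded comp_def])
    then show "dp_const ((x gchoose k) * (y gchoose (t - k))) * (dp_dx ^^ k) (b * (dp_dx ^^ (t - k)) c)
      = (\<Sum>a\<le>k. dp_const ((x gchoose k) * (y gchoose (t - k)) * of_nat (k choose a)) * (dp_dx ^^ a) b * (dp_dx ^^ (t - a)) c)"
      by (simp add: dx_pow_mult sum_distrib_left dp_const_mult dp_const_of_nat mult.assoc)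
  qed
  also have "\<dots> = (\<Sum>a\<le>t. \<Sum>k=a..t. dp_const ((x gchoose k) * (y gchoose (t - k)) * of_nat (k choose a)) * (dp_dx ^^ a) b * (dp_dx ^^ (t - a)) c)"
    unfolding sum.Sigma[OF finite_atMost ballI, OF finite_atMost] sum.Sigma[OF finite_atMost ballI, OF finite_atLeastAtMost]
    by (rule sum.reindex_bij_witness[where i = "\<lambda>(a, k). (k, a)" and j = "\<lambda>(a, k). (k, a)"]) auto
  also have "\<dots> = (\<Sum>a\<le>t. dp_const ((x gchoose a) * ((x + y - of_nat a) gchoose (t - a))) * (dp_dx ^^ a) b * (dp_dx ^^ (t - a)) c)"
  proof (intro sum.cong refl)
    fix a assume "a \<in> {..t}"
    then have a: "a \<le> t" by simp
    have "(\<Sum>k=a..t. (x gchoose k) * (y gchoose (t - k)) * of_nat (k choose a))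
       = (\<Sum>k=a..t. (x gchoose a) * ((x - of_nat a gchoose (k - a)) * (y gchoose (t - k))))"
    proof (intro sum.cong refl)
      fix k assume "k \<in> {a..t}"
      then have "(x gchoose k) * of_nat (k choose a) = (x gchoose a) * (x - of_nat a gchoose (k - a))"
        using gbinomial_trinomial_revision[of a k x] by (simp add: binomial_gbinomial)
      then show "(x gchoose k) * (y gchoose (t - k)) * of_nat (k choose a) =
         (x gchoose a) * ((x - of_nat a gchoose (k - a)) * (y gchoose (t - k)))"
        by (simp add: mult.commute mult.left_commute mult.assoc)
    qed
    also have "\<dots> = (x gchoose a) * (\<Sum>k=0..t-a. (x - of_nat a gchoose k) * (y gchoose (t - a - k)))"
      unfolding sum_distrib_left
      by (rule sum.reindex_bij_witness[where i = "\<lambda>k. k + a" and j = "\<lambda>k. k - a"]) (use a in auto)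
    also have "(\<Sum>k=0..t-a. (x - of_nat a gchoose k) * (y gchoose (t - a - k))) = (x + y - of_nat a) gchoose (t - a)"
      using gbinomial_Vandermonde[of "x - of_nat a" y "t - a"] by (simp add: algebra_simps)
    finally show "(\<Sum>k=a..t. dp_const ((x gchoose k) * (y gchoose (t - k)) * of_nat (k choose a)) * (dp_dx ^^ a) b * (dp_dx ^^ (t - a)) c)
      = dp_const ((x gchoose a) * ((x + y - of_nat a) gchoose (t - a))) * (dp_dx ^^ a) b * (dp_dx ^^ (t - a)) c"
      by (simp flip: sum_distrib_right dp_const_sum)
  qed
  finally show ?thesis by simp
qed

text \<open>Both nested sums are reindexed by the positions \<open>(i, j, r)\<close> of the three
  coefficients together with a number \<open>k\<close> of derivatives. For a fixed triple the
  preceding identity applies, with exponents lowered by \<open>i\<close> and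
  \<open>j\<close>.\<close>

lemma pprod_assoc: "pprod (x + y) (pprod x a b) c n = pprod x a (pprod y b c) n"
proof -
  define F where "F i j r k l =
    dp_const ((x - of_nat i gchoose k) * ((x + y - of_nat (i + j + k)) gchoose l)) * a i * (dp_dx ^^ k) (b j) * (dp_dx ^^ l) (c r)"
    for i j r k l :: nat
  define G where "G i j r k l =
    dp_const ((x - of_nat i gchoose k) * (y - of_nat j gchoose l)) * a i * (dp_dx ^^ k) (b j * (dp_dx ^^ l) (c r))"
    for i j r k l :: nat
  define T where "T = {(i, j, r). i + j + r \<le> n}"
  have fT: "finite T" unfolding T_def by (rule finite_subset[of _ "{..n} \<times> {..n} \<times> {..n}"]) auto
  have "pprod (x + y) (pprod x a b) c n =
    (\<Sum>(p, r)\<in>{(p, r). p + r \<le> n}. \<Sum>(i, j)\<in>{(i, j). i + j \<le> p}. F i j r (p - i - j) (n - p - r))"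
    unfolding pprod_def[of "x + y"]
  proof (intro sum.cong refl, clarify)
    fix p r :: nat
    show "dp_const (x + y - of_nat p gchoose (n - p - r)) * pprod x a b p * (dp_dx ^^ (n - p - r)) (c r) =
      (\<Sum>(i, j)\<in>{(i, j). i + j \<le> p}. F i j r (p - i - j) (n - p - r))"
      unfolding pprod_def sum_distrib_left sum_distrib_right
      by (intro sum.cong refl) (auto simp: F_def dp_const_mult mult_ac)
  qed
  also have "\<dots> = (\<Sum>((p, r), (i, j))\<in>Sigma {(p, r). p + r \<le> n} (\<lambda>(p, r). {(i, j). i + j \<le> p}). F i j r (p - i - j) (n - p - r))"
    by (subst sum.Sigma[symmetric]) (auto simp: finite_triangle case_prod_beta)
  also have "\<dots> = (\<Sum>((i, j, r), k)\<in>Sigma T (\<lambda>(i, j, r). {..n - i - j - r}). F i j r k (n - i - j - r - k))"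
    by (rule sum.reindex_bij_witness[where i = "\<lambda>((i, j, r), k). ((i + j + k, r), (i, j))"
          and j = "\<lambda>((p, r), (i, j)). ((i, j, r), p - i - j)"]) (auto simp: T_def add.commute)
  also have "\<dots> = (\<Sum>(i, j, r)\<in>T. \<Sum>k\<le>n - i - j - r. F i j r k (n - i - j - r - k))"
    by (subst sum.Sigma[symmetric]) (auto simp: fT case_prod_beta)
  also have "\<dots> = (\<Sum>(i, j, r)\<in>T. \<Sum>k\<le>n - i - j - r. G i j r k (n - i - j - r - k))"
  proof (intro sum.cong refl, clarify)
    fix i j r
    have eq: "x + y - of_nat (i + j + k) = (x - of_nat i) + (y - of_nat j) - of_nat k" for k by simp
    have "(\<Sum>k\<le>n - i - j - r. F i j r k (n - i - j - r - k)) = a i * (\<Sum>k\<le>n - i - j - r.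
       dp_const ((x - of_nat i gchoose k) * ((x - of_nat i) + (y - of_nat j) - of_nat k gchoose (n - i - j - r - k)))
         * (dp_dx ^^ k) (b j) * (dp_dx ^^ (n - i - j - r - k)) (c r))"
      unfolding sum_distrib_left F_def eq by (intro sum.cong refl) (simp add: mult.assoc mult.left_commute)
    also have "\<dots> = (\<Sum>k\<le>n - i - j - r. G i j r k (n - i - j - r - k))"
      unfolding pprod_assoc_inner sum_distrib_left G_def
      by (intro sum.cong refl) (simp add: mult.assoc mult.left_commute)
    finally show "(\<Sum>k\<le>n - i - j - r. F i j r k (n - i - j - r - k)) = (\<Sum>k\<le>n - i - j - r. G i j r k (n - i - j - r - k))" .
  qed
  also have "\<dots> = (\<Sum>((i, j, r), k)\<in>Sigma T (\<lambda>(i, j, r). {..n - i - j - r}). G i j r k (n - i - j - r - k))"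
    by (subst sum.Sigma[symmetric]) (auto simp: fT case_prod_beta)
  also have "\<dots> = (\<Sum>((i, q), (j, r))\<in>Sigma {(i, q). i + q \<le> n} (\<lambda>(i, q). {(j, r). j + r \<le> q}). G i j r (n - i - q) (q - j - r))"
    by (rule sum.reindex_bij_witness[where i = "\<lambda>((i, q), (j, r)). ((i, j, r), n - i - q)"
          and j = "\<lambda>((i, j, r), k). ((i, n - i - k), (j, r))"]) (auto simp: T_def add_ac)
  also have "\<dots> = (\<Sum>(i, q)\<in>{(i, q). i + q \<le> n}. \<Sum>(j, r)\<in>{(j, r). j + r \<le> q}. G i j r (n - i - q) (q - j - r))"
    by (subst sum.Sigma[symmetric]) (auto simp: finite_triangle case_prod_beta)
  also have "\<dots> = pprod x a (pprod y b c) n"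
    unfolding pprod_def[of x]
  proof (intro sum.cong refl, clarify)
    fix i q :: nat
    have inner: "(dp_dx ^^ k) (dp_const e * d * d') = dp_const e * (dp_dx ^^ k) (d * d')" for k e d d'
      by (simp add: mult.assoc dx_pow_const_mult)
    show "(\<Sum>(j, r)\<in>{(j, r). j + r \<le> q}. G i j r (n - i - q) (q - j - r)) =
      dp_const (x - of_nat i gchoose (n - i - q)) * a i * (dp_dx ^^ (n - i - q)) (pprod y b c q)"
      unfolding pprod_def dx_pow_sum sum_distrib_left
      by (intro sum.cong refl)
        (auto simp: G_def dp_const_mult inner mult.left_commute)
  qed
  finally show ?thesis .
qed

definition psdo_order :: "psdo \<Rightarrow> int \<Rightarrow> bool" where
  "psdo_order A M \<longleftrightarrow> (\<forall>i>M. A i = 0)"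

text \<open>Bounded orders make the index set in \<open>psdo_mult\<close> finite, so that its sum is
  a genuine one and may be taken over any finite set outside which the terms vanish.\<close>

lemma psdo_mult_eq_sum:
  assumes A: "psdo_order A M" and B: "psdo_order B N" and "finite T"
    and zero: "\<And>i k. (i, k) \<notin> T \<Longrightarrow>
      dp_const ((of_int i :: complex) gchoose k) * A i * (dp_dx ^^ k) (B (m + int k - i)) = 0"
  shows "psdo_mult A B m =
    (\<Sum>(i, k)\<in>T. dp_const ((of_int i :: complex) gchoose k) * A i * (dp_dx ^^ k) (B (m + int k - i)))"
proof -
  have "finite {(i, k :: nat). A i \<noteq> 0 \<and> B (m + int k - i) \<noteq> 0}"
  proof (rule finite_subset)
    show "{(i, k :: nat). A i \<noteq> 0 \<and> B (m + int k - i) \<noteq> 0} \<subseteq> {m - N..M} \<times> {..nat (M + N - m)}"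
    proof clarify
      fix i and k :: nat
      assume "A i \<noteq> 0" "B (m + int k - i) \<noteq> 0"
      then have "i \<le> M" "m + int k - i \<le> N"
        using A B by (auto simp: psdo_order_def not_less[symmetric])
      then show "i \<in> {m - N..M} \<and> k \<in> {..nat (M + N - m)}" by auto
    qed
  qed simp
  then show ?thesis unfolding psdo_mult_def
  proof (rule sum.mono_neutral_cong[OF assms(3)])
    show "(case x of (i, k) \<Rightarrow> dp_const ((of_int i :: complex) gchoose k) * A i * (dp_dx ^^ k) (B (m + int k - i))) = 0"
      if "x \<in> {(i, k). A i \<noteq> 0 \<and> B (m + int k - i) \<noteq> 0} - T" for x
      using that zero[of "fst x" "snd x"] by (simp add: case_prod_beta)
  qed auto
qed

lemma psdo_order_mult:
  assumes A: "psdo_order A M" and B: "psdo_order B N"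
  shows "psdo_order (psdo_mult A B) (M + N)"
  unfolding psdo_order_def
proof (intro allI impI)
  fix m assume m: "m > M + N"
  have "psdo_mult A B m = (\<Sum>(i, k)\<in>{}. dp_const ((of_int i :: complex) gchoose k) * A i * (dp_dx ^^ k) (B (m + int k - i)))"
  proof (rule psdo_mult_eq_sum[OF A B])
    fix i and k :: nat
    have "i > M \<or> m + int k - i > N" using m by linarith
    then show "dp_const ((of_int i :: complex) gchoose k) * A i * (dp_dx ^^ k) (B (m + int k - i)) = 0"
      using A B by (auto simp: psdo_order_def)
  qed simp
  then show "psdo_mult A B m = 0" by simp
qed

lemma psdo_mult_pprod:
  assumes A: "psdo_order A M" and B: "psdo_order B N"
  shows "psdo_mult A B (M + N - int n) = pprod (of_int M) (\<lambda>i. A (M - int i)) (\<lambda>j. B (N - int j)) n"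
proof -
  define f where "f = (\<lambda>(i :: nat, j :: nat). (M - int i, n - i - j))"
  define T where "T = f ` {(i, j). i + j \<le> n}"
  have inj: "inj_on f {(i, j). i + j \<le> n}" by (auto simp: f_def inj_on_def)
  have "psdo_mult A B (M + N - int n) =
    (\<Sum>(i, k)\<in>T. dp_const ((of_int i :: complex) gchoose k) * A i * (dp_dx ^^ k) (B ((M + N - int n) + int k - i)))"
  proof (rule psdo_mult_eq_sum[OF A B])
    fix i and k :: nat assume nT: "(i, k) \<notin> T"
    have "A i = 0 \<or> B (M + N - int n + int k - i) = 0"
    proof (rule ccontr)
      assume "\<not> ?thesis"
      then have *: "i \<le> M" "M + N - int n + int k - i \<le> N"
        using A B by (auto simp: psdo_order_def not_less[symmetric])
      define p j where "p = nat (M - i)" and "j = n - p - k"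
      have "f (p, j) = (i, k)" "p + j \<le> n" using * by (auto simp: f_def p_def j_def)
      then show False using nT by (force simp: T_def)
    qed
    then show "dp_const ((of_int i :: complex) gchoose k) * A i * (dp_dx ^^ k) (B (M + N - int n + int k - i)) = 0"
      by auto
  qed (simp add: T_def finite_triangle)
  also have "\<dots> = pprod (of_int M) (\<lambda>i. A (M - int i)) (\<lambda>j. B (N - int j)) n"
    unfolding T_def sum.reindex[OF inj] pprod_def
  proof (intro sum.cong refl, clarify)
    fix i j :: nat assume "i + j \<le> n"
    then have "M + N - int n + int (n - i - j) - (M - int i) = N - int j" by simp
    then show "((\<lambda>(i, k). dp_const (of_int i gchoose k) * A i * (dp_dx ^^ k) (B (M + N - int n + int k - i))) \<circ> f) (i, j) =
      dp_const (of_int M - of_nat i gchoose (n - i - j)) * A (M - int i) * (dp_dx ^^ (n - i - j)) (B (N - int j))"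
      by (simp add: f_def)
  qed
  finally show ?thesis .
qed

lemma psdo_mult_assoc:
  assumes A: "psdo_order A M" and B: "psdo_order B N" and C: "psdo_order C P"
  shows "psdo_mult (psdo_mult A B) C = psdo_mult A (psdo_mult B C)"
proof
  fix m
  note AB = psdo_order_mult[OF A B] and BC = psdo_order_mult[OF B C]
  show "psdo_mult (psdo_mult A B) C m = psdo_mult A (psdo_mult B C) m"
  proof (cases "m \<le> M + N + P")
    case True
    define n where "n = nat (M + N + P - m)"
    have m: "m = M + N + P - int n" using True by (simp add: n_def)
    show ?thesis
      unfolding m psdo_mult_pprod[OF AB C] psdo_mult_pprod[OF A B]
      unfolding add.assoc[of M N P] psdo_mult_pprod[OF A BC] psdo_mult_pprod[OF B C]
      using pprod_assoc by simp
  next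
    case False
    then show ?thesis
      using psdo_order_mult[OF AB C] psdo_order_mult[OF A BC] by (auto simp: psdo_order_def)
  qed
qed

section \<open>The square root of \<open>Q\<close>\<close>

text \<open>The part of the n-th coefficient of a square that involves only earlier coefficients;
  removing it makes the equation for the square root triangular.\<close>

definition pprod_lower :: "(nat \<Rightarrow> dpoly) \<Rightarrow> nat \<Rightarrow> dpoly" where
  "pprod_lower s n = (\<Sum>(i, j)\<in>{(i, j). i + j \<le> n \<and> i < n \<and> j < n}.
     dp_const ((1 - of_nat i) gchoose (n - i - j)) * s i * (dp_dx ^^ (n - i - j)) (s j))"

lemma pprod_lower_cong: "(\<And>i. i < n \<Longrightarrow> s i = s' i) \<Longrightarrow> pprod_lower s n = pprod_lower s' n"
  unfolding pprod_lower_def by (intro sum.cong refl) auto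

lemma pprod_square:
  assumes "n > 0" "s 0 = 1"
  shows "pprod 1 s s n = 2 * s n + pprod_lower s n"
proof -
  have *: "{(i, j). i + j \<le> n} = insert (n, 0) (insert (0, n) {(i, j). i + j \<le> n \<and> i < n \<and> j < n})"
    by auto
  have fin: "finite {(i, j). i + j \<le> n \<and> i < n \<and> j < n}"
    by (rule finite_subset[OF _ finite_triangle[of n]]) auto
  show ?thesis unfolding pprod_def * using assms fin
    by (simp add: pprod_lower_def)
qed

lemma psdo_Q_index: "psdo_Q (2 - int n) = (if n = 0 then 1 else if n = 2 then dp_u else 0)"
  by (auto simp: psdo_Q_def)

lemma psdo_order_Q: "psdo_order psdo_Q 2"
  by (auto simp: psdo_order_def psdo_Q_def)

lemma psdo_square_iff:
  assumes S: "psdo_order S 1"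
  shows "psdo_mult S S = psdo_Q \<longleftrightarrow> (\<forall>n. pprod 1 (\<lambda>i. S (1 - int i)) (\<lambda>i. S (1 - int i)) n = psdo_Q (2 - int n))"
proof -
  have eq: "psdo_mult S S (2 - int n) = pprod 1 (\<lambda>i. S (1 - int i)) (\<lambda>i. S (1 - int i)) n" for n
    using psdo_mult_pprod[OF S S, of n] by simp
  show ?thesis
  proof
    assume "psdo_mult S S = psdo_Q" then show "\<forall>n. pprod 1 (\<lambda>i. S (1 - int i)) (\<lambda>i. S (1 - int i)) n = psdo_Q (2 - int n)"
      by (simp flip: eq)
  next
    assume *: "\<forall>n. pprod 1 (\<lambda>i. S (1 - int i)) (\<lambda>i. S (1 - int i)) n = psdo_Q (2 - int n)"
    show "psdo_mult S S = psdo_Q"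
    proof
      fix m
      show "psdo_mult S S m = psdo_Q m"
      proof (cases "m \<le> 2")
        case True
        then show ?thesis using *[rule_format, of "nat (2 - m)"] eq[of "nat (2 - m)"] by simp
      next
        case False
        then show ?thesis using psdo_order_mult[OF S S] psdo_order_Q by (auto simp: psdo_order_def)
      qed
    qed
  qed
qed

lemma dp_const_half: "dp_const (1/2) * (2 * p) = p"
  using dp_const_mult[of "1/2" 2] by (simp flip: mult.assoc)

text \<open>At each order the equation gives twice the new coefficient in terms of the earlier ones,
  so well-founded recursion gives existence and induction gives uniqueness.\<close>

lemma sqrt_Q_ex1: "\<exists>!S. S 1 = 1 \<and> (\<forall>i>1. S i = 0) \<and> psdo_mult S S = psdo_Q"
proof -
  define H where "H f n = (if n = 0 then 1 else dp_const (1/2) * (psdo_Q (2 - int n) - pprod_lower f n))"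
    for f :: "nat \<Rightarrow> dpoly" and n :: nat
  define s where "s = wfrec less_than H"
  have s_rec: "s n = H s n" for n
  proof -
    have "s n = H (cut s less_than n) n" unfolding s_def by (rule wfrec) simp
    also have "\<dots> = H s n" unfolding H_def
      by (intro if_cong refl arg_cong2[where f = "(*)"] arg_cong2[where f = "(-)"] pprod_lower_cong)
        (simp add: cut_def)
    finally show ?thesis .
  qed
  define S where "S = (\<lambda>i::int. if i \<le> 1 then s (nat (1 - i)) else 0)"
  have S: "psdo_order S 1" by (simp add: psdo_order_def S_def)
  have s0: "s 0 = 1" using s_rec[of 0] by (simp add: H_def)
  have S_s: "(\<lambda>i. S (1 - int i)) = s" by (auto simp: S_def)
  have "pprod 1 s s n = psdo_Q (2 - int n)" for n
  proof (cases "n = 0")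
    case True
    have "{(i, j). i + j \<le> (0::nat)} = {(0, 0)}" by auto
    then show ?thesis using True by (simp add: pprod_def s0 psdo_Q_def)
  next
    case False
    then have "s n = dp_const (1/2) * (psdo_Q (2 - int n) - pprod_lower s n)"
      using s_rec[of n] by (simp add: H_def)
    then have "2 * s n = psdo_Q (2 - int n) - pprod_lower s n"
      by (simp only: mult.left_commute[of 2] dp_const_half)
    then show ?thesis using False by (simp add: pprod_square s0)
  qed
  then have ex: "psdo_mult S S = psdo_Q" by (simp add: psdo_square_iff[OF S] S_s)
  show ?thesis
  proof (rule ex1I[of _ S])
    show "S 1 = 1 \<and> (\<forall>i>1. S i = 0) \<and> psdo_mult S S = psdo_Q"
      using ex s0 by (simp add: S_def)
  next
    fix S' :: psdo assume S': "S' 1 = 1 \<and> (\<forall>i>1. S' i = 0) \<and> psdo_mult S' S' = psdo_Q"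
    define s' where "s' = (\<lambda>i. S' (1 - int i))"
    have ord: "psdo_order S' 1" using S' by (simp add: psdo_order_def)
    have eq: "pprod 1 s' s' n = psdo_Q (2 - int n)" for n
      using S' psdo_square_iff[OF ord] by (simp add: s'_def)
    have "s' n = s n" for n
    proof (induction n rule: less_induct)
      case (less n)
      show ?case
      proof (cases "n = 0")
        case True then show ?thesis using S' by (simp add: s'_def s0)
      next
        case False
        have "s' 0 = 1" using S' by (simp add: s'_def)
        then have "2 * s' n = psdo_Q (2 - int n) - pprod_lower s' n"
          using eq[of n] False by (simp add: pprod_square eq_diff_eq)
        moreover have "pprod_lower s' n = pprod_lower s n" using less by (rule pprod_lower_cong)
        ultimately have "dp_const (1/2) * (2 * s' n) = s n"
          using s_rec[of n] False by (simp add: H_def)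
        then show ?thesis by (simp only: dp_const_half)
      qed
    qed
    then have *: "S' (1 - int n) = s n" for n by (simp add: s'_def)
    show "S' = S"
    proof
      fix i show "S' i = S i"
        using S' *[of "nat (1 - i)"] by (cases "i \<le> 1") (auto simp: S_def)
    qed
  qed
qed

lemma sqrt_Q: "psdo_sqrt_Q 1 = 1" "psdo_order psdo_sqrt_Q 1" "psdo_mult psdo_sqrt_Q psdo_sqrt_Q = psdo_Q"
  using theI'[OF sqrt_Q_ex1] by (auto simp: psdo_sqrt_Q_def psdo_order_def)

text \<open>Off by one: this is the power with exponent k + 1, so the residue defining
  \<open>gd (Suc k)\<close> is taken from \<open>sqrt_pow (2 * k)\<close>.\<close>

definition sqrt_pow :: "nat \<Rightarrow> psdo" where
  "sqrt_pow k = (psdo_mult psdo_sqrt_Q ^^ k) psdo_sqrt_Q"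

lemma sqrt_pow_Suc: "sqrt_pow (Suc k) = psdo_mult psdo_sqrt_Q (sqrt_pow k)"
  by (simp add: sqrt_pow_def)

lemma sqrt_pow_order: "psdo_order (sqrt_pow k) (int k + 1)"
proof (induction k)
  case (Suc k)
  then show ?case using psdo_order_mult[OF sqrt_Q(2) Suc] by (simp add: sqrt_pow_Suc add.commute)
qed (simp add: sqrt_pow_def sqrt_Q)

text \<open>Lets Q be moved across a power of its root; comparing the two products with Q is the
  source of the recursion.\<close>

lemma sqrt_pow_commute: "psdo_mult (sqrt_pow k) psdo_sqrt_Q = psdo_mult psdo_sqrt_Q (sqrt_pow k)"
proof (induction k)
  case (Suc k)
  then show ?case
    by (simp add: sqrt_pow_Suc psdo_mult_assoc[OF sqrt_Q(2) sqrt_pow_order sqrt_Q(2)])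
qed (simp add: sqrt_pow_def)

lemma sqrt_pow_Q_left: "sqrt_pow (Suc (Suc k)) = psdo_mult psdo_Q (sqrt_pow k)"
  using psdo_mult_assoc[OF sqrt_Q(2) sqrt_Q(2) sqrt_pow_order, of k]
  by (simp add: sqrt_pow_Suc sqrt_Q(3))

lemma sqrt_pow_Q_right: "sqrt_pow (Suc (Suc k)) = psdo_mult (sqrt_pow k) psdo_Q"
  using psdo_mult_assoc[OF sqrt_pow_order sqrt_Q(2) sqrt_Q(2), of k]
    psdo_mult_assoc[OF sqrt_Q(2) sqrt_pow_order sqrt_Q(2), of k]
  by (simp add: sqrt_pow_Suc sqrt_Q(3) sqrt_pow_commute)

section \<open>The Lenard recursion\<close>

abbreviation (input) gd :: "nat \<Rightarrow> dpoly" where "gd \<equiv> gelfand_dickey"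

lemma gd_0: "gd 0 = 1"
  by (simp add: gelfand_dickey_def)

lemma gd_Suc: "gd (Suc k) = sqrt_pow (2 * k) (-1)"
  by (simp add: gelfand_dickey_def psdo_Q_half_pow_def sqrt_pow_def)

lemma gbinomial_of_int_eq_0:
  assumes "0 \<le> i" "i < int k"
  shows "(of_int i :: complex) gchoose k = 0"
  using assms by (metis binomial_eq_0 binomial_gbinomial of_int_of_nat_eq of_nat_0 of_nat_less_iff zero_le_imp_eq_int)

lemma psdo_mult_Q_left:
  assumes A: "psdo_order A N"
  shows "psdo_mult psdo_Q A m = A (m - 2) + 2 * dp_dx (A (m - 1)) + dp_dx (dp_dx (A m)) + dp_u * A m"
proof -
  have "psdo_mult psdo_Q A m = (\<Sum>(i, k)\<in>{(2, 0), (2, 1), (2, 2), (0, 0)}.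
      dp_const ((of_int i :: complex) gchoose k) * psdo_Q i * (dp_dx ^^ k) (A (m + int k - i)))"
  proof (rule psdo_mult_eq_sum[OF psdo_order_Q A])
    fix i :: int and k :: nat
    assume *: "(i, k) \<notin> {(2, 0), (2, 1), (2, 2), (0, 0)}"
    consider "i = 0" "k > 0" | "i = 2" "k > 2" | "i \<noteq> 0" "i \<noteq> 2"
      using * by (cases "i = 0"; cases "i = 2"; force)
    then show "dp_const ((of_int i :: complex) gchoose k) * psdo_Q i * (dp_dx ^^ k) (A (m + int k - i)) = 0"
    proof cases
      case 3 then show ?thesis by (simp add: psdo_Q_def)
    qed (simp_all add: gbinomial_of_int_eq_0 del: of_int_numeral of_int_0)
  qed simp
  also have "\<dots> = A (m - 2) + 2 * dp_dx (A (m - 1)) + dp_dx (dp_dx (A m)) + dp_u * A m"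
    by (simp add: psdo_Q_def numeral_2_eq_2 gbinomial_Suc)
  finally show ?thesis .
qed

text \<open>Multiplication by u from the right gives terms with the binomial (i choose k), where i =
  m + k. These vanish for 0 <= i < k; as m is negative, only the finitely many negative i
  remain.\<close>

lemma psdo_mult_Q_right:
  assumes A: "psdo_order A N"
  shows "psdo_mult A psdo_Q (-1) = A (-3) + dp_u * A (-1)"
    and "psdo_mult A psdo_Q (-2) = A (-4) + dp_u * A (-2) - dp_dx dp_u * A (-1)"
proof -
  have zero: "dp_const ((of_int i :: complex) gchoose k) * A i * (dp_dx ^^ k) (psdo_Q (m + int k - i)) = 0"
    if "m + int k - i = 2 \<Longrightarrow> k \<noteq> 0" "m + int k - i = 0 \<Longrightarrow> 0 \<le> i \<and> i < int k" for i k m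
    using that by (cases "m + int k - i = 2"; cases "m + int k - i = 0")
      (simp_all add: psdo_Q_def dx_pow_1 gbinomial_of_int_eq_0)
  have "psdo_mult A psdo_Q (-1) = (\<Sum>(i, k)\<in>{(-3, 0), (-1, 0)}.
      dp_const ((of_int i :: complex) gchoose k) * A i * (dp_dx ^^ k) (psdo_Q (-1 + int k - i)))"
  proof (rule psdo_mult_eq_sum[OF A psdo_order_Q], simp, rule zero)
    fix i :: int and k :: nat
    assume *: "(i, k) \<notin> {(-3, 0), (-1, 0)}" and i: "-1 + int k - i = 0"
    have "i = int k - 1" using i by simp
    moreover have "k \<noteq> 0" using * calculation by auto
    ultimately show "0 \<le> i \<and> i < int k" by auto
  qed auto
  then show "psdo_mult A psdo_Q (-1) = A (-3) + dp_u * A (-1)"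
    by (simp add: psdo_Q_def mult.commute)
  have "psdo_mult A psdo_Q (-2) = (\<Sum>(i, k)\<in>{(-4, 0), (-2, 0), (-1, 1)}.
      dp_const ((of_int i :: complex) gchoose k) * A i * (dp_dx ^^ k) (psdo_Q (-2 + int k - i)))"
  proof (rule psdo_mult_eq_sum[OF A psdo_order_Q], simp, rule zero)
    fix i :: int and k :: nat
    assume *: "(i, k) \<notin> {(-4, 0), (-2, 0), (-1, 1)}" and i: "-2 + int k - i = 0"
    have "i = int k - 2" using i by simp
    moreover have "k \<noteq> 0" "k \<noteq> 1" using * calculation by auto
    ultimately show "0 \<le> i \<and> i < int k" by auto
  qed auto
  then show "psdo_mult A psdo_Q (-2) = A (-4) + dp_u * A (-2) - dp_dx dp_u * A (-1)"
    by (simp add: psdo_Q_def mult.commute dp_const_uminus)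
qed

text \<open>The orders 1, 0 and -1 of the square root of Q have coefficients 1, 0 and u/2.\<close>

lemma gd_1: "2 * gd 1 = dp_u"
proof -
  define s where "s = (\<lambda>i. psdo_sqrt_Q (1 - int i))"
  have s0: "s 0 = 1" by (simp add: s_def sqrt_Q)
  have sq: "2 * s n + pprod_lower s n = psdo_Q (2 - int n)" if "n > 0" for n
    using psdo_square_iff[OF sqrt_Q(2)] sqrt_Q(3) pprod_square[of n s, OF that s0] by (simp add: s_def)
  have "{(i, j). i + j \<le> 1 \<and> i < 1 \<and> j < (1::nat)} = {(0, 0)}" by auto
  then have "pprod_lower s 1 = 0" by (simp add: pprod_lower_def s0 dp_dx_simps)
  then have "2 * s 1 = 0" using sq[of 1] by (simp add: psdo_Q_def)
  then have s1: "s 1 = 0" by (metis dp_const_half mult_zero_right)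
  have "{(i, j). i + j \<le> 2 \<and> i < 2 \<and> j < (2::nat)} = {(0, 0), (0, 1), (1, 0), (1, 1)}" by auto
  then have "pprod_lower s 2 = 0" using s1
    by (simp add: pprod_lower_def s0 dp_dx_simps numeral_2_eq_2)
  then have "2 * s 2 = dp_u" using sq[of 2] by (simp add: psdo_Q_def)
  then show ?thesis by (simp add: s_def gd_Suc[of 0, simplified] sqrt_pow_def)
qed

lemma dpoly_cancel_numeral:
  assumes "numeral k * p = numeral k * (q :: dpoly)" shows "p = q"
  using assms by simp

text \<open>For an odd power A of the root, the orders -1 and -2 of Q A = A Q relate the
  coefficients of A at -1, -2 and -3. Eliminating the last two from the residue of A Q leaves the
  recursion. As \<open>gd 0\<close> is 1 by convention and not a residue, the first instance is
  computed from R_1.\<close>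

lemma gd_recursion:
  "4 * dp_dx (gd (Suc n)) = dp_dx (dp_dx (dp_dx (gd n))) + 4 * dp_u * dp_dx (gd n) + 2 * dp_dx dp_u * gd n"
proof (cases n)
  case 0
  have "2 * dp_dx (gd 1) = dp_dx dp_u"
    using arg_cong[OF gd_1, of dp_dx] dp_dx_const_mult[of 2 "gd 1"] by simp
  then have "2 * (2 * dp_dx (gd 1)) = 2 * dp_dx dp_u" by (simp only:)
  then show ?thesis using 0 by (simp add: gd_0 dp_dx_simps)
next
  case (Suc k)
  define A where "A = sqrt_pow (2 * k)"
  have A: "psdo_order A (int (2 * k) + 1)" unfolding A_def by (rule sqrt_pow_order)
  have next_gd: "gd (Suc (Suc k)) = psdo_mult A psdo_Q (-1)"
    using sqrt_pow_Q_right[of "2 * k"] by (simp add: gd_Suc A_def)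
  have comm: "psdo_mult psdo_Q A m = psdo_mult A psdo_Q m" for m
    using sqrt_pow_Q_right[of "2 * k"] sqrt_pow_Q_left[of "2 * k"] by (simp add: A_def)
  have e1: "2 * dp_dx (A (-2)) + dp_dx (dp_dx (A (-1))) = 0"
    using comm[of "-1"] psdo_mult_Q_left[OF A, of "-1"] psdo_mult_Q_right(1)[OF A] by simp
  have e2: "2 * dp_dx (A (-3)) + dp_dx (dp_dx (A (-2))) + dp_dx dp_u * A (-1) = 0"
    using comm[of "-2"] psdo_mult_Q_left[OF A, of "-2"] psdo_mult_Q_right(2)[OF A] by (simp add: algebra_simps)
  have two: "dp_dx (2 * p) = 2 * dp_dx p" for p
    using dp_dx_const_mult[of 2 p] by simp
  have e3: "2 * dp_dx (dp_dx (A (-2))) + dp_dx (dp_dx (dp_dx (A (-1)))) = 0"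
    using arg_cong[OF e1, of dp_dx] by (simp add: dp_dx_simps(1,3) two)
  have "4 * dp_dx (gd (Suc (Suc k))) = 4 * dp_dx (A (-3)) + 4 * dp_dx dp_u * A (-1) + 4 * dp_u * dp_dx (A (-1))"
    by (simp add: next_gd psdo_mult_Q_right(1)[OF A] dp_dx_simps(1,2) algebra_simps)
  \<comment> \<open>Twice the relation at order -2 minus the x-derivative of the relation at order
    -1 eliminates \<open>A (-2)\<close>.\<close>
  also have "4 * dp_dx (A (-3)) = 2 * (2 * dp_dx (A (-3)) + dp_dx (dp_dx (A (-2))) + dp_dx dp_u * A (-1))
     - (2 * dp_dx (dp_dx (A (-2))) + dp_dx (dp_dx (dp_dx (A (-1)))))
     + dp_dx (dp_dx (dp_dx (A (-1)))) - 2 * dp_dx dp_u * A (-1)" by (simp add: algebra_simps)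
  also have "\<dots> = dp_dx (dp_dx (dp_dx (A (-1)))) - 2 * dp_dx dp_u * A (-1)"
    unfolding e2 e3 by simp
  finally show ?thesis using Suc by (simp add: gd_Suc A_def algebra_simps)
qed

section \<open>Values at the zero jet\<close>

lemma dp_eval_zero_dx_pow: "dp_eval (\<lambda>_. 0) ((dp_dx ^^ k) p) = (if k = 0 then dp_eval (\<lambda>_. 0) p else 0)"
  by (cases k) (simp_all add: dp_eval_zero_dx)

text \<open>At the zero jet all terms containing a derivative vanish, so composition of operators
  degenerates to multiplication of power series.\<close>

lemma dp_eval_zero_pprod:
  "dp_eval (\<lambda>_. 0) (pprod x a b n) = (\<Sum>i\<le>n. dp_eval (\<lambda>_. 0) (a i) * dp_eval (\<lambda>_. 0) (b (n - i)))"
proof -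
  have "dp_eval (\<lambda>_. 0) (pprod x a b n) = (\<Sum>(i, j)\<in>{(i, j). i + j \<le> n}.
      if j = n - i then dp_eval (\<lambda>_. 0) (a i) * dp_eval (\<lambda>_. 0) (b (n - i)) else 0)"
    unfolding pprod_def dp_eval_sum
    by (intro sum.cong refl) (auto simp: dp_eval_mult dp_eval_zero_dx_pow)
  also have "\<dots> = (\<Sum>i\<le>n. dp_eval (\<lambda>_. 0) (a i) * dp_eval (\<lambda>_. 0) (b (n - i)))"
  proof -
    have "{(i, j). i + j \<le> n} = Sigma {..n} (\<lambda>i. {..n - i})" by auto
    then show ?thesis by (simp add: sum.Sigma[symmetric])
  qed
  finally show ?thesis .
qed

lemma dp_eval_zero_sqrt: "dp_eval (\<lambda>_. 0) (psdo_sqrt_Q (1 - int n)) = (if n = 0 then 1 else 0)"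
proof (induction n rule: less_induct)
  case (less n)
  define f where "f i = dp_eval (\<lambda>_. 0) (psdo_sqrt_Q (1 - int i))" for i
  show ?case
  proof (cases "n = 0")
    case False
    have "(\<Sum>i\<le>n. f i * f (n - i)) = dp_eval (\<lambda>_. 0) (psdo_Q (2 - int n))"
      using psdo_square_iff[OF sqrt_Q(2), THEN iffD1, OF sqrt_Q(3), rule_format, of n, symmetric]
      by (simp only: dp_eval_zero_pprod f_def)
    also have "\<dots> = 0" using False by (simp add: psdo_Q_index dp_u_eq_var)
    \<comment> \<open>By the induction hypothesis only the two end terms survive.\<close>
    also have "(\<Sum>i\<le>n. f i * f (n - i)) = (\<Sum>i\<le>n. if i = 0 then f n else if i = n then f n else 0)"
      using less False by (intro sum.cong refl) (auto simp: f_def sqrt_Q)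
    also have "\<dots> = (\<Sum>i\<in>{0, n}. f n)"
      by (rule sum.mono_neutral_cong_right) auto
    also have "\<dots> = 2 * f n" using False by simp
    finally show ?thesis using False by (simp add: f_def)
  qed (simp add: sqrt_Q)
qed

lemma dp_eval_zero_sqrt_pow:
  "dp_eval (\<lambda>_. 0) (sqrt_pow k (int k + 1 - int n)) = (if n = 0 then 1 else 0)"
proof (induction k arbitrary: n)
  case (Suc k)
  have "sqrt_pow (Suc k) (1 + (int k + 1) - int n) =
      pprod (of_int 1) (\<lambda>i. psdo_sqrt_Q (1 - int i)) (\<lambda>i. sqrt_pow k (int k + 1 - int i)) n"
    unfolding sqrt_pow_Suc by (rule psdo_mult_pprod[OF sqrt_Q(2) sqrt_pow_order])
  then have "dp_eval (\<lambda>_. 0) (sqrt_pow (Suc k) (1 + (int k + 1) - int n)) =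
      (\<Sum>i\<le>n. (if i = 0 then 1 else 0) * (if n - i = 0 then 1 else 0))"
    by (simp only: dp_eval_zero_pprod dp_eval_zero_sqrt Suc)
  moreover have "int (Suc k) + 1 - int n = 1 + (int k + 1) - int n" by simp
  ultimately show ?case by (simp only:) (simp add: if_distrib[of "\<lambda>x. x * _"] cong: if_cong)
qed (simp add: sqrt_pow_def dp_eval_zero_sqrt)

text \<open>For u = 0 the root of Q is d/dx, whose positive powers have no residue. This supplies
  the integration constants of the quadratic relation.\<close>

lemma dp_eval_zero_gd: "dp_eval (\<lambda>_. 0) (gd n) = (if n = 0 then 1 else 0)"
proof (cases n)
  case (Suc k)
  then show ?thesis using dp_eval_zero_sqrt_pow[of "2 * k" "2 * k + 2"] by (simp add: gd_Suc)
qed (simp add: gd_0)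

section \<open>Generating functions\<close>

definition fps_lift :: "('a \<Rightarrow> 'b) \<Rightarrow> 'a fps \<Rightarrow> 'b fps" where
  "fps_lift d f = Abs_fps (\<lambda>n. d (fps_nth f n))"

lemma fps_lift_nth [simp]: "fps_nth (fps_lift d f) n = d (fps_nth f n)"
  by (simp add: fps_lift_def)

lemma derivation_fps_lift:
  assumes "derivation d" shows "derivation (fps_lift d)"
  unfolding derivation_def
  by (auto simp: fps_eq_iff derivationD[OF assms] fps_mult_nth derivation_sum[OF assms] sum.distrib)

lemma derivation_of_nat:
  assumes "derivation d" shows "d (of_nat n) = 0"
  by (induction n) (simp_all add: derivationD[OF assms] derivation_0[OF assms] derivation_1[OF assms])

lemma derivation_numeral:
  assumes "derivation d" shows "d (numeral k) = 0"
  using derivation_of_nat[OF assms, of "numeral k"] by simp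

lemma fps_lift_X:
  assumes "derivation d" shows "fps_lift d fps_X = 0"
  by (auto simp: fps_eq_iff fps_X_def derivation_0[OF assms] derivation_1[OF assms])

lemma fps_lift_const: "d 0 = 0 \<Longrightarrow> fps_lift d (fps_const c) = fps_const (d c)"
  by (auto simp: fps_eq_iff)

lemma fps_lift_commute: "(\<And>p. d (e p) = e (d p)) \<Longrightarrow> fps_lift d (fps_lift e f) = fps_lift e (fps_lift d f)"
  by (simp add: fps_eq_iff)

lemma fps_lift_deriv:
  assumes "derivation d" shows "fps_lift d (fps_deriv f) = fps_deriv (fps_lift d f)"
proof -
  have "d (1 + of_nat n) = 0" for n
    by (simp add: derivationD(1)[OF assms] derivation_1[OF assms] derivation_of_nat[OF assms])
  then show ?thesis by (simp add: fps_eq_iff derivationD(2)[OF assms])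
qed

abbreviation (input) dx :: "dpoly fps \<Rightarrow> dpoly fps" where "dx \<equiv> fps_lift dp_dx"

lemmas derivation_dx_fps = derivation_fps_lift[OF derivation_dx]

lemmas dx_fps_simps = derivationD[OF derivation_dx_fps] derivation_0[OF derivation_dx_fps]
  derivation_diff[OF derivation_dx_fps] derivation_uminus[OF derivation_dx_fps]
  fps_lift_X[OF derivation_dx] derivation_numeral[OF derivation_dx_fps]

text \<open>The formal variable \<open>fps_X\<close> plays the role of 1/lambda.\<close>

definition gd_fps :: "dpoly fps" where
  "gd_fps = Abs_fps gelfand_dickey"

definition u_fps :: "dpoly fps" where
  "u_fps = fps_const dp_u"

lemma gd_fps_recursion:
  "fps_X * (dx (dx (dx gd_fps)) + 4 * u_fps * dx gd_fps + 2 * dx u_fps * gd_fps) = 4 * dx gd_fps"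
proof (rule fps_ext)
  fix n
  show "fps_nth (fps_X * (dx (dx (dx gd_fps)) + 4 * u_fps * dx gd_fps + 2 * dx u_fps * gd_fps)) n
    = fps_nth (4 * dx gd_fps) n"
    using gd_recursion[of "n - 1"]
    by (cases n) (simp_all add: gd_fps_def u_fps_def fps_lift_const dp_dx_simps gd_0
      numeral_fps_const[symmetric] fps_const_mult mult.assoc fps_numeral_nth)
qed

text \<open>The first integral of the third-order recursion: its x-derivative is 2p (p''' + 4u p' +
  2u' p). It gives the quadratic equation of the diagonal resolvent of Q.\<close>

definition quad_form :: "dpoly fps \<Rightarrow> dpoly fps" where
  "quad_form p = 2 * p * dx (dx p) - (dx p)\<^sup>2 + 4 * u_fps * p\<^sup>2"

lemma gd_fps_quadratic: "4 * gd_fps\<^sup>2 = 4 + fps_X * quad_form gd_fps"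
proof -
  define P where "P = gd_fps"
  define G where "G = fps_X * quad_form P - 4 * P\<^sup>2"
  have "dx G = 2 * P * (fps_X * (dx (dx (dx P)) + 4 * u_fps * dx P + 2 * dx u_fps * P) - 4 * dx P)"
    by (simp add: G_def quad_form_def power2_eq_square dx_fps_simps mult.assoc) (simp add: algebra_simps)
  also have "\<dots> = 0" by (simp add: P_def gd_fps_recursion)
  finally have "dp_dx (fps_nth G n) = 0" for n by (metis fps_lift_nth fps_zero_nth)
  then have G_const: "fps_nth G n = dp_const (dp_eval (\<lambda>_. 0) (fps_nth G n))" for n
    by (rule dp_dx_eq_0_imp_const)
  define ev where "ev = fps_lift (dp_eval (\<lambda>_. 0))"
  have ev: "ev (f + h) = ev f + ev h" "ev (f - h) = ev f - ev h" "ev (f * h) = ev f * ev h" for f h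
    by (auto simp: ev_def fps_eq_iff dp_eval_add dp_eval_diff fps_mult_nth dp_eval_sum dp_eval_mult)
  have ev_num: "ev (numeral k) = numeral k" "ev fps_X = fps_X" for k
    by (auto simp: ev_def fps_eq_iff numeral_fps_const fps_X_def)
  have "ev P = 1" "ev (dx f) = 0" "ev u_fps = 0" for f
    by (auto simp: ev_def fps_eq_iff P_def gd_fps_def dp_eval_zero_gd dp_eval_zero_dx u_fps_def dp_u_eq_var)
  \<comment> \<open>At the zero jet \<open>P\<close> is 1 and \<open>quad_form P\<close> vanishes,
    so the only nonzero integration constant is the one of order 0.\<close>
  then have "ev G = - 4"
    by (simp add: G_def quad_form_def ev ev_num power2_eq_square mult.assoc)
  have "G = - 4"
  proof (rule fps_ext)
    fix n
    have "dp_eval (\<lambda>_. 0) (fps_nth G n) = fps_nth (- 4) n"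
      using \<open>ev G = - 4\<close> by (metis ev_def fps_lift_nth)
    then show "fps_nth G n = fps_nth (- 4) n"
      using G_const[of n] by (simp add: fps_numeral_nth dp_const_uminus split: if_splits)
  qed
  then show ?thesis by (simp add: G_def P_def algebra_simps)
qed

text \<open>Half the linearization of \<open>4 P\<^sup>2 - X * quad_form P\<close> at \<open>P = gd_fps\<close>.\<close>

definition lin_form :: "dpoly fps \<Rightarrow> dpoly fps" where
  "lin_form y = 4 * gd_fps * y - fps_X * (y * dx (dx gd_fps) + gd_fps * dx (dx y)
     - dx gd_fps * dx y + 4 * u_fps * gd_fps * y)"

lemma lin_form_diff: "lin_form (y - z) = lin_form y - lin_form z"
  by (simp add: lin_form_def dx_fps_simps algebra_simps)

lemma lin_form_X: "lin_form (fps_X * y) = fps_X * lin_form y"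
  by (simp add: lin_form_def dx_fps_simps algebra_simps)

lemma lin_form_X_power: "lin_form (fps_X ^ n * y) = fps_X ^ n * lin_form y"
  by (induction n) (simp_all add: lin_form_X mult.assoc)

text \<open>Apply \<open>d\<close> to the quadratic relation: everything assembles into the
  linearization except the term in which \<open>d\<close> hits u.\<close>

lemma lin_form_derivation:
  assumes d: "derivation d" and comm: "\<And>p. d (dp_dx p) = dp_dx (d p)"
  shows "lin_form (fps_lift d gd_fps) = fps_X * (2 * fps_const (d dp_u) * gd_fps\<^sup>2)"
proof -
  let ?d = "fps_lift d"
  note d_simps = derivationD[OF derivation_fps_lift[OF d]] derivation_diff[OF derivation_fps_lift[OF d]]
    fps_lift_X[OF d] derivation_numeral[OF derivation_fps_lift[OF d]] derivation_0[OF derivation_fps_lift[OF d]]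
  have c: "?d (dx f) = dx (?d f)" for f by (rule fps_lift_commute) (rule comm)
  have u: "?d u_fps = fps_const (d dp_u)" by (simp add: u_fps_def fps_lift_const derivation_0[OF d])
  have "?d (4 * gd_fps\<^sup>2) = ?d (4 + fps_X * quad_form gd_fps)"
    by (simp only: gd_fps_quadratic)
  then have "2 * lin_form (?d gd_fps) = 2 * (fps_X * (2 * fps_const (d dp_u) * gd_fps\<^sup>2))"
    by (simp add: quad_form_def power2_eq_square d_simps c u mult.assoc lin_form_def) (simp add: algebra_simps)
  then have "2 * fps_nth (lin_form (?d gd_fps)) n = 2 * fps_nth (fps_X * (2 * fps_const (d dp_u) * gd_fps\<^sup>2)) n" for n
    by (simp only: numeral_fps_const flip: fps_mult_left_const_nth)
  then show ?thesis by (intro fps_ext) (rule dpoly_cancel_numeral)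
qed

text \<open>Since \<open>gd_fps\<close> begins with 1, the n-th coefficient of
  \<open>lin_form y\<close> is 4 times that of \<open>y\<close> plus terms in earlier coefficients
  of \<open>y\<close>; all derivatives of \<open>y\<close> stand behind a factor X. This replaces
  integration in x.\<close>

lemma lin_form_eq_0_imp:
  assumes "lin_form y = 0" shows "y = 0"
proof -
  have "fps_nth y n = 0" for n
  proof (induction n rule: less_induct)
    case (less n)
    have lower: "fps_nth (f * h) m = 0" if "\<And>i. i \<le> m \<Longrightarrow> fps_nth h i = 0" for f h :: "dpoly fps" and m
      using that by (simp add: fps_mult_nth)
    have y: "fps_nth y i = 0" "fps_nth (dx y) i = 0" "fps_nth (dx (dx y)) i = 0" if "i < n" for i
      using less[OF that] by (simp_all add: dp_dx_simps)
    have "fps_nth (fps_X * (y * dx (dx gd_fps) + gd_fps * dx (dx y) - dx gd_fps * dx y + 4 * u_fps * gd_fps * y)) n = 0"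
    proof (cases n)
      case (Suc m)
      then show ?thesis using y
        by (simp add: mult.commute[of y] lower del: fps_lift_nth)
    qed simp
    moreover have "fps_nth (4 * gd_fps * y) n = 4 * fps_nth y n"
    proof -
      have "fps_nth (gd_fps * y) n = (\<Sum>i\<in>{0}. fps_nth gd_fps i * fps_nth y (n - i))"
        unfolding fps_mult_nth by (rule sum.mono_neutral_right) (use y in auto)
      also have "\<dots> = fps_nth y n" by (simp add: gd_fps_def gd_0)
      finally show ?thesis by (simp add: mult.assoc numeral_fps_const)
    qed
    ultimately have "4 * fps_nth y n = 0"
      using arg_cong[OF assms, of "\<lambda>f. fps_nth f n"] by (simp add: lin_form_def)
    then show ?case by simp
  qed
  then show ?thesis by (simp add: fps_eq_iff)
qed

section \<open>The derivative by u of the Gelfand-Dickey polynomials\<close>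

definition dp_du :: "dpoly \<Rightarrow> dpoly" where
  "dp_du = dp_der (\<lambda>i. if i = 0 then 1 else 0)"

lemma derivation_du: "derivation dp_du"
  by (simp add: dp_du_def derivation_dp_der)

text \<open>This derivation is the infinitesimal shift of u by a constant, which leaves all
  x-derivatives of u unchanged.\<close>

lemma du_commute: "dp_du (dp_dx p) = dp_dx (dp_du p)"
  by (rule derivation_commuteI[OF derivation_du derivation_dx])
    (simp_all add: dp_du_def derivation_0[OF derivation_dp_der] dp_dx_simps)

text \<open>Adding a constant to u amounts to shifting lambda in Q - lambda, so the derivative by u
  can be expressed by the derivative in the formal variable X = 1/lambda.\<close>

lemma dp_du_gd: "2 * dp_du (gd (Suc k)) = (2 * of_nat k + 1) * gd k"
proof -
  define P where "P = gd_fps"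
  \<comment> \<open>The expected value of \<open>2 * fps_lift dp_du P\<close>: the operator
    \<open>fps_X * fps_deriv\<close> multiplies the k-th coefficient by k, and the outer X raises
    the index by one.\<close>
  define y where "y = fps_X * (2 * (fps_X * fps_deriv P) + P)"
  have c: "fps_deriv (dx f) = dx (fps_deriv f)" for f
    by (simp add: fps_lift_deriv[OF derivation_dx])
  have "fps_deriv (4 * P\<^sup>2) = fps_deriv (4 + fps_X * quad_form P)"
    by (simp only: P_def gd_fps_quadratic)
  moreover have "fps_deriv u_fps = 0" by (simp add: u_fps_def)
  moreover have nn: "fps_deriv (numeral k * f) = numeral k * fps_deriv f" for k and f :: "dpoly fps"
    by (simp add: numeral_fps_const)
  moreover have "fps_deriv (numeral k :: dpoly fps) = 0" for k by (simp add: numeral_fps_const)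
  \<comment> \<open>Differentiating the quadratic relation in X: the explicit factor X contributes
    \<open>quad_form P\<close>, all else is the linearization.\<close>
  ultimately have "2 * lin_form (fps_deriv P) = quad_form P"
    by (simp add: quad_form_def power2_eq_square c mult.assoc lin_form_def P_def)
  moreover have "lin_form P = 4"
  proof -
    have "lin_form P = 4 * P\<^sup>2 - fps_X * quad_form P"
      by (simp add: lin_form_def quad_form_def P_def power2_eq_square algebra_simps)
    then show ?thesis by (simp add: P_def gd_fps_quadratic)
  qed
  moreover have "lin_form (2 * f + h) = 2 * lin_form f + lin_form h" for f h
    by (simp add: lin_form_def dx_fps_simps algebra_simps)
  ultimately have "lin_form y = fps_X * (2 * (fps_X * lin_form (fps_deriv P)) + 4)"
    and q: "2 * lin_form (fps_deriv P) = quad_form P"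
    by (simp_all add: y_def lin_form_X)
  then have "lin_form y = fps_X * (fps_X * quad_form P + 4)"
    unfolding q[symmetric] by (simp add: mult.left_commute[of 2])
  also have "\<dots> = fps_X * (4 * P\<^sup>2)" unfolding P_def gd_fps_quadratic by (simp add: add.commute)
  finally have ly: "lin_form y = fps_X * (4 * P\<^sup>2)" .
  have "dp_du dp_u = 1" by (simp add: dp_du_def dp_u_eq_var)
  then have "lin_form (fps_lift dp_du P) = fps_X * (2 * P\<^sup>2)"
    using lin_form_derivation[OF derivation_du du_commute] by (simp add: P_def)
  moreover have "lin_form (2 * f) = 2 * lin_form f" for f
    by (simp add: lin_form_def dx_fps_simps algebra_simps)
  ultimately have "lin_form (2 * fps_lift dp_du P - y) = 0"
    by (simp add: lin_form_diff ly mult.left_commute[of 2] flip: mult.assoc)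
  then have "2 * fps_lift dp_du P = y" using lin_form_eq_0_imp by fastforce
  then have "fps_nth (2 * fps_lift dp_du P) (Suc k) = fps_nth y (Suc k)" by simp
  then show ?thesis
    by (cases k) (simp_all add: y_def P_def gd_fps_def numeral_fps_const algebra_simps)
qed

section \<open>The flows\<close>

text \<open>The values on the higher jets are forced by commutation with
  \<open>dp_dx\<close>.\<close>

definition flow :: "nat \<Rightarrow> dpoly \<Rightarrow> dpoly" where
  "flow n = dp_der (\<lambda>i. (dp_dx ^^ i) (2 * dp_dx (gd (Suc n))))"

lemma derivation_flow: "derivation (flow n)"
  by (simp add: flow_def derivation_dp_der)

lemma flow_const: "flow n (dp_const c) = 0"
  by (simp add: flow_def)

lemma flow_u: "flow n dp_u = 2 * dp_dx (gd (Suc n))"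
  by (simp add: flow_def dp_u_eq_var)

lemma flow_var: "flow n (dp_var i) = (dp_dx ^^ i) (2 * dp_dx (gd (Suc n)))"
  by (simp add: flow_def)

lemma flow_commute: "flow n (dp_dx p) = dp_dx (flow n p)"
  by (rule derivation_commuteI[OF derivation_flow derivation_dx])
    (simp_all add: flow_const flow_var derivation_0[OF derivation_flow] dp_dx_simps)

text \<open>With \<open>B\<close> the part of \<open>gd_fps\<close> up to order \<open>n\<close>,
  the claim is that the Wronskian B P' - B' P equals X^n times the flow of P. Both have the same
  image under the injective \<open>lin_form\<close>.\<close>

lemma flow_gd:
  "flow n (gd k) = (\<Sum>i\<le>n. gd i * dp_dx (gd (n + k - i)) - dp_dx (gd i) * gd (n + k - i))"
proof -
  define P where "P = gd_fps"
  define B where "B = Abs_fps (\<lambda>i. if i \<le> n then gd i else 0)"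
  define v where "v = fps_const (2 * dp_dx (gd (Suc n)))"
  define y where "y = B * dx P - dx B * P"
  \<comment> \<open>\<open>B\<close> satisfies the recursion of \<open>P\<close> except at order n +
    1, where the next coefficient has been cut off; the defect is twice the value of the flow on
    u.\<close>
  have B_rec: "fps_X * (dx (dx (dx B)) + 4 * u_fps * dx B + 2 * dx u_fps * B) = 4 * dx B + 2 * (fps_X ^ Suc n * v)"
  proof (rule fps_ext)
    fix m
    consider "m = 0" | "0 < m" "m \<le> n" | "m = Suc n" | "m > Suc n" by linarith
    then show "fps_nth (fps_X * (dx (dx (dx B)) + 4 * u_fps * dx B + 2 * dx u_fps * B)) m
      = fps_nth (4 * dx B + 2 * (fps_X ^ Suc n * v)) m"
      using gd_recursion[of "m - 1"]
      by cases (auto simp: B_def u_fps_def v_def fps_lift_const dp_dx_simps gd_0 numeral_fps_const[symmetric]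
        mult.assoc fps_numeral_nth fps_X_power_mult_nth simp del: power_Suc split: nat.splits)
  qed
  \<comment> \<open>On the Wronskian the linearization splits into the third-order expressions of
    \<open>P\<close> and of \<open>B\<close>, so that only the defect of \<open>B\<close>
    remains.\<close>
  have "lin_form y = 4 * P * y - (P * B * (fps_X * (dx (dx (dx P)) + 4 * u_fps * dx P + 2 * dx u_fps * P))
      - P\<^sup>2 * (fps_X * (dx (dx (dx B)) + 4 * u_fps * dx B + 2 * dx u_fps * B)))"
    unfolding lin_form_def P_def[symmetric] y_def
    by (simp add: dx_fps_simps power2_eq_square algebra_simps)
  also have "\<dots> = fps_X ^ Suc n * (2 * v * P\<^sup>2)"
    unfolding B_rec gd_fps_recursion[folded P_def] y_def
    by (simp add: power2_eq_square algebra_simps)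
  finally have "lin_form y = fps_X ^ n * lin_form (fps_lift (flow n) P)"
    using lin_form_derivation[OF derivation_flow flow_commute, of n]
    by (simp add: P_def v_def flow_u algebra_simps)
  then have "lin_form (y - fps_X ^ n * fps_lift (flow n) P) = 0"
    by (simp add: lin_form_diff lin_form_X_power)
  then have "y = fps_X ^ n * fps_lift (flow n) P" using lin_form_eq_0_imp by fastforce
  then have "flow n (gd k) = fps_nth y (n + k)"
    by (simp add: P_def gd_fps_def fps_X_power_mult_nth)
  also have "\<dots> = (\<Sum>i=0..n + k. if i \<le> n then gd i * dp_dx (gd (n + k - i)) - dp_dx (gd i) * gd (n + k - i) else 0)"
    unfolding y_def fps_sub_nth fps_mult_nth sum_subtractf[symmetric]
    by (intro sum.cong refl) (auto simp: B_def P_def gd_fps_def dp_dx_simps)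
  also have "\<dots> = (\<Sum>i\<le>n. gd i * dp_dx (gd (n + k - i)) - dp_dx (gd i) * gd (n + k - i))"
    by (rule sum.mono_neutral_cong_right) auto
  finally show ?thesis .
qed

section \<open>Symmetry of second derivatives\<close>

text \<open>The mean value theorem, first in x for the difference in y, then in y.\<close>

lemma mixed_difference_mvt:
  fixes F Fx Fxy :: "real \<Rightarrow> real \<Rightarrow> real"
  assumes h: "0 < h"
    and 1: "\<And>x y. 0 \<le> x \<Longrightarrow> x \<le> h \<Longrightarrow> 0 \<le> y \<Longrightarrow> y \<le> h \<Longrightarrow> ((\<lambda>x. F x y) has_real_derivative Fx x y) (at x)"
    and 2: "\<And>x y. 0 \<le> x \<Longrightarrow> x \<le> h \<Longrightarrow> 0 \<le> y \<Longrightarrow> y \<le> h \<Longrightarrow> ((\<lambda>y. Fx x y) has_real_derivative Fxy x y) (at y)"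
  shows "\<exists>x y. 0 < x \<and> x < h \<and> 0 < y \<and> y < h \<and> F h h - F h 0 - F 0 h + F 0 0 = h\<^sup>2 * Fxy x y"
proof -
  have "\<exists>z>0. z < h \<and> (F h h - F h 0) - (F 0 h - F 0 0) = (h - 0) * (Fx z h - Fx z 0)"
    by (rule MVT2[OF h]) (auto intro!: DERIV_diff 1 simp: h less_imp_le)
  then obtain x where x: "0 < x" "x < h" "(F h h - F h 0) - (F 0 h - F 0 0) = h * (Fx x h - Fx x 0)" by auto
  have "\<exists>z>0. z < h \<and> Fx x h - Fx x 0 = (h - 0) * Fxy x z"
    by (rule MVT2[OF h]) (use x in \<open>auto intro!: 2\<close>)
  then obtain y where "0 < y" "y < h" "Fx x h - Fx x 0 = h * Fxy x y" by auto
  with x show ?thesis by (intro exI[of _ x] exI[of _ y]) (auto simp: power2_eq_square)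
qed

text \<open>The second difference over a square of side h is symmetric in the two variables and
  equals h^2 times either mixed derivative at some interior point; continuity at the corner brings
  the two values together.\<close>

lemma real_second_derivatives_symmetric:
  fixes F Fx Fy Fxy Fyx :: "real \<Rightarrow> real \<Rightarrow> real"
  assumes r: "0 < r"
    and x: "\<And>x y. \<bar>x\<bar> < r \<Longrightarrow> \<bar>y\<bar> < r \<Longrightarrow> ((\<lambda>x. F x y) has_real_derivative Fx x y) (at x)"
    and y: "\<And>x y. \<bar>x\<bar> < r \<Longrightarrow> \<bar>y\<bar> < r \<Longrightarrow> ((\<lambda>y. F x y) has_real_derivative Fy x y) (at y)"
    and xy: "\<And>x y. \<bar>x\<bar> < r \<Longrightarrow> \<bar>y\<bar> < r \<Longrightarrow> ((\<lambda>y. Fx x y) has_real_derivative Fxy x y) (at y)"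
    and yx: "\<And>x y. \<bar>x\<bar> < r \<Longrightarrow> \<bar>y\<bar> < r \<Longrightarrow> ((\<lambda>x. Fy x y) has_real_derivative Fyx x y) (at x)"
    and c1: "\<And>e. e > 0 \<Longrightarrow> \<exists>d>0. \<forall>x y. \<bar>x\<bar> < d \<longrightarrow> \<bar>y\<bar> < d \<longrightarrow> \<bar>Fxy x y - Fxy 0 0\<bar> < e"
    and c2: "\<And>e. e > 0 \<Longrightarrow> \<exists>d>0. \<forall>x y. \<bar>x\<bar> < d \<longrightarrow> \<bar>y\<bar> < d \<longrightarrow> \<bar>Fyx x y - Fyx 0 0\<bar> < e"
  shows "Fxy 0 0 = Fyx 0 0"
proof (rule ccontr)
  assume neq: "Fxy 0 0 \<noteq> Fyx 0 0"
  define e where "e = \<bar>Fxy 0 0 - Fyx 0 0\<bar> / 2"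
  have e: "e > 0" using neq by (simp add: e_def)
  from c1[OF e] obtain d1 where d1: "d1 > 0" "\<And>x y. \<bar>x\<bar> < d1 \<Longrightarrow> \<bar>y\<bar> < d1 \<Longrightarrow> \<bar>Fxy x y - Fxy 0 0\<bar> < e" by auto
  from c2[OF e] obtain d2 where d2: "d2 > 0" "\<And>x y. \<bar>x\<bar> < d2 \<Longrightarrow> \<bar>y\<bar> < d2 \<Longrightarrow> \<bar>Fyx x y - Fyx 0 0\<bar> < e" by auto
  define h where "h = min r (min d1 d2) / 2"
  have h: "0 < h" "h < r" "h < d1" "h < d2" using r d1(1) d2(1) by (auto simp: h_def)
  obtain a b where ab: "0 < a" "a < h" "0 < b" "b < h"
    and 1: "F h h - F h 0 - F 0 h + F 0 0 = h\<^sup>2 * Fxy a b"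
    using mixed_difference_mvt[OF h(1), of F Fx Fxy] x xy h by force
  obtain b' a' where ab': "0 < b'" "b' < h" "0 < a'" "a' < h"
    and 2: "F h h - F 0 h - F h 0 + F 0 0 = h\<^sup>2 * Fyx a' b'"
    using mixed_difference_mvt[OF h(1), of "\<lambda>y x. F x y" "\<lambda>y x. Fy x y" "\<lambda>y x. Fyx x y"] y yx h by force
  have eq: "Fxy a b = Fyx a' b'" using 1 2 h(1) by (simp add: algebra_simps)
  then have "2 * e \<le> \<bar>Fxy a b - Fxy 0 0\<bar> + \<bar>Fyx a' b' - Fyx 0 0\<bar>" unfolding e_def by simp
  moreover have "\<bar>Fxy a b - Fxy 0 0\<bar> < e" using d1(2)[of a b] ab h by auto
  moreover have "\<bar>Fyx a' b' - Fyx 0 0\<bar> < e" using d2(2)[of a' b'] ab' h by auto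
  ultimately show False by linarith
qed

section \<open>Partial derivatives\<close>

locale time_field =
  fixes K :: "complex set"
  assumes K_cases: "K = \<real> \<or> K = UNIV"
begin

text \<open>The property through which real and complex times are treated together: real lines
  through a point of \<open>K\<close> stay in \<open>K\<close>.\<close>

lemma K_add_of_real: "z \<in> K \<Longrightarrow> z + of_real x \<in> K"
  using K_cases by auto

text \<open>No point of \<open>K\<close> is isolated; this makes the derivative unique and the
  description in \<open>partial\<close> meaningful.\<close>

lemma at_within_K_not_bot: assumes "z \<in> K" shows "at z within K \<noteq> bot"
proof -
  have "z islimpt K" unfolding islimpt_approachable
  proof (intro allI impI)
    fix e :: real assume "e > 0"
    then show "\<exists>x'\<in>K. x' \<noteq> z \<and> dist x' z < e"
      by (intro bexI[of _ "z + of_real (e / 2)"]) (auto simp: dist_norm K_add_of_real[OF assms] simp del: of_real_divide)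
  qed
  then show ?thesis by (simp add: trivial_limit_within)
qed

lemma has_partial_unique:
  assumes "has_partial K k f d t" "has_partial K k f d' t" "t k \<in> K"
  shows "d = d'"
proof -
  have "((\<lambda>s. f (t(k := s))) has_derivative (*) d) (at (t k) within K)"
    and "((\<lambda>s. f (t(k := s))) has_derivative (*) d') (at (t k) within K)"
    using assms by (auto simp: has_partial_def has_field_derivative_def)
  moreover have "(f' has_derivative (*) a) (at z within K) \<Longrightarrow> ((\<lambda>s. (f' s - f' z) / (s - z)) \<longlongrightarrow> a) (at z within K)" for f' a z
    using has_field_derivative_iff[of f' a z K] by (simp add: has_field_derivative_def)
  ultimately show ?thesis
    using tendsto_unique[OF at_within_K_not_bot[OF assms(3)]] by blast
qed

lemma partial_eqI:
  assumes "has_partial K k f d t" "t k \<in> K"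
  shows "partial K k f t = d"
  unfolding partial_def using assms by (blast intro: the_equality has_partial_unique)

lemma has_partial_partial:
  assumes "\<exists>d. has_partial K k f d t" "t k \<in> K"
  shows "has_partial K k f (partial K k f t) t"
  using assms partial_eqI by blast

lemma open_times_mem:
  assumes "open_times K g D" "t \<in> D" "k \<in> time_indices g"
  shows "t k \<in> K"
proof -
  have "t \<in> time_space K g"
    using assms(1,2) openin_imp_subset by (auto simp: open_times_def)
  then show ?thesis using assms(3) by (auto simp: time_space_def split: if_splits)
qed

lemma time_space_update: "t \<in> time_space K g \<Longrightarrow> k \<in> time_indices g \<Longrightarrow> s \<in> K \<Longrightarrow> t(k := s) \<in> time_space K g"
  by (auto simp: time_space_def)

lemma open_times_obtain:
  assumes "open_times K g D"
  obtains T where "open T" "D = T \<inter> time_space K g"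
  using assms by (auto simp: open_times_def openin_open)

lemma continuous_fun_upd: "continuous_on UNIV (\<lambda>s::complex. (t :: nat \<Rightarrow> complex)(k := s))"
proof (rule continuous_on_coordinatewise_then_product)
  show "continuous_on UNIV (\<lambda>s. (t(k := s)) i)" for i by (cases "i = k") auto
qed

lemma eventually_open_times:
  assumes "open_times K g D" "t \<in> D" "k \<in> time_indices g"
  shows "\<forall>\<^sub>F s in at (t k) within K. t(k := s) \<in> D"
proof -
  obtain T where T: "open T" "D = T \<inter> time_space K g" using open_times_obtain[OF assms(1)] .
  have "open ((\<lambda>s. t(k := s)) -` T)"
    using continuous_fun_upd T(1) by (simp add: continuous_on_open_vimage)
  moreover have "t k \<in> (\<lambda>s. t(k := s)) -` T" using assms T by simp
  ultimately have "\<forall>\<^sub>F s in at (t k) within K. s \<in> (\<lambda>s. t(k := s)) -` T"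
    by (rule eventually_at_in_open'[THEN filter_leD[OF at_le[OF subset_UNIV]]])
  moreover have "\<forall>\<^sub>F s in at (t k) within K. s \<in> K" by (simp add: eventually_at_filter)
  ultimately show ?thesis
    by eventually_elim (use T assms time_space_update in auto)
qed

lemma has_partial_cong:
  assumes "open_times K g D" "t \<in> D" "k \<in> time_indices g" and "\<And>t. t \<in> D \<Longrightarrow> f t = f' t"
    and "has_partial K k f d t"
  shows "has_partial K k f' d t"
  unfolding has_partial_def
proof (rule has_field_derivative_cong_eventually[THEN iffD1])
  show "((\<lambda>s. f (t(k := s))) has_field_derivative d) (at (t k) within K)" using assms(5) by (simp add: has_partial_def)
  show "\<forall>\<^sub>F s in at (t k) within K. f (t(k := s)) = f' (t(k := s))"
    using eventually_open_times[OF assms(1-3)] by eventually_elim (rule assms(4))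
qed (use assms in auto)

lemma partial_cong:
  assumes "open_times K g D" "t \<in> D" "k \<in> time_indices g" and "\<And>t. t \<in> D \<Longrightarrow> f t = f' t"
  shows "partial K k f t = partial K k f' t"
proof -
  have "has_partial K k f d t \<longleftrightarrow> has_partial K k f' d t" for d
    using has_partial_cong[OF assms(1-3), of f f'] has_partial_cong[OF assms(1-3), of f' f] assms(4) by metis
  then show ?thesis by (simp add: partial_def)
qed

lemma partial_funpow_cong:
  assumes "open_times K g D" "k \<in> time_indices g" and "\<And>t. t \<in> D \<Longrightarrow> f t = f' t" "t \<in> D"
  shows "(partial K k ^^ i) f t = (partial K k ^^ i) f' t"
  using assms(4)
proof (induction i arbitrary: t)
  case (Suc i)
  show ?case
    using partial_cong[OF assms(1) Suc.prems assms(2) Suc.IH] by simp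
qed (simp add: assms)

lemma smooth_has_partial:
  assumes "open_times K g D" "smooth_on_times K g D f" "t \<in> D" "k \<in> time_indices g"
  shows "has_partial K k f (partial K k f t) t"
proof (rule has_partial_partial)
  show "\<exists>d. has_partial K k f d t"
    using assms(2)[unfolded smooth_on_times_def, rule_format, of "[]"] assms(3,4) by simp
qed (rule open_times_mem[OF assms(1,3,4)])

lemma smooth_partial:
  assumes "smooth_on_times K g D f" "k \<in> time_indices g"
  shows "smooth_on_times K g D (partial K k f)"
  unfolding smooth_on_times_def
proof (intro allI impI)
  fix ks assume "set ks \<subseteq> time_indices g"
  then have "set (ks @ [k]) \<subseteq> time_indices g" using assms(2) by simp
  then show "continuous_on D (foldr (partial K) ks (partial K k f)) \<and>
        (\<forall>k'\<in>time_indices g. \<forall>t\<in>D. \<exists>d. has_partial K k' (foldr (partial K) ks (partial K k f)) d t)"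
    using assms(1)[unfolded smooth_on_times_def, rule_format, of "ks @ [k]"] by simp
qed

lemma smooth_funpow_partial:
  assumes "smooth_on_times K g D f" "k \<in> time_indices g"
  shows "smooth_on_times K g D ((partial K k ^^ i) f)"
  by (induction i) (simp_all add: assms smooth_partial)

lemma smooth_continuous:
  assumes "smooth_on_times K g D f" shows "continuous_on D f"
proof -
  have "continuous_on D (foldr (partial K) [] f)"
    using assms unfolding smooth_on_times_def by (rule allE[of _ "[]"]) (simp only: list.set empty_subsetI)
  then show ?thesis by simp
qed

text \<open>Restriction to a real line followed by a real-linear functional turns derivatives of
  either kind into ordinary real ones.\<close>

lemma has_partial_real_direction:
  assumes "has_partial K k f d (p(k := z + of_real x))" "z \<in> K" "bounded_linear L"
  shows "((\<lambda>x. L (f (p(k := z + of_real x))) :: real) has_real_derivative L d) (at x)"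
proof -
  have "((\<lambda>s. f (p(k := s))) has_derivative (*) d) (at (z + of_real x) within K)"
    using assms(1) by (simp add: has_partial_def has_field_derivative_def)
  then have 1: "((\<lambda>s. f (p(k := s))) has_derivative (*) d) (at (z + of_real x) within range (\<lambda>x::real. z + of_real x))"
    by (rule has_derivative_subset) (use K_add_of_real[OF assms(2)] in auto)
  have 2: "((\<lambda>x::real. z + of_real x) has_derivative of_real) (at x)"
    by (auto intro!: derivative_eq_intros)
  have "((\<lambda>x. f (p(k := z + of_real x))) has_derivative (\<lambda>h. d * of_real h)) (at x)"
    using diff_chain_within[OF 2 1] by (simp add: comp_def)
  then have "((\<lambda>x. L (f (p(k := z + of_real x)))) has_derivative (\<lambda>h. L (d * of_real h))) (at x)"
    by (rule bounded_linear.has_derivative[OF assms(3)])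
  moreover have "L (d * of_real h) = L d * h" for h
    using linear_cmul[OF bounded_linear.linear[OF assms(3)], of h d] by (simp add: scaleR_conv_of_real mult.commute)
  ultimately show ?thesis by (simp add: has_field_derivative_def)
qed

text \<open>Restrict to the real plane through \<open>t\<close> in the two time directions, take
  real and imaginary parts, and apply the real symmetry theorem.\<close>

lemma partial_commute:
  assumes D: "open_times K g D" and f: "smooth_on_times K g D f" and t: "t \<in> D"
    and j: "j \<in> time_indices g" and k: "k \<in> time_indices g"
  shows "partial K j (partial K k f) t = partial K k (partial K j f) t"
proof (cases "j = k")
  case False
  define pt where "pt x y = t(j := t j + of_real x, k := t k + of_real y)" for x y :: real
  have pt_swap: "pt x y = (t(k := t k + of_real y))(j := t j + of_real x)" for x y
    using False by (auto simp: pt_def)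
  note tj = open_times_mem[OF D t j] and tk = open_times_mem[OF D t k]
  have pt0: "pt 0 0 = t" by (simp add: pt_def)
  obtain T where T: "open T" "D = T \<inter> time_space K g" using open_times_obtain[OF D] .
  have pt_space: "pt x y \<in> time_space K g" for x y
    unfolding pt_def using T t j k tj tk by (auto intro!: time_space_update K_add_of_real)
  have pt_cont: "continuous_on UNIV (\<lambda>(x, y). pt x y)"
    unfolding pt_def case_prod_beta
  proof (rule continuous_on_coordinatewise_then_product)
    show "continuous_on UNIV (\<lambda>p. (t(j := t j + of_real (fst p), k := t k + of_real (snd p))) i)" for i
      by (cases "i = k"; cases "i = j") (auto intro!: continuous_intros)
  qed
  \<comment> \<open>A neighbourhood of \<open>t\<close> in the product topology contains the image
    of a small square; used for staying in \<open>D\<close> and for continuity of the second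
    derivatives.\<close>
  have box: "\<exists>d>0. \<forall>x y. \<bar>x\<bar> < d \<longrightarrow> \<bar>y\<bar> < d \<longrightarrow> Q (pt x y)"
    if "open S" "t \<in> S" and S: "\<And>p. p \<in> S \<inter> time_space K g \<Longrightarrow> Q p" for S Q
  proof -
    have "open ((\<lambda>(x, y). pt x y) -` S)" using pt_cont that by (simp add: continuous_on_open_vimage)
    moreover have "(0, 0) \<in> (\<lambda>(x, y). pt x y) -` S" using that by (simp add: pt0)
    ultimately obtain A B where AB: "open A" "open B" "(0, 0) \<in> A \<times> B" "A \<times> B \<subseteq> (\<lambda>(x, y). pt x y) -` S"
      by (rule open_prod_elim)
    obtain d1 where d1: "d1 > 0" "\<And>x. \<bar>x\<bar> < d1 \<Longrightarrow> x \<in> A"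
      using AB(1,3) by (force simp: open_dist dist_real_def)
    obtain d2 where d2: "d2 > 0" "\<And>x. \<bar>x\<bar> < d2 \<Longrightarrow> x \<in> B"
      using AB(2,3) by (force simp: open_dist dist_real_def)
    show ?thesis
    proof (intro exI[of _ "min d1 d2"] conjI allI impI)
      fix x y assume "\<bar>x\<bar> < min d1 d2" "\<bar>y\<bar> < min d1 d2"
      then have "(x, y) \<in> A \<times> B" using d1 d2 by auto
      then show "Q (pt x y)" using AB(4) pt_space by (intro S) auto
    qed (use d1 d2 in auto)
  qed
  obtain r where r: "r > 0" "\<And>x y. \<bar>x\<bar> < r \<Longrightarrow> \<bar>y\<bar> < r \<Longrightarrow> pt x y \<in> D"
    using box[of T "\<lambda>p. p \<in> D"] T t by auto
  have cont: "\<exists>d>0. \<forall>x y. \<bar>x\<bar> < d \<longrightarrow> \<bar>y\<bar> < d \<longrightarrow> \<bar>L (h (pt x y)) - L (h (pt 0 0))\<bar> < e"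
    if h: "continuous_on D h" and L: "bounded_linear L" and e: "e > 0" for h :: "(nat \<Rightarrow> complex) \<Rightarrow> complex" and L :: "complex \<Rightarrow> real" and e
  proof -
    have "continuous_on D (\<lambda>p. L (h p))" using bounded_linear.continuous_on[OF L h] .
    from this[unfolded continuous_on_open_invariant, rule_format, OF open_ball, of "L (h t)" e]
    obtain S where S: "open S" "S \<inter> D = (\<lambda>p. L (h p)) -` ball (L (h t)) e \<inter> D"
      by (elim exE conjE)
    have "t \<in> S" using S(2) t e by auto
    then have "\<exists>d>0. \<forall>x y. \<bar>x\<bar> < d \<longrightarrow> \<bar>y\<bar> < d \<longrightarrow> L (h (pt x y)) \<in> ball (L (h t)) e"
    proof (intro box[of "S \<inter> T"])
      fix p assume "p \<in> S \<inter> T \<inter> time_space K g"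
      then have "p \<in> S \<inter> D" using T by simp
      then show "L (h p) \<in> ball (L (h t)) e" unfolding S(2) by simp
    qed (use S(1) T t \<open>t \<in> S\<close> in auto)
    then show ?thesis by (simp add: pt0 dist_real_def abs_minus_commute)
  qed
  note fj = smooth_partial[OF f j] and fk = smooth_partial[OF f k]
  have "L (partial K k (partial K j f) t) = L (partial K j (partial K k f) t)"
    if L: "bounded_linear L" for L :: "complex \<Rightarrow> real"
  proof -
    have "L (partial K k (partial K j f) (pt 0 0)) = L (partial K j (partial K k f) (pt 0 0))"
    proof (rule real_second_derivatives_symmetric[OF r(1),
        where F = "\<lambda>x y. L (f (pt x y))" and Fx = "\<lambda>x y. L (partial K j f (pt x y))"
        and Fy = "\<lambda>x y. L (partial K k f (pt x y))"
        and Fxy = "\<lambda>x y. L (partial K k (partial K j f) (pt x y))"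
        and Fyx = "\<lambda>x y. L (partial K j (partial K k f) (pt x y))"])
      fix x y assume xy: "\<bar>x\<bar> < r" "\<bar>y\<bar> < r"
      note in_D = r(2)[OF xy]
      show "((\<lambda>x. L (f (pt x y))) has_real_derivative L (partial K j f (pt x y))) (at x)"
        using smooth_has_partial[OF D f in_D j] unfolding pt_swap
        by (rule has_partial_real_direction[OF _ tj L])
      show "((\<lambda>y. L (f (pt x y))) has_real_derivative L (partial K k f (pt x y))) (at y)"
        using smooth_has_partial[OF D f in_D k] unfolding pt_def
        by (rule has_partial_real_direction[OF _ tk L])
      show "((\<lambda>y. L (partial K j f (pt x y))) has_real_derivative L (partial K k (partial K j f) (pt x y))) (at y)"
        using smooth_has_partial[OF D fj in_D k] unfolding pt_def
        by (rule has_partial_real_direction[OF _ tk L])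
      show "((\<lambda>x. L (partial K k f (pt x y))) has_real_derivative L (partial K j (partial K k f) (pt x y))) (at x)"
        using smooth_has_partial[OF D fk in_D j] unfolding pt_swap
        by (rule has_partial_real_direction[OF _ tj L])
    qed (rule cont[OF smooth_continuous[OF smooth_partial[OF fj k]] L], assumption,
        rule cont[OF smooth_continuous[OF smooth_partial[OF fk j]] L], assumption)
    then show ?thesis by (simp add: pt0)
  qed
  from this[OF bounded_linear_Re] this[OF bounded_linear_Im] show ?thesis by (simp add: complex_eq_iff)
qed simp

end

section \<open>Differential polynomials along a solution\<close>

locale PI_flow = time_field K for K :: "complex set" +
  fixes g :: nat and D :: "(nat \<Rightarrow> complex) set" and u :: "(nat \<Rightarrow> complex) \<Rightarrow> complex"
  assumes solution: "PI_solution K g D u"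
begin

definition ev :: "(nat \<Rightarrow> complex) \<Rightarrow> dpoly \<Rightarrow> complex" where
  "ev t p = dp_eval (\<lambda>i. (partial K 1 ^^ i) u t) p"

lemma R_fun_ev: "R_fun K u n t = ev t (gd n)"
  by (simp add: R_fun_def ev_def)

lemmas ev_simps = dp_eval_add[of "\<lambda>i. (partial K 1 ^^ i) u t" for t, folded ev_def]
  dp_eval_mult[of "\<lambda>i. (partial K 1 ^^ i) u t" for t, folded ev_def]
  dp_eval_diff[of "\<lambda>i. (partial K 1 ^^ i) u t" for t, folded ev_def]
  dp_eval_uminus[of "\<lambda>i. (partial K 1 ^^ i) u t" for t, folded ev_def]
  dp_eval_numeral[of "\<lambda>i. (partial K 1 ^^ i) u t" for t, folded ev_def]
  dp_eval_const[of "\<lambda>i. (partial K 1 ^^ i) u t" for t, folded ev_def]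
  dp_eval_0[of "\<lambda>i. (partial K 1 ^^ i) u t" for t, folded ev_def]
  dp_eval_1[of "\<lambda>i. (partial K 1 ^^ i) u t" for t, folded ev_def]
  dp_eval_sum[of "\<lambda>i. (partial K 1 ^^ i) u t" for t, folded ev_def]

lemma ev_var: "ev t (dp_var i) = (partial K 1 ^^ i) u t"
  by (simp add: ev_def)

lemma open_D: "open_times K g D" and smooth_u: "smooth_on_times K g D u"
  using solution by (auto simp: PI_solution_def)

lemma odd_index: "n \<le> g \<Longrightarrow> 2 * n + 1 \<in> time_indices g" and one_index: "1 \<in> time_indices g"
  by (auto simp: time_indices_def)

lemma has_partial_ev_derivation:
  assumes d: "derivation d" "\<And>c. d (dp_const c) = 0"
    and var: "\<And>i. has_partial K k (\<lambda>t. ev t (dp_var i)) (ev t (d (dp_var i))) t"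
  shows "has_partial K k (\<lambda>t. ev t p) (ev t (d p)) t"
proof (induction p rule: dpoly_induct)
  case (const c)
  then show ?case by (simp add: has_partial_def ev_simps d)
next
  case (add p q)
  then show ?case unfolding has_partial_def by (simp add: ev_simps derivationD[OF d(1)] DERIV_add)
next
  case (mult p q)
  have "((\<lambda>s. ev (t(k := s)) p * ev (t(k := s)) q) has_field_derivative
      ev t (d p) * ev (t(k := t k)) q + ev t (d q) * ev (t(k := t k)) p) (at (t k) within K)"
    by (rule DERIV_mult) (use mult in \<open>simp_all add: has_partial_def\<close>)
  then show ?case unfolding has_partial_def
    by (simp add: ev_simps derivationD[OF d(1)] algebra_simps)
qed (rule var)

lemma has_partial_ev_dx:
  assumes "t \<in> D"
  shows "has_partial K 1 (\<lambda>t. ev t p) (ev t (dp_dx p)) t"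
proof (rule has_partial_ev_derivation[OF derivation_dx dp_dx_const])
  fix i
  show "has_partial K 1 (\<lambda>t. ev t (dp_var i)) (ev t (dp_dx (dp_var i))) t"
    using smooth_has_partial[OF open_D smooth_funpow_partial[OF smooth_u one_index] assms one_index, of i]
    by (simp add: ev_var)
qed

lemma partial_ev_dx: "t \<in> D \<Longrightarrow> partial K 1 (\<lambda>t. ev t p) t = ev t (dp_dx p)"
  by (rule partial_eqI[OF has_partial_ev_dx open_times_mem[OF open_D _ one_index]])

lemma partial_funpow_ev: "t \<in> D \<Longrightarrow> (partial K 1 ^^ i) (\<lambda>t. ev t p) t = ev t ((dp_dx ^^ i) p)"
proof (induction i arbitrary: t)
  case (Suc i)
  then show ?case
    using partial_cong[OF open_D Suc.prems one_index Suc.IH] partial_ev_dx by simp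
qed simp

lemma partial_flow_u:
  assumes "n \<le> g" "t \<in> D"
  shows "partial K (2 * n + 1) u t = ev t (2 * dp_dx (gd (Suc n)))"
proof (cases "n = 0")
  case True
  \<comment> \<open>The hierarchy lists the flows from n = 1 on; for n = 0 the equation reads u_x =
    (2 R_1)_x.\<close>
  have "2 * dp_dx (gd (Suc 0)) = dp_dx dp_u"
    using arg_cong[OF gd_1, of dp_dx] dp_dx_const_mult[of 2 "gd 1"] by simp
  then show ?thesis using partial_ev_dx[OF assms(2), of dp_u] True
    by (simp add: dp_u_eq_var ev_var)
next
  case False
  then have "partial K (2 * n + 1) u t = 2 * partial K 1 (R_fun K u (n + 1)) t"
    using solution assms by (simp add: PI_solution_def)
  also have "R_fun K u (n + 1) = (\<lambda>t. ev t (gd (Suc n)))" by (simp add: R_fun_ev fun_eq_iff)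
  finally show ?thesis using assms(2) by (simp only: partial_ev_dx ev_simps)
qed

lemma partial_funpow_commute:
  assumes "k \<in> time_indices g" "t \<in> D"
  shows "partial K k ((partial K 1 ^^ i) u) t = (partial K 1 ^^ i) (partial K k u) t"
  using assms(2)
proof (induction i arbitrary: t)
  case (Suc i)
  have "partial K k ((partial K 1 ^^ Suc i) u) t = partial K 1 (partial K k ((partial K 1 ^^ i) u)) t"
    using partial_commute[OF open_D smooth_funpow_partial[OF smooth_u one_index] Suc.prems assms(1) one_index] by simp
  also have "\<dots> = partial K 1 ((partial K 1 ^^ i) (partial K k u)) t"
    by (rule partial_cong[OF open_D Suc.prems one_index]) (rule Suc.IH)
  finally show ?case by simp
qed simp

text \<open>It suffices to check the jets of u, and there the time derivative may be interchanged
  with the x-derivatives by symmetry of second derivatives.\<close>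

lemma has_partial_ev_flow:
  assumes "n \<le> g" "t \<in> D"
  shows "has_partial K (2 * n + 1) (\<lambda>t. ev t p) (ev t (flow n p)) t"
proof (rule has_partial_ev_derivation[OF derivation_flow flow_const])
  fix i
  let ?k = "2 * n + 1"
  note k = odd_index[OF assms(1)]
  have "has_partial K ?k ((partial K 1 ^^ i) u) (partial K ?k ((partial K 1 ^^ i) u) t) t"
    by (rule smooth_has_partial[OF open_D smooth_funpow_partial[OF smooth_u one_index] assms(2) k])
  also have "partial K ?k ((partial K 1 ^^ i) u) t = (partial K 1 ^^ i) (partial K ?k u) t"
    by (rule partial_funpow_commute[OF k assms(2)])
  also have "\<dots> = (partial K 1 ^^ i) (\<lambda>t. ev t (2 * dp_dx (gd (Suc n)))) t"
    by (rule partial_funpow_cong[OF open_D one_index partial_flow_u[OF assms(1)] assms(2)])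
  also have "\<dots> = ev t (flow n (dp_var i))"
    by (simp only: partial_funpow_ev[OF assms(2)] flow_var)
  finally show "has_partial K ?k (\<lambda>t. ev t (dp_var i)) (ev t (flow n (dp_var i))) t"
    by (simp add: ev_var)
qed

end

section \<open>Coefficientwise partial derivatives of polynomials\<close>

lemma lambda_poly_0: "lambda_poly 0 a = [:a 0:]"
  by (simp add: lambda_poly_def monom_0)

lemma coeff_lambda_poly: "coeff (lambda_poly n a) i = (if i \<le> n then a (n - i) else 0)"
proof -
  have "coeff (lambda_poly n a) i = (\<Sum>k\<le>n. if k = n - i \<and> i \<le> n then a k else 0)"
    unfolding lambda_poly_def coeff_sum by (intro sum.cong refl) auto
  then show ?thesis by (simp add: sum.delta)
qed

lemma lambda_poly_Suc: "lambda_poly (Suc n) a = pCons (a (Suc n)) (lambda_poly n a)"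
  by (auto simp: poly_eq_iff coeff_lambda_poly coeff_pCons split: nat.splits)

lemma smult_sum_right: "smult c (sum f A) = (\<Sum>i\<in>A. smult c (f i))"
  by (induction A rule: infinite_finite_induct) (simp_all add: smult_add_right)

lemma degree_lambda_poly: "degree (lambda_poly n a) \<le> n"
  by (rule degree_le) (simp add: coeff_lambda_poly)

lemma lambda_poly_smult: "lambda_poly n (\<lambda>k. c * a k) = smult c (lambda_poly n a)"
  by (simp add: poly_eq_iff coeff_lambda_poly)

lemma lambda_poly_sum: "lambda_poly n (\<lambda>k. \<Sum>i\<in>A. a i k) = (\<Sum>i\<in>A. lambda_poly n (a i))"
  by (simp add: poly_eq_iff coeff_lambda_poly coeff_sum)

text \<open>Raising the coefficient index is multiplication by lambda, up to a new constant term and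
  the removal of the leading term.\<close>

lemma lambda_poly_shift: "lambda_poly n (\<lambda>k. a (Suc k)) = pCons (a (Suc n)) (lambda_poly n a) - monom (a 0) (Suc n)"
  unfolding lambda_poly_Suc[symmetric]
  by (auto simp: poly_eq_iff coeff_lambda_poly Suc_diff_le)

definition has_poly_partial ::
    "complex set \<Rightarrow> nat \<Rightarrow> ((nat \<Rightarrow> complex) \<Rightarrow> complex poly) \<Rightarrow> complex poly \<Rightarrow> (nat \<Rightarrow> complex) \<Rightarrow> bool" where
  "has_poly_partial K k P Q t \<longleftrightarrow> (\<forall>i. has_partial K k (\<lambda>t. coeff (P t) i) (coeff Q i) t)"

lemma has_partial_add:
  "has_partial K k f d t \<Longrightarrow> has_partial K k f' d' t \<Longrightarrow> has_partial K k (\<lambda>t. f t + f' t) (d + d') t"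
  unfolding has_partial_def by (rule DERIV_add)

lemma has_partial_mult:
  assumes "has_partial K k f d t" "has_partial K k f' d' t"
  shows "has_partial K k (\<lambda>t. f t * f' t) (d * f' t + f t * d') t"
  using DERIV_mult[OF assms[unfolded has_partial_def]] unfolding has_partial_def
  by (simp add: mult.commute add.commute)

lemma has_partial_const: "has_partial K k (\<lambda>t. c) 0 t"
  by (simp add: has_partial_def)

lemma has_partial_sum:
  assumes "\<And>i. i \<in> A \<Longrightarrow> has_partial K k (f i) (d i) t"
  shows "has_partial K k (\<lambda>t. \<Sum>i\<in>A. f i t) (\<Sum>i\<in>A. d i) t"
  using assms by (induction A rule: infinite_finite_induct) (auto intro: has_partial_add has_partial_const)

lemma has_poly_partial_add:
  "has_poly_partial K k P Q t \<Longrightarrow> has_poly_partial K k P' Q' t \<Longrightarrow> has_poly_partial K k (\<lambda>t. P t + P' t) (Q + Q') t"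
  by (simp add: has_poly_partial_def has_partial_add)

lemma has_poly_partial_mult:
  assumes "has_poly_partial K k P Q t" "has_poly_partial K k P' Q' t"
  shows "has_poly_partial K k (\<lambda>t. P t * P' t) (Q * P' t + P t * Q') t"
  using assms unfolding has_poly_partial_def coeff_mult coeff_add sum.distrib[symmetric]
  by (intro allI has_partial_sum has_partial_mult) auto

lemma has_poly_partial_smult:
  assumes "has_partial K k c d t" "has_poly_partial K k P Q t"
  shows "has_poly_partial K k (\<lambda>t. smult (c t) (P t)) (smult d (P t) + smult (c t) Q) t"
  using assms unfolding has_poly_partial_def coeff_smult coeff_add
  by (intro allI has_partial_mult) auto

lemma has_poly_partial_const: "has_poly_partial K k (\<lambda>t. P) 0 t"
  by (simp add: has_poly_partial_def has_partial_const)

lemma has_poly_partial_smult_const: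
  "has_poly_partial K k P Q t \<Longrightarrow> has_poly_partial K k (\<lambda>t. smult c (P t)) (smult c Q) t"
  using has_poly_partial_smult[OF has_partial_const] by force

lemma has_poly_partial_sum:
  assumes "\<And>i. i \<in> A \<Longrightarrow> has_poly_partial K k (P i) (Q i) t"
  shows "has_poly_partial K k (\<lambda>t. \<Sum>i\<in>A. P i t) (\<Sum>i\<in>A. Q i) t"
  using assms by (induction A rule: infinite_finite_induct) (auto intro: has_poly_partial_add has_poly_partial_const)

lemma has_poly_partial_pderiv:
  assumes "has_poly_partial K k P Q t"
  shows "has_poly_partial K k (\<lambda>t. pderiv (P t)) (pderiv Q) t"
proof -
  have "has_partial K k (\<lambda>t. of_nat (Suc n) * coeff (P t) (Suc n)) (0 * coeff (P t) (Suc n) + of_nat (Suc n) * coeff Q (Suc n)) t" for n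
    using assms by (intro has_partial_mult has_partial_const) (simp add: has_poly_partial_def)
  then show ?thesis by (simp add: has_poly_partial_def coeff_pderiv)
qed

lemma has_poly_partial_lambda_poly:
  assumes "\<And>i. has_partial K k (\<lambda>t. a t i) (b i) t"
  shows "has_poly_partial K k (\<lambda>t. lambda_poly n (a t)) (lambda_poly n b) t"
  by (simp add: has_poly_partial_def coeff_lambda_poly assms has_partial_const)

context time_field
begin

lemma has_poly_partial_unique:
  assumes "has_poly_partial K k P Q t" "has_poly_partial K k P Q' t" "t k \<in> K"
  shows "Q = Q'"
  using assms has_partial_unique unfolding has_poly_partial_def poly_eq_iff by blast

lemma has_poly_partial_cong:
  assumes "open_times K g D" "t \<in> D" "k \<in> time_indices g" and "\<And>t. t \<in> D \<Longrightarrow> P t = P' t"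
    and "has_poly_partial K k P Q t"
  shows "has_poly_partial K k P' Q t"
  unfolding has_poly_partial_def
proof
  fix i
  show "has_partial K k (\<lambda>t. coeff (P' t) i) (coeff Q i) t"
    by (rule has_partial_cong[OF assms(1-3), of "\<lambda>t. coeff (P t) i"])
      (use assms(4,5) in \<open>auto simp: has_poly_partial_def\<close>)
qed

end

section \<open>The flows of \<open>\<alpha>\<close> and \<open>\<beta>\<close>\<close>

lemma has_partial_c_time:
  assumes "m \<le> g"
  shows "has_partial K k (c_time g m) (if m \<noteq> 0 \<and> k = 2 * (g - m) + 3 then of_nat k / 2 else 0) t"
proof -
  define N where "N = 2 * (g - m) + 3"
  have "((\<lambda>s. a * s) has_field_derivative a) (at z within K)" for a z :: complex
    by (auto intro!: derivative_eq_intros)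
  from this[of "of_nat k / 2" "t k"] show ?thesis
    unfolding has_partial_def c_time_def N_def[symmetric] by (cases "k = N"; cases "m = 0") auto
qed

context PI_flow
begin

definition LP :: "nat \<Rightarrow> (nat \<Rightarrow> dpoly) \<Rightarrow> (nat \<Rightarrow> complex) \<Rightarrow> complex poly" where
  "LP n p t = lambda_poly n (\<lambda>k. ev t (p k))"

text \<open>For p = R, R_x and R_xx this gives beta, -2 alpha and the second-derivative part of -2
  gamma, so one computation serves all entries of V.\<close>

definition CS :: "(nat \<Rightarrow> dpoly) \<Rightarrow> (nat \<Rightarrow> complex) \<Rightarrow> complex poly" where
  "CS p t = (\<Sum>m\<le>g. smult (c_time g m t) (LP (g - m) p t))"

abbreviation (input) gd1 :: "nat \<Rightarrow> dpoly" where "gd1 k \<equiv> dp_dx (gd k)"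
abbreviation (input) gd2 :: "nat \<Rightarrow> dpoly" where "gd2 k \<equiv> dp_dx (dp_dx (gd k))"

lemma R_fun_fun: "R_fun K u k = (\<lambda>t. ev t (gd k))"
  by (simp add: fun_eq_iff R_fun_ev)

lemma partial2_ev_dx: assumes "t \<in> D" shows "partial K 1 (partial K 1 (\<lambda>t. ev t p)) t = ev t (dp_dx (dp_dx p))"
  using partial_funpow_ev[OF assms, of 2 p] by (simp add: numeral_2_eq_2)

lemma B_poly_LP: "B_poly K u n t = LP n gd t"
  by (simp add: B_poly_def LP_def R_fun_ev)

lemma A_poly_LP: "t \<in> D \<Longrightarrow> A_poly K u n t = smult (-1/2) (LP n gd1 t)"
  unfolding A_poly_def LP_def R_fun_fun by (simp only: partial_ev_dx)

lemma Gamma_poly_LP: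
  "t \<in> D \<Longrightarrow> Gamma_poly K u n t = smult (-1/2) (LP n gd2 t) + [:- u t, 1:] * LP n gd t"
  unfolding Gamma_poly_def B_poly_LP unfolding LP_def R_fun_fun by (simp only: partial2_ev_dx)

lemma beta_poly_CS: "beta_poly K u g t = CS gd t"
  by (simp add: beta_poly_def V_mat_def U_mat_def CS_def B_poly_LP)

lemma alpha_poly_CS: "t \<in> D \<Longrightarrow> alpha_poly K u g t = smult (-1/2) (CS gd1 t)"
  by (simp add: alpha_poly_def V_mat_def U_mat_def CS_def A_poly_LP smult_sum_right mult.commute)

lemma gamma_poly_CS:
  "t \<in> D \<Longrightarrow> gamma_poly K u g t = smult (-1/2) (CS gd2 t) + [:- u t, 1:] * CS gd t"
  by (simp add: gamma_poly_def V_mat_def U_mat_def CS_def Gamma_poly_LP smult_sum_right smult_add_right smult_diff_right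
      sum.distrib sum_subtractf sum_negf sum_distrib_left mult.commute del: mult_pCons_left mult_pCons_right)

lemma has_partial_c_sum:
  assumes "t \<in> D"
  shows "has_partial K 1 (\<lambda>t. \<Sum>m\<le>g. c_time g m t * ev t (p m)) (\<Sum>m\<le>g. c_time g m t * ev t (dp_dx (p m))) t"
proof (rule has_partial_sum)
  fix m assume "m \<in> {..g}"
  then show "has_partial K 1 (\<lambda>t. c_time g m t * ev t (p m)) (c_time g m t * ev t (dp_dx (p m))) t"
    \<comment> \<open>Each c_m is 1 or involves a time of index at least 3, so it is constant for
      d/dx.\<close>
    using has_partial_mult[OF has_partial_c_time has_partial_ev_dx[OF assms], of m g "p m"] by simp
qed

lemma string_equation: "t \<in> D \<Longrightarrow> (\<Sum>m\<le>g. c_time g m t * ev t (gd (Suc (g - m)))) = - t 1 / 2"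
proof -
  assume t: "t \<in> D"
  define S where "S = (\<Sum>m=1..g. c_time g m t * ev t (gd (Suc (g - m))))"
  have "2 * R_fun K u (g + 1) t + (\<Sum>m=1..g. 2 * c_time g m t * R_fun K u (g + 1 - m) t) + t 1 = 0"
    using solution t by (simp add: PI_solution_def)
  moreover have "(\<Sum>m=1..g. 2 * c_time g m t * R_fun K u (g + 1 - m) t) = 2 * S"
    unfolding S_def sum_distrib_left by (intro sum.cong refl) (simp add: R_fun_ev Suc_diff_le)
  moreover have "(\<Sum>m\<le>g. c_time g m t * ev t (gd (Suc (g - m)))) =
      ev t (gd (Suc g)) + S"
    by (simp add: S_def sum.atMost_shift c_time_def sum.atLeast1_atMost_eq)
  ultimately show ?thesis by (simp add: R_fun_ev field_simps eq_neg_iff_add_eq_0)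
qed

lemma string_equation_dx:
  "t \<in> D \<Longrightarrow> (\<Sum>m\<le>g. c_time g m t * ev t ((dp_dx ^^ Suc i) (gd (Suc (g - m))))) = (if i = 0 then - 1 / 2 else 0)"
proof (induction i arbitrary: t)
  case 0
  have 1: "has_partial K 1 (\<lambda>t. \<Sum>m\<le>g. c_time g m t * ev t (gd (Suc (g - m))))
     (\<Sum>m\<le>g. c_time g m t * ev t (dp_dx (gd (Suc (g - m))))) t"
    by (rule has_partial_c_sum[OF 0])
  have 2: "has_partial K 1 (\<lambda>t. - t 1 / 2) (- 1 / 2) t"
    unfolding has_partial_def by (auto intro!: derivative_eq_intros)
  have "has_partial K 1 (\<lambda>t. \<Sum>m\<le>g. c_time g m t * ev t (gd (Suc (g - m)))) (- 1 / 2) t"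
    by (rule has_partial_cong[OF open_D 0 one_index _ 2]) (simp add: string_equation)
  from has_partial_unique[OF 1 this open_times_mem[OF open_D 0 one_index]] show ?case by simp
next
  case (Suc i)
  have 1: "has_partial K 1 (\<lambda>t. \<Sum>m\<le>g. c_time g m t * ev t ((dp_dx ^^ Suc i) (gd (Suc (g - m)))))
     (\<Sum>m\<le>g. c_time g m t * ev t (dp_dx ((dp_dx ^^ Suc i) (gd (Suc (g - m)))))) t"
    by (rule has_partial_c_sum[OF Suc.prems])
  have "has_partial K 1 (\<lambda>t. \<Sum>m\<le>g. c_time g m t * ev t ((dp_dx ^^ Suc i) (gd (Suc (g - m))))) 0 t"
    by (rule has_partial_cong[OF open_D Suc.prems one_index _ has_partial_const]) (rule Suc.IH[symmetric])
  from has_partial_unique[OF 1 this open_times_mem[OF open_D Suc.prems one_index]] show ?case by simp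
qed

text \<open>By the string equation the combination of the flows with coefficients \<open>c_time\<close> is the
  shift of \<open>u\<close> by a constant.\<close>

lemma string_flow:
  assumes t: "t \<in> D"
  shows "(\<Sum>m\<le>g. c_time g m t * ev t (flow (g - m) p)) = - ev t (dp_du p)"
proof (induction p rule: dpoly_induct)
  case (const c)
  then show ?case by (simp add: flow_const dp_du_def ev_simps)
next
  case (var i)
  have "(dp_dx ^^ i) (2 * q) = 2 * (dp_dx ^^ i) q" for q
    using dx_pow_const_mult[of i 2 q] by simp
  then have "(\<Sum>m\<le>g. c_time g m t * ev t (flow (g - m) (dp_var i)))
     = 2 * (\<Sum>m\<le>g. c_time g m t * ev t ((dp_dx ^^ Suc i) (gd (Suc (g - m)))))"
    by (simp add: flow_var ev_simps sum_distrib_left mult.left_commute funpow_swap1)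
  \<comment> \<open>On u the combination gives 2 (-1/2) = -1, on every x-derivative of u it gives
    0.\<close>
  also have "\<dots> = - ev t (dp_du (dp_var i))"
    unfolding string_equation_dx[OF t] by (simp add: dp_du_def ev_simps)
  finally show ?case .
next
  case (add p q)
  then show ?case
    by (simp add: derivationD(1)[OF derivation_flow] derivationD(1)[OF derivation_du] ev_simps algebra_simps sum.distrib)
next
  case (mult p q)
  have "(\<Sum>m\<le>g. c_time g m t * ev t (flow (g - m) (p * q))) =
     (\<Sum>m\<le>g. c_time g m t * ev t (flow (g - m) p)) * ev t q + (\<Sum>m\<le>g. c_time g m t * ev t (flow (g - m) q)) * ev t p"
    by (simp add: derivationD(2)[OF derivation_flow] ev_simps algebra_simps sum.distrib sum_distrib_left)
  then show ?case unfolding mult by (simp add: derivationD(2)[OF derivation_du] ev_simps algebra_simps)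
qed

lemma string_flow_gd:
  assumes t: "t \<in> D"
  shows "(\<Sum>m\<le>g. c_time g m t * ev t (flow (g - m) (gd k))) =
    (case k of 0 \<Rightarrow> 0 | Suc j \<Rightarrow> - (of_nat j + 1 / 2) * ev t (gd j))"
proof (cases k)
  case 0
  then show ?thesis by (simp add: gd_0 derivation_1[OF derivation_flow] ev_simps)
next
  case (Suc j)
  have "2 * ev t (dp_du (gd (Suc j))) = (2 * of_nat j + 1) * ev t (gd j)"
    using arg_cong[OF dp_du_gd[of j], of "ev t"] by (simp add: ev_simps flip: dp_const_of_nat)
  then show ?thesis unfolding string_flow[OF t] using Suc by (simp add: field_simps)
qed

section \<open>Zero curvature equations\<close>

lemma flow_gd_symmetric: "flow n (gd (Suc k)) = flow k (gd (Suc n))"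
proof -
  \<comment> \<open>\<open>w\<close> is odd under the reflection of \<open>i\<close> to n + k + 1 -
    i. Its full sum therefore vanishes, and the tail beyond \<open>n\<close> is minus the sum up to
    \<open>k\<close>.\<close>
  define w where "w i = gd i * gd1 (Suc (n + k) - i) - gd1 i * gd (Suc (n + k) - i)" for i
  have "flow n (gd (Suc k)) = (\<Sum>i\<le>n. w i)" by (simp add: flow_gd w_def)
  also have "\<dots> = (\<Sum>i\<le>Suc (n + k). w i) - (\<Sum>i\<in>{Suc n..Suc (n + k)}. w i)"
  proof -
    have "{..Suc (n + k)} = {..n} \<union> {Suc n..Suc (n + k)}" by auto
    then have "(\<Sum>i\<le>Suc (n + k). w i) = (\<Sum>i\<le>n. w i) + (\<Sum>i\<in>{Suc n..Suc (n + k)}. w i)"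
      by (simp only:) (rule sum.union_disjoint, auto)
    then show ?thesis by simp
  qed
  also have "(\<Sum>i\<in>{Suc n..Suc (n + k)}. w i) = (\<Sum>i\<le>k. - w i)"
    by (rule sum.reindex_bij_witness[where i = "\<lambda>i. Suc (n + k) - i" and j = "\<lambda>i. Suc (n + k) - i"])
      (auto simp: w_def)
  also have "(\<Sum>i\<le>Suc (n + k). w i) = 0"
  proof -
    have "(\<Sum>i\<le>Suc (n + k). w i) = (\<Sum>i\<le>Suc (n + k). - w i)"
      by (rule sum.reindex_bij_witness[where i = "\<lambda>i. Suc (n + k) - i" and j = "\<lambda>i. Suc (n + k) - i"])
        (auto simp: w_def)
    moreover have "p = 0" if "p = - p" for p :: dpoly
      using that by (simp add: eq_neg_iff_add_eq_0 flip: mult_2)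
    ultimately show ?thesis unfolding sum_negf by blast
  qed
  finally have "flow n (gd (Suc k)) = (\<Sum>i\<le>k. w i)" by (simp only: sum_negf) simp
  also have "\<dots> = flow k (gd (Suc n))" by (simp add: flow_gd w_def add.commute)
  finally show ?thesis .
qed

lemma flow_gd_step: "flow (Suc k) (gd j) = flow k (gd (Suc j)) + (gd (Suc k) * gd1 j - gd1 (Suc k) * gd j)"
  by (simp add: flow_gd)

lemma flow_0: "flow 0 (gd k) = gd1 k"
  by (simp add: flow_gd gd_0 dp_dx_simps)

text \<open>The upper right entry of the zero curvature equation for U_n and U_k. Raising
  \<open>k\<close> multiplies both sides by lambda and adds terms with R_(k+1); the symmetry of the
  flows makes the constant terms on the left cancel.\<close>

lemma zero_curvature:
  "LP k (\<lambda>j. flow n (gd j)) t - LP n (\<lambda>j. flow k (gd j)) t = LP n gd t * LP k gd1 t - LP n gd1 t * LP k gd t"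
proof (induction k)
  case 0
  then show ?case
    by (simp add: LP_def lambda_poly_0 gd_0 flow_0 derivation_1[OF derivation_flow] dp_dx_simps ev_simps)
next
  case (Suc k)
  define r where "r = ev t (gd (Suc k))"
  define r' where "r' = ev t (gd1 (Suc k))"
  have "LP n (\<lambda>j. flow (Suc k) (gd j)) t = LP n (\<lambda>j. flow k (gd (Suc j))) t + smult r (LP n gd1 t) - smult r' (LP n gd t)"
    by (simp add: poly_eq_iff LP_def coeff_lambda_poly flow_gd_step ev_simps r_def r'_def)
  also have "LP n (\<lambda>j. flow k (gd (Suc j))) t = pCons (ev t (flow k (gd (Suc n)))) (LP n (\<lambda>j. flow k (gd j)) t)"
    unfolding LP_def lambda_poly_shift[of n "\<lambda>j. ev t (flow k (gd j))"]
    by (simp add: gd_0 derivation_1[OF derivation_flow] ev_simps)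
  finally have 1: "LP n (\<lambda>j. flow (Suc k) (gd j)) t = pCons (ev t (flow n (gd (Suc k)))) (LP n (\<lambda>j. flow k (gd j)) t)
      + smult r (LP n gd1 t) - smult r' (LP n gd t)" by (simp add: flow_gd_symmetric)
  have 2: "LP (Suc k) p t = pCons (ev t (p (Suc k))) (LP k p t)" for p
    by (simp add: LP_def lambda_poly_Suc)
  have "LP (Suc k) (\<lambda>j. flow n (gd j)) t - LP n (\<lambda>j. flow (Suc k) (gd j)) t
     = pCons 0 (LP k (\<lambda>j. flow n (gd j)) t - LP n (\<lambda>j. flow k (gd j)) t) - smult r (LP n gd1 t) + smult r' (LP n gd t)"
    unfolding 1 2 by (simp add: algebra_simps)
  also have "\<dots> = LP n gd t * LP (Suc k) gd1 t - LP n gd1 t * LP (Suc k) gd t"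
    unfolding Suc 2 by (simp add: r_def r'_def mult_pCons_right smult_diff_right algebra_simps)
  finally show ?case .
qed

lemma has_poly_partial_LP_flow:
  "n \<le> g \<Longrightarrow> t \<in> D \<Longrightarrow> has_poly_partial K (2 * n + 1) (LP k p) (LP k (\<lambda>j. flow n (p j)) t) t"
  unfolding LP_def by (rule has_poly_partial_lambda_poly[OF has_partial_ev_flow])

lemma has_poly_partial_LP_dx:
  "t \<in> D \<Longrightarrow> has_poly_partial K 1 (LP k p) (LP k (\<lambda>j. dp_dx (p j)) t) t"
  unfolding LP_def by (rule has_poly_partial_lambda_poly[OF has_partial_ev_dx])

lemma has_poly_partial_CS_dx:
  assumes "t \<in> D" shows "has_poly_partial K 1 (CS p) (CS (\<lambda>j. dp_dx (p j)) t) t"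
  unfolding CS_def
proof (rule has_poly_partial_sum)
  fix m assume "m \<in> {..g}"
  then show "has_poly_partial K 1 (\<lambda>t. smult (c_time g m t) (LP (g - m) p t))
      (smult (c_time g m t) (LP (g - m) (\<lambda>j. dp_dx (p j)) t)) t"
    using has_poly_partial_smult[OF has_partial_c_time has_poly_partial_LP_dx[OF assms], of m g "g - m" p] by simp
qed

text \<open>The second summand comes from the explicit times: the time of index 2n+1 with n > 0
  occurs only in c_(g+1-n), with derivative n + 1/2, and that coefficient multiplies the polynomial
  of degree index n - 1. The time x occurs in no c_m.\<close>

definition CS_flow :: "nat \<Rightarrow> (nat \<Rightarrow> dpoly) \<Rightarrow> (nat \<Rightarrow> complex) \<Rightarrow> complex poly" where
  "CS_flow n p t = CS (\<lambda>j. flow n (p j)) t + (if n = 0 then 0 else smult (of_nat n + 1 / 2) (LP (n - 1) p t))"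

lemma has_poly_partial_CS_flow:
  assumes "n \<le> g" "t \<in> D" shows "has_poly_partial K (2 * n + 1) (CS p) (CS_flow n p t) t"
proof -
  let ?d = "\<lambda>m. if m \<noteq> 0 \<and> 2 * n + 1 = 2 * (g - m) + 3 then of_nat (2 * n + 1) / 2 else (0 :: complex)"
  have "has_poly_partial K (2 * n + 1) (CS p) (\<Sum>m\<le>g. smult (?d m) (LP (g - m) p t)
     + smult (c_time g m t) (LP (g - m) (\<lambda>j. flow n (p j)) t)) t"
    unfolding CS_def
    by (intro has_poly_partial_sum has_poly_partial_smult has_partial_c_time has_poly_partial_LP_flow[OF assms]) simp
  also have "(\<Sum>m\<le>g. smult (?d m) (LP (g - m) p t) + smult (c_time g m t) (LP (g - m) (\<lambda>j. flow n (p j)) t))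
     = (\<Sum>m\<le>g. smult (?d m) (LP (g - m) p t)) + CS (\<lambda>j. flow n (p j)) t"
    by (simp add: sum.distrib CS_def)
  also have "(\<Sum>m\<le>g. smult (?d m) (LP (g - m) p t)) = (if n = 0 then 0 else smult (of_nat n + 1 / 2) (LP (n - 1) p t))"
  proof (cases "n = 0")
    case False
    have "(\<Sum>m\<le>g. smult (?d m) (LP (g - m) p t)) = (\<Sum>m\<le>g. if m = Suc g - n then smult (of_nat n + 1 / 2) (LP (n - 1) p t) else 0)"
    proof (intro sum.cong refl)
      fix m assume "m \<in> {..g}"
      then have "m \<noteq> 0 \<and> 2 * n + 1 = 2 * (g - m) + 3 \<longleftrightarrow> m = Suc g - n"
        and "m = Suc g - n \<Longrightarrow> g - m = n - 1" using False assms(1) by auto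
      then show "smult (?d m) (LP (g - m) p t) = (if m = Suc g - n then smult (of_nat n + 1 / 2) (LP (n - 1) p t) else 0)"
        by (simp add: add_divide_distrib add.commute)
    qed
    also have "\<dots> = smult (of_nat n + 1 / 2) (LP (n - 1) p t)" using False by simp
    finally show ?thesis using False by simp
  qed (simp add: sum.neutral)
  finally show ?thesis by (simp add: CS_flow_def add.commute)
qed

text \<open>At the coefficient \<open>a j\<close> the contributions -(j + 1/2) and n + 1/2 add up to
  n - j, the exponent of lambda there.\<close>

lemma lambda_poly_pderiv:
  "lambda_poly n (\<lambda>k. case k of 0 \<Rightarrow> 0 | Suc j \<Rightarrow> - (of_nat j + 1 / 2) * a j)
     + (if n = 0 then 0 else smult (of_nat n + 1 / 2) (lambda_poly (n - 1) a)) = pderiv (lambda_poly n a)"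
proof (rule poly_eqI)
  fix i
  consider "Suc i \<le> n" | "Suc i > n" by linarith
  then show "coeff (lambda_poly n (\<lambda>k. case k of 0 \<Rightarrow> 0 | Suc j \<Rightarrow> - (of_nat j + 1 / 2) * a j)
     + (if n = 0 then 0 else smult (of_nat n + 1 / 2) (lambda_poly (n - 1) a))) i = coeff (pderiv (lambda_poly n a)) i"
  proof cases
    case 1
    then obtain d where n: "n = Suc i + d" using le_Suc_ex by blast
    show ?thesis unfolding n by (simp add: coeff_lambda_poly coeff_pderiv Suc_diff_le algebra_simps)
  next
    case 2
    then show ?thesis by (auto simp: coeff_lambda_poly coeff_pderiv split: nat.splits)
  qed
qed

text \<open>Summing the zero curvature equations with weights c_m exchanges the n-th flow of beta
  for the weighted flows of R_n, which the string equation evaluates. This is the upper right entry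
  of the Lax equation.\<close>

lemma beta_flow:
  assumes n: "n \<le> g" and t: "t \<in> D"
  shows "CS_flow n gd t = LP n gd t * CS gd1 t - LP n gd1 t * CS gd t + pderiv (LP n gd t)"
proof -
  have "CS (\<lambda>j. flow n (gd j)) t = (\<Sum>m\<le>g. smult (c_time g m t)
     (LP n (\<lambda>j. flow (g - m) (gd j)) t + (LP n gd t * LP (g - m) gd1 t - LP n gd1 t * LP (g - m) gd t)))"
    unfolding CS_def zero_curvature[symmetric] by simp
  also have "\<dots> = (\<Sum>m\<le>g. smult (c_time g m t) (LP n (\<lambda>j. flow (g - m) (gd j)) t))
     + (LP n gd t * CS gd1 t - LP n gd1 t * CS gd t)"
    by (simp add: CS_def smult_add_right smult_diff_right sum.distrib sum_subtractf sum_distrib_left)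
  also have "(\<Sum>m\<le>g. smult (c_time g m t) (LP n (\<lambda>j. flow (g - m) (gd j)) t))
     = lambda_poly n (\<lambda>k. case k of 0 \<Rightarrow> 0 | Suc j \<Rightarrow> - (of_nat j + 1 / 2) * ev t (gd j))"
    unfolding LP_def string_flow_gd[OF t, symmetric] by (simp add: lambda_poly_sum lambda_poly_smult)
  finally have CS: "CS (\<lambda>j. flow n (gd j)) t =
     lambda_poly n (\<lambda>k. case k of 0 \<Rightarrow> 0 | Suc j \<Rightarrow> - (of_nat j + 1 / 2) * ev t (gd j))
     + (LP n gd t * CS gd1 t - LP n gd1 t * CS gd t)" .
  show ?thesis
    unfolding CS_flow_def CS LP_def lambda_poly_pderiv[symmetric] by (simp only: add.assoc add.commute add.left_commute)
qed

text \<open>The x-derivative of the equation for beta; the products of two first derivatives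
  cancel.\<close>

lemma alpha_flow:
  assumes n: "n \<le> g" and t: "t \<in> D"
  shows "CS_flow n gd1 t = LP n gd t * CS gd2 t - LP n gd2 t * CS gd t + pderiv (LP n gd1 t)"
proof -
  let ?Q = "\<lambda>t. LP n gd t * CS gd1 t + LP n (\<lambda>j. - gd1 j) t * CS gd t + pderiv (LP n gd t)"
  have neg: "LP n (\<lambda>j. - p j) t = - LP n p t" for p t
    by (simp add: LP_def poly_eq_iff coeff_lambda_poly ev_simps)
  have 1: "has_poly_partial K 1 ?Q
     (LP n gd1 t * CS gd1 t + LP n gd t * CS gd2 t + (LP n (\<lambda>j. dp_dx (- gd1 j)) t * CS gd t + LP n (\<lambda>j. - gd1 j) t * CS gd1 t)
       + pderiv (LP n gd1 t)) t"
    by (intro has_poly_partial_add has_poly_partial_mult has_poly_partial_pderiv has_poly_partial_LP_dx[OF t] has_poly_partial_CS_dx[OF t])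
  have "has_poly_partial K 1 (CS_flow n gd) (CS_flow n gd1 t) t"
    unfolding CS_flow_def flow_commute
    by (cases "n = 0") (auto intro!: has_poly_partial_add has_poly_partial_smult_const has_poly_partial_const
      has_poly_partial_LP_dx[OF t, unfolded One_nat_def] has_poly_partial_CS_dx[OF t, unfolded One_nat_def]
      has_poly_partial_CS_dx[OF t, unfolded One_nat_def, THEN has_poly_partial_add])
  then have "has_poly_partial K 1 ?Q (CS_flow n gd1 t) t"
    by (rule has_poly_partial_cong[OF open_D t one_index, rotated]) (simp add: beta_flow[OF n] neg)
  from has_poly_partial_unique[OF this 1 open_times_mem[OF open_D t one_index]]
  show ?thesis by (simp add: neg dp_dx_simps)
qed

end

section \<open>The leading coefficients of \<open>h\<close>\<close>

text \<open>\<open>\<lambda>\<^sup>N * rev_fps N p (1/\<lambda>) = p \<lambda>\<close>\<close>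

definition rev_fps :: "nat \<Rightarrow> 'a::comm_ring_1 poly \<Rightarrow> 'a fps" where
  "rev_fps N p = Abs_fps (\<lambda>k. if k \<le> N then coeff p (N - k) else 0)"

lemma rev_fps_nth: "fps_nth (rev_fps N p) k = (if k \<le> N then coeff p (N - k) else 0)"
  by (simp add: rev_fps_def)

lemma rev_fps_linear:
  "rev_fps N (p + q) = rev_fps N p + rev_fps N q"
  "rev_fps N (p - q) = rev_fps N p - rev_fps N q"
  "rev_fps N (smult c p) = fps_const c * rev_fps N p"
  by (auto simp: fps_eq_iff rev_fps_nth)

lemma rev_fps_Suc:
  assumes "degree p \<le> N" shows "rev_fps (Suc N) p = fps_X * rev_fps N p"
  using assms by (auto simp: fps_eq_iff rev_fps_nth coeff_eq_0 not_less_eq_eq Suc_diff_le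
      split: nat.splits intro!: coeff_eq_0)

lemma rev_fps_pCons: "rev_fps (Suc N) (pCons 0 p) = rev_fps N p"
  by (auto simp: fps_eq_iff rev_fps_nth Suc_diff_le coeff_pCons le_Suc_eq split: nat.splits)

lemma rev_fps_mult:
  assumes p: "degree p \<le> N" and q: "degree q \<le> M"
  shows "rev_fps (N + M) (p * q) = rev_fps N p * rev_fps M q"
proof (rule fps_ext)
  fix k
  define T where "T = {i. i \<le> N \<and> i \<le> k \<and> k - i \<le> M}"
  have rhs: "fps_nth (rev_fps N p * rev_fps M q) k = (\<Sum>i\<in>T. coeff p (N - i) * coeff q (M - (k - i)))"
    unfolding fps_mult_nth rev_fps_nth by (rule sum.mono_neutral_cong_right) (auto simp: T_def)
  show "fps_nth (rev_fps (N + M) (p * q)) k = fps_nth (rev_fps N p * rev_fps M q) k"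
  proof (cases "k \<le> N + M")
    case True
    have "fps_nth (rev_fps (N + M) (p * q)) k = (\<Sum>j\<le>N + M - k. coeff p j * coeff q (N + M - k - j))"
      using True by (simp add: rev_fps_nth coeff_mult)
    also have "\<dots> = (\<Sum>j\<in>{j. j \<le> N \<and> N \<le> k + j \<and> j \<le> N + M - k}. coeff p j * coeff q (N + M - k - j))"
    proof (rule sum.mono_neutral_right)
      show "\<forall>j\<in>{..N + M - k} - {j. j \<le> N \<and> N \<le> k + j \<and> j \<le> N + M - k}. coeff p j * coeff q (N + M - k - j) = 0"
      proof
        fix j assume "j \<in> {..N + M - k} - {j. j \<le> N \<and> N \<le> k + j \<and> j \<le> N + M - k}"
        then have "j > N \<or> N + M - k - j > M" by auto
        then show "coeff p j * coeff q (N + M - k - j) = 0"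
          using p q by (auto simp: coeff_eq_0)
      qed
    qed auto
    also have "\<dots> = (\<Sum>i\<in>T. coeff p (N - i) * coeff q (M - (k - i)))"
    proof (rule sum.reindex_bij_witness[where i = "\<lambda>i. N - i" and j = "\<lambda>i. N - i"])
      fix j assume "j \<in> {j. j \<le> N \<and> N \<le> k + j \<and> j \<le> N + M - k}"
      then have "N + M - k - j = M - (k - (N - j))" "N - (N - j) = j" using True by auto
      then show "coeff p (N - (N - j)) * coeff q (M - (k - (N - j))) = coeff p j * coeff q (N + M - k - j)" by simp
    qed (use True in \<open>auto simp: T_def\<close>)
    finally show ?thesis unfolding rhs .
  next
    case False
    then have "T = {}" by (auto simp: T_def)
    then show ?thesis unfolding rhs using False by (simp add: rev_fps_nth)
  qed
qed

context PI_flow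
begin

lemma degree_CS: "degree (CS p t) \<le> g"
  unfolding CS_def LP_def
  by (intro degree_sum_le) (auto intro!: order_trans[OF degree_smult_le] order_trans[OF degree_lambda_poly])

text \<open>Cut off beyond \<open>g\<close>, where truncated subtraction would make
  \<open>c_time g m\<close> a multiple of \<open>t 3\<close> instead of 0.\<close>

definition c_fps :: "(nat \<Rightarrow> complex) \<Rightarrow> complex fps" where
  "c_fps t = Abs_fps (\<lambda>m. if m \<le> g then c_time g m t else 0)"

definition ev_fps :: "(nat \<Rightarrow> complex) \<Rightarrow> (nat \<Rightarrow> dpoly) \<Rightarrow> complex fps" where
  "ev_fps t p = Abs_fps (\<lambda>k. ev t (p k))"

lemma coeff_CS:
  assumes "k \<le> g"
  shows "coeff (CS p t) (g - k) = fps_nth (c_fps t * ev_fps t p) k"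
proof -
  have "coeff (CS p t) (g - k) = (\<Sum>m\<le>g. if m \<le> k then c_time g m t * ev t (p (k - m)) else 0)"
    unfolding CS_def coeff_sum LP_def coeff_smult coeff_lambda_poly
    by (intro sum.cong refl) (use assms in auto)
  also have "\<dots> = (\<Sum>m=0..k. c_time g m t * ev t (p (k - m)))"
    by (rule sum.mono_neutral_cong_right) (use assms in auto)
  finally show ?thesis
    using assms unfolding fps_mult_nth by (auto simp: c_fps_def ev_fps_def intro!: sum.cong)
qed

lemma quadratic_ev:
  "4 * (ev_fps t gd)\<^sup>2 + fps_X * ((ev_fps t gd1)\<^sup>2 - 2 * ev_fps t gd * ev_fps t gd2 - 4 * fps_const (ev t dp_u) * (ev_fps t gd)\<^sup>2) = 4"
proof -
  define E where "E = fps_lift (ev t)"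
  have E: "E (f + h) = E f + E h" "E (f - h) = E f - E h" "E (f * h) = E f * E h" for f h
    by (auto simp: E_def fps_eq_iff ev_simps fps_mult_nth)
  have E_num: "E (numeral k) = numeral k" "E fps_X = fps_X" for k
    by (auto simp: E_def fps_eq_iff numeral_fps_const fps_X_def ev_simps)
  have "E gd_fps = ev_fps t gd" "E (dx gd_fps) = ev_fps t gd1" "E (dx (dx gd_fps)) = ev_fps t gd2"
    "E u_fps = fps_const (ev t dp_u)"
    by (auto simp: E_def fps_eq_iff gd_fps_def ev_fps_def u_fps_def ev_simps)
  then have "4 * (ev_fps t gd)\<^sup>2 = 4 + fps_X * (2 * ev_fps t gd * ev_fps t gd2 - (ev_fps t gd1)\<^sup>2
      + 4 * fps_const (ev t dp_u) * (ev_fps t gd)\<^sup>2)"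
    using arg_cong[OF gd_fps_quadratic, of E]
    by (simp add: quad_form_def E E_num power2_eq_square)
  then show ?thesis by (simp add: algebra_simps)
qed

lemma h_poly_CS:
  assumes "t \<in> D"
  shows "smult 4 (h_poly K u g t) = (CS gd1 t)\<^sup>2 - smult 2 (CS gd t * CS gd2 t) - smult (4 * u t) ((CS gd t)\<^sup>2)
    + smult 4 (pCons 0 ((CS gd t)\<^sup>2))"
proof -
  have "[:- u t, 1:] * CS gd t = pCons 0 (CS gd t) - smult (u t) (CS gd t)"
    by simp
  then show ?thesis
    unfolding h_poly_def alpha_poly_CS[OF assms] beta_poly_CS gamma_poly_CS[OF assms]
    by (simp add: power2_eq_square smult_add_right smult_diff_right algebra_simps)
qed

lemma c_fps_nth: "fps_nth (c_fps t) m = (if m \<le> g then c_time g m t else 0)"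
  by (simp add: c_fps_def)

text \<open>The double sums in \<open>I0\<close> are coefficients of the square of
  \<open>c_fps\<close>; at order g + 1 the cutoff removes the terms m = 0 and m = g + 1.\<close>

lemma coeff_I0:
  assumes "k \<le> Suc g"
  shows "coeff (I0 g t) (2 * g + 1 - k) = fps_nth ((c_fps t)\<^sup>2) k + (if k = Suc g then t 1 else 0)"
proof -
  have "coeff (I0 g t) (2 * g + 1 - k) =
      (\<Sum>j\<le>g. if j = k then \<Sum>m\<le>k. c_time g m t * c_time g (k - m) t else 0)
      + (if k = Suc g then (\<Sum>m=1..g. c_time g m t * c_time g (g + 1 - m) t) + t 1 else 0)"
    unfolding I0_def coeff_add coeff_sum coeff_monom
    by (intro arg_cong2[where f = "(+)"] sum.cong refl) (use assms in auto)
  also have "\<dots> = fps_nth ((c_fps t)\<^sup>2) k + (if k = Suc g then t 1 else 0)"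
  proof (cases "k = Suc g")
    case True
    have "(\<Sum>m=1..g. c_time g m t * c_time g (g + 1 - m) t) = fps_nth ((c_fps t)\<^sup>2) (Suc g)"
      unfolding power2_eq_square fps_mult_nth
      by (rule sum.mono_neutral_cong_left) (auto simp: c_fps_nth)
    then show ?thesis using True by simp
  next
    case False
    then have "(\<Sum>m\<le>k. c_time g m t * c_time g (k - m) t) = fps_nth ((c_fps t)\<^sup>2) k"
      unfolding power2_eq_square fps_mult_nth using assms
      by (intro sum.cong) (auto simp: c_fps_nth)
    then show ?thesis using False assms by simp
  qed
  finally show ?thesis .
qed

text \<open>Up to order \<open>g\<close> the reversed \<open>\<beta>\<close> is the product of \<open>c_fps\<close> and \<open>gd_fps\<close>, for which the quadratic
  relation gives \<open>c_fps\<^sup>2\<close>; the coefficient of order \<open>g + 1\<close> is corrected by the string equation.\<close>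

lemma coeff_h_poly:
  assumes t: "t \<in> D" and i: "g \<le> i"
  shows "coeff (h_poly K u g t) i = coeff (I0 g t) i"
proof (cases "i \<le> 2 * g + 1")
  case True
  define k where "k = 2 * g + 1 - i"
  have k: "k \<le> Suc g" "i = 2 * g + 1 - k" using True i by (auto simp: k_def)
  define c where "c = c_fps t"
  define P P1 P2 where "P = ev_fps t gd" and "P1 = ev_fps t gd1" and "P2 = ev_fps t gd2"
  define U where "U = fps_const (ev t dp_u)"
  define b b1 b2 where "b = rev_fps g (CS gd t)" and "b1 = rev_fps g (CS gd1 t)" and "b2 = rev_fps g (CS gd2 t)"
  \<comment> \<open>A polynomial of degree at most g has no terms beyond order g; the error against
    the full series product starts at order g + 1.\<close>
  have corr: "rev_fps g (CS p t) = c * ev_fps t p + fps_X ^ Suc g * fps_shift (Suc g) (- (c * ev_fps t p))" for p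
  proof (rule fps_ext)
    fix n
    show "fps_nth (rev_fps g (CS p t)) n = fps_nth (c * ev_fps t p + fps_X ^ Suc g * fps_shift (Suc g) (- (c * ev_fps t p))) n"
      using coeff_CS[of n p t] by (auto simp: rev_fps_nth c_def fps_X_power_mult_nth simp del: power_Suc)
  qed
  define f f1 f2 where "f = fps_shift (Suc g) (- (c * P))" and "f1 = fps_shift (Suc g) (- (c * P1))"
    and "f2 = fps_shift (Suc g) (- (c * P2))"
  have b: "b = c * P + fps_X ^ Suc g * f" "b1 = c * P1 + fps_X ^ Suc g * f1" "b2 = c * P2 + fps_X ^ Suc g * f2"
    unfolding b_def b1_def b2_def f_def f1_def f2_def P_def P1_def P2_def by (rule corr)+
  have f0: "fps_nth f 0 = t 1 / 2"
  proof -
    have "fps_nth (c * P) (Suc g) = (\<Sum>m\<le>g. c_time g m t * ev t (gd (Suc (g - m))))"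
      unfolding fps_mult_nth by (rule sum.mono_neutral_cong_right) (auto simp: c_def c_fps_nth P_def ev_fps_def Suc_diff_le)
    then show ?thesis by (simp add: f_def string_equation[OF t])
  qed
  have "ev t dp_u = u t" by (simp add: dp_u_eq_var ev_var)
  have deg: "degree (CS p t * CS q t) \<le> 2 * g" for p q
    using degree_mult_le[of "CS p t" "CS q t"] degree_CS[of p t] degree_CS[of q t] by linarith
  have rev: "rev_fps (2 * g) (CS p t * CS q t) = rev_fps g (CS p t) * rev_fps g (CS q t)" for p q
    using rev_fps_mult[OF degree_CS[of p t] degree_CS[of q t]] by (simp add: mult_2)
  have "fps_const 4 * rev_fps (Suc (2 * g)) (h_poly K u g t)
     = fps_X * (b1\<^sup>2 - fps_const 2 * (b * b2) - fps_const (4 * u t) * b\<^sup>2) + fps_const 4 * b\<^sup>2"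
    unfolding rev_fps_linear(3)[symmetric] h_poly_CS[OF t] rev_fps_linear power2_eq_square rev_fps_pCons
      rev_fps_Suc[OF deg] rev b_def b1_def b2_def
    by (simp add: algebra_simps)
  also have "fps_const (4 * u t) = 4 * U"
    using \<open>ev t dp_u = u t\<close> by (simp add: U_def numeral_fps_const fps_const_mult)
  finally have "fps_const 4 * rev_fps (Suc (2 * g)) (h_poly K u g t)
     = fps_X * (b1\<^sup>2 - 2 * (b * b2) - 4 * U * b\<^sup>2) + 4 * b\<^sup>2" by (simp add: numeral_fps_const)
  \<comment> \<open>Everything free of the truncation errors is collected in the first summand.
    Among the errors only 8 c P f reaches order g + 1, where it contributes 8 (x/2) = 4 x.\<close>
  also have "\<dots> = c\<^sup>2 * (4 * P\<^sup>2 + fps_X * (P1\<^sup>2 - 2 * P * P2 - 4 * U * P\<^sup>2))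
     + fps_X ^ Suc g * (8 * c * P * f + fps_X * (4 * fps_X ^ g * f\<^sup>2
       + 2 * c * P1 * f1 + fps_X ^ Suc g * f1\<^sup>2 - 2 * (c * P * f2 + f * c * P2 + fps_X ^ Suc g * f * f2)
       - 4 * U * (2 * c * P * f + fps_X ^ Suc g * f\<^sup>2)))"
    unfolding b by (simp add: power2_eq_square algebra_simps)
  also have "4 * P\<^sup>2 + fps_X * (P1\<^sup>2 - 2 * P * P2 - 4 * U * P\<^sup>2) = 4"
    unfolding P_def P1_def P2_def U_def by (rule quadratic_ev)
  finally obtain r where r: "fps_const 4 * rev_fps (Suc (2 * g)) (h_poly K u g t)
     = c\<^sup>2 * 4 + fps_X ^ Suc g * (8 * c * P * f + fps_X * r)" by blast
  have "fps_nth (8 * c * P * f + fps_X * r) 0 = 4 * t 1"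
    by (simp add: f0 c_def c_fps_nth c_time_def P_def ev_fps_def gd_0 ev_simps fps_numeral_nth)
  then have "4 * coeff (h_poly K u g t) i = 4 * fps_nth (c\<^sup>2) k + (if k = Suc g then 4 * t 1 else 0)"
    using arg_cong[OF r, of "\<lambda>f. fps_nth f k"] k
    by (auto simp: rev_fps_nth fps_X_power_mult_nth numeral_fps_const mult.commute simp del: power_Suc)
  also have "\<dots> = 4 * coeff (I0 g t) i"
    unfolding k(2) coeff_I0[OF k(1)] by (simp add: c_def)
  finally show ?thesis by simp
next
  case False
  have deg: "degree (CS p t * CS q t) \<le> 2 * g" for p q
    using degree_mult_le[of "CS p t" "CS q t"] degree_CS[of p t] degree_CS[of q t] by linarith
  have z: "coeff (CS p t * CS q t) j = 0" if "j > 2 * g" for p q j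
    by (rule coeff_eq_0, rule le_less_trans[OF deg that])
  obtain j where j: "i = Suc j" "j > 2 * g" using False by (cases i) auto
  have "coeff (smult 4 (h_poly K u g t)) i = 0"
    unfolding h_poly_CS[OF t] power2_eq_square using j by (simp add: z)
  moreover have "coeff (I0 g t) i = 0"
    unfolding I0_def using False by (auto simp: coeff_sum intro!: sum.neutral)
  ultimately show ?thesis by simp
qed

end

section \<open>Polynomials with simple roots\<close>

definition cofactor :: "nat \<Rightarrow> (nat \<Rightarrow> complex) \<Rightarrow> nat \<Rightarrow> complex poly" where
  "cofactor g l j = (\<Prod>i\<in>{1..g} - {j}. [:- l i, 1:])"

lemma beta_of_roots_factor:
  assumes "j \<in> {1..g}" shows "beta_of_roots g l = [:- l j, 1:] * cofactor g l j"
  unfolding beta_of_roots_def cofactor_def using assms by (simp add: prod.remove)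

lemma cofactor_upd: "cofactor g (l(j := z)) j = cofactor g l j"
  unfolding cofactor_def by (intro prod.cong) auto

lemma degree_cofactor:
  assumes "j \<in> {1..g}" shows "degree (cofactor g l j) = g - 1"
  unfolding cofactor_def by (subst degree_prod_eq_sum_degree) (use assms in auto)

lemma poly_cofactor_eq_0_iff: "poly (cofactor g l j) x = 0 \<longleftrightarrow> (\<exists>i\<in>{1..g} - {j}. x = l i)"
  by (auto simp: cofactor_def poly_prod)

lemma poly_cofactor_root_neq_0:
  assumes "inj_on l {1..g}" "j \<in> {1..g}" shows "poly (cofactor g l j) (l j) \<noteq> 0"
  unfolding poly_cofactor_eq_0_iff using inj_onD[OF assms(1) _ assms(2)] by blast

lemma pderiv_linear_factor: "pderiv ([:- a, 1:] * p) = p + [:- a, 1:] * pderiv (p :: complex poly)"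
  by (simp add: pderiv_mult pderiv_pCons add.commute del: mult_pCons_left)

lemma pderiv_beta_of_roots:
  assumes "j \<in> {1..g}"
  shows "poly (pderiv (beta_of_roots g l)) x = poly (cofactor g l j) x + (x - l j) * poly (pderiv (cofactor g l j)) x"
  unfolding beta_of_roots_factor[OF assms] pderiv_linear_factor by (simp add: algebra_simps)

lemma pderiv_sum: "pderiv (sum f A) = (\<Sum>i\<in>A. pderiv (f i))"
  by (induction A rule: infinite_finite_induct) (simp_all add: pderiv_add)

lemma lagrange_interpolation:
  assumes inj: "inj_on l {1..g}" and deg: "degree p < g"
  shows "p = (\<Sum>k=1..g. smult (poly p (l k) / poly (cofactor g l k) (l k)) (cofactor g l k))"
proof -
  define q where "q = (\<Sum>k=1..g. smult (poly p (l k) / poly (cofactor g l k) (l k)) (cofactor g l k))"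
  have "poly q (l j) = poly p (l j)" if j: "j \<in> {1..g}" for j
  proof -
    have "poly q (l j) = (\<Sum>k=1..g. if k = j then poly p (l j) else 0)"
      unfolding q_def poly_sum
    proof (intro sum.cong refl)
      fix k assume k: "k \<in> {1..g}"
      have "poly (cofactor g l k) (l j) = 0 \<longleftrightarrow> k \<noteq> j"
        using poly_cofactor_root_neq_0[OF inj j] j unfolding poly_cofactor_eq_0_iff by blast
      then show "poly (smult (poly p (l k) / poly (cofactor g l k) (l k)) (cofactor g l k)) (l j) = (if k = j then poly p (l j) else 0)"
        by auto
    qed
    then show ?thesis using j by simp
  qed
  then have "l ` {1..g} \<subseteq> {x. poly (p - q) x = 0}" by auto
  moreover have "card (l ` {1..g}) = g" using inj by (simp add: card_image)
  moreover have "degree (p - q) < g"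
  proof (rule degree_diff_less[OF deg])
    have "degree q \<le> g - 1" unfolding q_def
      by (intro degree_sum_le order_trans[OF degree_smult_le]) (auto simp: degree_cofactor)
    then show "degree q < g" using deg by linarith
  qed
  moreover have "card {x. poly (p - q) x = 0} \<le> degree (p - q)" "finite {x. poly (p - q) x = 0}" if "p - q \<noteq> 0"
    using card_poly_roots_bound[OF that] poly_roots_finite[OF that] by auto
  ultimately have "p - q = 0" using card_mono[of "{x. poly (p - q) x = 0}" "l ` {1..g}"] by linarith
  then have "p = q" by simp
  then show ?thesis unfolding q_def .
qed

section \<open>The polynomials \<open>R\<^sub>n\<close> as functions of the roots\<close>

text \<open>Unlike \<open>c_fps\<close> without cutoff; only its coefficients up to \<open>g\<close>
  enter below, through triangular relations.\<close>

definition c_ser :: "nat \<Rightarrow> (nat \<Rightarrow> complex) \<Rightarrow> complex fps" where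
  "c_ser g t = Abs_fps (\<lambda>k. c_time g k t)"

lemma c_ser_inverse: "inverse (c_ser g t) * c_ser g t = 1"
  by (rule inverse_mult_eq_1) (simp add: c_ser_def c_time_def)

lemma c_ser_solve:
  assumes "\<And>n. n \<le> N \<Longrightarrow> fps_nth (c_ser g t * x) n = fps_nth y n" "n \<le> N"
  shows "fps_nth x n = fps_nth (inverse (c_ser g t) * y) n"
proof -
  have "fps_nth x n = fps_nth (inverse (c_ser g t) * (c_ser g t * x)) n"
    by (simp only: mult.assoc[symmetric] c_ser_inverse mult_1_left)
  also have "\<dots> = fps_nth (inverse (c_ser g t) * y) n"
    unfolding fps_mult_nth[of _ "c_ser g t * x"] fps_mult_nth[of _ y]
    using assms by (intro sum.cong refl) auto
  finally show ?thesis .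
qed

text \<open>Solves the defining triangular system by one division of series, which exhibits the R_n
  as linear in the coefficients of beta.\<close>

lemma R_of_roots_fps:
  assumes "n \<le> g"
  shows "R_of_roots g l t n = fps_nth (inverse (c_ser g t) * rev_fps g (beta_of_roots g l)) n"
proof -
  have lead: "coeff (beta_of_roots g l) g = 1"
  proof -
    have "degree (beta_of_roots g l) = g"
      unfolding beta_of_roots_def by (subst degree_prod_eq_sum_degree) auto
    moreover have "lead_coeff (beta_of_roots g l) = 1"
      unfolding beta_of_roots_def lead_coeff_prod by simp
    ultimately show ?thesis by simp
  qed
  have "fps_nth (c_ser g t * Abs_fps (R_of_roots g l t)) n = fps_nth (rev_fps g (beta_of_roots g l)) n" if "n \<le> g" for n
  proof (cases "n = 0")
    case True
    then show ?thesis by (simp add: c_ser_def c_time_def R_of_roots_0 rev_fps_nth lead)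
  next
    case False
    then show ?thesis using coeff_beta_of_roots[of n g l t] that
      by (simp add: rev_fps_nth fps_mult_nth c_ser_def atLeast0AtMost)
  qed
  from c_ser_solve[of g, OF this assms] show ?thesis by simp
qed

text \<open>For \<open>q\<close> of degree less than \<open>g\<close> this is the polynomial part of \<open>\<lambda>\<^sup>n\<^sup>-\<^sup>g * q / c_ser(1/\<lambda>)\<close>.\<close>

definition trunc :: "nat \<Rightarrow> (nat \<Rightarrow> complex) \<Rightarrow> nat \<Rightarrow> complex poly \<Rightarrow> complex poly" where
  "trunc g t n q = (if n = 0 then 0 else
     lambda_poly (n - 1) (fps_nth (inverse (c_ser g t) * rev_fps (g - 1) q)))"

lemma coeff_trunc: "coeff (trunc g t n q) i =
    (if i < n then fps_nth (inverse (c_ser g t) * rev_fps (g - 1) q) (n - 1 - i) else 0)"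
  by (auto simp: trunc_def coeff_lambda_poly)

lemma trunc_add: "trunc g t n (p + q) = trunc g t n p + trunc g t n q"
  by (simp add: poly_eq_iff coeff_trunc rev_fps_linear distrib_left)

lemma trunc_smult: "trunc g t n (smult c p) = smult c (trunc g t n p)"
  by (simp add: poly_eq_iff coeff_trunc rev_fps_linear mult.left_commute[of _ "fps_const c"])

lemma trunc_0: "trunc g t n 0 = 0"
  using trunc_smult[of g t n 0 0] by simp

lemma trunc_sum: "trunc g t n (sum f A) = (\<Sum>i\<in>A. trunc g t n (f i))"
  by (induction A rule: infinite_finite_induct) (simp_all add: trunc_add trunc_0)

text \<open>The coefficient of 1/lambda in the quotient truncated by \<open>trunc\<close>.
  Multiplication by lambda turns this first discarded term into the constant part of R_n.\<close>

definition trunc_const :: "nat \<Rightarrow> (nat \<Rightarrow> complex) \<Rightarrow> nat \<Rightarrow> complex poly \<Rightarrow> complex" where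
  "trunc_const g t n q = fps_nth (inverse (c_ser g t) * rev_fps (g - 1) q) n"

text \<open>The cofactor does not involve the \<open>j\<close>-th root, so this shows how \<open>R\<^sub>n\<close> depends on that root.\<close>

lemma R_poly_of_roots_factor:
  assumes n: "n \<le> g" and j: "j \<in> {1..g}"
  shows "R_poly_of_roots g n l t =
    [:- l j, 1:] * trunc g t n (cofactor g l j) + [:trunc_const g t n (cofactor g l j):]"
proof -
  define e where "e = inverse (c_ser g t) * rev_fps (g - 1) (cofactor g l j)"
  have "rev_fps (1 + (g - 1)) (beta_of_roots g l) = rev_fps 1 [:- l j, 1:] * rev_fps (g - 1) (cofactor g l j)"
    unfolding beta_of_roots_factor[OF j] by (rule rev_fps_mult) (use j in \<open>auto simp: degree_cofactor\<close>)
  also have "1 + (g - 1) = g" using j by simp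
  also have "rev_fps 1 [:- l j, 1:] = 1 - fps_const (l j) * fps_X"
    by (auto simp: fps_eq_iff rev_fps_nth fps_X_def coeff_pCons split: nat.splits)
  finally have R: "R_of_roots g l t k = fps_nth ((1 - fps_const (l j) * fps_X) * e) k" if "k \<le> n" for k
    using R_of_roots_fps[of k g l t] that n by (simp add: e_def mult.left_commute)
  have R': "R_of_roots g l t k = fps_nth e k - (if k = 0 then 0 else l j * fps_nth e (k - 1))" if "k \<le> n" for k
    using R[OF that] by (simp add: left_diff_distrib mult.assoc)
  show ?thesis
  proof (rule poly_eqI)
    fix i
    have c: "coeff ([:- l j, 1:] * p + [:a:]) i = (if i = 0 then a else coeff p (i - 1)) - l j * coeff p i" for p and a :: complex
      by (cases i) (simp_all add: algebra_simps)
    show "coeff (R_poly_of_roots g n l t) i =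
       coeff ([:- l j, 1:] * trunc g t n (cofactor g l j) + [:trunc_const g t n (cofactor g l j):]) i"
      unfolding c R_poly_of_roots_def coeff_lambda_poly coeff_trunc trunc_const_def e_def[symmetric]
      by (auto simp: R' Suc_diff_Suc)
  qed
qed

lemma poly_pderiv_R_poly_of_roots:
  assumes "n \<le> g" "j \<in> {1..g}"
  shows "poly (pderiv (R_poly_of_roots g n l t)) x =
    poly (trunc g t n (cofactor g l j)) x + (x - l j) * poly (pderiv (trunc g t n (cofactor g l j))) x"
  unfolding R_poly_of_roots_factor[OF assms] pderiv_add pderiv_linear_factor
  by (simp add: pderiv_pCons algebra_simps)

lemma poly_R_poly_of_roots:
  assumes "n \<le> g" "j \<in> {1..g}"
  shows "poly (R_poly_of_roots g n l t) x =
    (x - l j) * poly (trunc g t n (cofactor g l j)) x + trunc_const g t n (cofactor g l j)"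
  unfolding R_poly_of_roots_factor[OF assms] by (simp add: algebra_simps)

section \<open>Partial derivatives of the Hamiltonians\<close>

text \<open>\<open>e\<close>, \<open>E\<close> and \<open>\<phi>\<close> do not involve the j-th
  root, so all dependence on \<open>z\<close> is visible. At another root \<open>l k\<close> the
  cofactor vanishes, and the derivative of beta there is (l_k - z) e'(l_k).\<close>

lemma Ham_upd:
  fixes l m t :: "nat \<Rightarrow> complex"
  assumes n: "n \<le> g" and j: "j \<in> {1..g}" and z: "\<And>k. k \<in> {1..g} - {j} \<Longrightarrow> z \<noteq> l k"
  defines "e \<equiv> cofactor g l j" and "E \<equiv> trunc g t n (cofactor g l j)" and "\<phi> \<equiv> trunc_const g t n (cofactor g l j)"
  shows "Ham g n t (l(j := z)) m =
    ((m j)\<^sup>2 - poly (I0 g t) z) / poly e z * \<phi> - m j * poly E z / poly e z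
    + (\<Sum>k\<in>{1..g} - {j}. (((m k)\<^sup>2 - poly (I0 g t) (l k)) * (poly E (l k) + \<phi> / (l k - z))
        - m k * (poly E (l k) / (l k - z) + poly (pderiv E) (l k))) / poly (pderiv e) (l k))"
proof -
  let ?l = "l(j := z)"
  have beta: "poly (pderiv (beta_of_roots g ?l)) x = poly e x + (x - z) * poly (pderiv e) x" for x
    using pderiv_beta_of_roots[OF j, of ?l x] by (simp add: e_def cofactor_upd)
  have R: "poly (R_poly_of_roots g n ?l t) x = (x - z) * poly E x + \<phi>" for x
    using poly_R_poly_of_roots[OF n j, of ?l t x] by (simp add: E_def \<phi>_def cofactor_upd)
  have R': "poly (pderiv (R_poly_of_roots g n ?l t)) x = poly E x + (x - z) * poly (pderiv E) x" for x
    using poly_pderiv_R_poly_of_roots[OF n j, of ?l t x] by (simp add: E_def cofactor_upd)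
  have e0: "poly e (l k) = 0" if "k \<in> {1..g} - {j}" for k
    using that by (auto simp: e_def poly_cofactor_eq_0_iff)
  have "Ham g n t ?l m = (\<Sum>k=1..g. ((m k)\<^sup>2 - poly (I0 g t) (?l k)) / poly (pderiv (beta_of_roots g ?l)) (?l k)
        * poly (R_poly_of_roots g n ?l t) (?l k)
     - m k * poly (pderiv (R_poly_of_roots g n ?l t)) (?l k) / poly (pderiv (beta_of_roots g ?l)) (?l k))"
    by (simp add: Ham_def sum_subtractf)
  also have "\<dots> = ((m j)\<^sup>2 - poly (I0 g t) z) / poly e z * \<phi> - m j * poly E z / poly e z
     + (\<Sum>k\<in>{1..g} - {j}. ((m k)\<^sup>2 - poly (I0 g t) (?l k)) / poly (pderiv (beta_of_roots g ?l)) (?l k)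
        * poly (R_poly_of_roots g n ?l t) (?l k)
     - m k * poly (pderiv (R_poly_of_roots g n ?l t)) (?l k) / poly (pderiv (beta_of_roots g ?l)) (?l k))"
    by (subst sum.remove[OF _ j]) (simp_all add: beta R R')
  also have "(\<Sum>k\<in>{1..g} - {j}. ((m k)\<^sup>2 - poly (I0 g t) (?l k)) / poly (pderiv (beta_of_roots g ?l)) (?l k)
        * poly (R_poly_of_roots g n ?l t) (?l k)
     - m k * poly (pderiv (R_poly_of_roots g n ?l t)) (?l k) / poly (pderiv (beta_of_roots g ?l)) (?l k))
    = (\<Sum>k\<in>{1..g} - {j}. (((m k)\<^sup>2 - poly (I0 g t) (l k)) * (poly E (l k) + \<phi> / (l k - z))
        - m k * (poly E (l k) / (l k - z) + poly (pderiv E) (l k))) / poly (pderiv e) (l k))"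
  proof (intro sum.cong refl)
    fix k assume k: "k \<in> {1..g} - {j}"
    then have "l k - z \<noteq> 0" using z[OF k] by auto
    moreover have "V / (d * p) * (d * x + y) - M * (x + d * w) / (d * p) = (V * (x + y / d) - M * (x / d + w)) / p"
      if "d \<noteq> 0" for V d p x y M w :: complex
      using that by (cases "p = 0") (simp_all add: field_simps)
    ultimately show "((m k)\<^sup>2 - poly (I0 g t) (?l k)) / poly (pderiv (beta_of_roots g ?l)) (?l k)
        * poly (R_poly_of_roots g n ?l t) (?l k)
     - m k * poly (pderiv (R_poly_of_roots g n ?l t)) (?l k) / poly (pderiv (beta_of_roots g ?l)) (?l k)
     = (((m k)\<^sup>2 - poly (I0 g t) (l k)) * (poly E (l k) + \<phi> / (l k - z))
        - m k * (poly E (l k) / (l k - z) + poly (pderiv E) (l k))) / poly (pderiv e) (l k)"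
      using k by (simp add: beta R R' e0)
  qed
  finally show ?thesis .
qed

lemma Ham_deriv_l:
  fixes l m t :: "nat \<Rightarrow> complex"
  assumes n: "n \<le> g" and j: "j \<in> {1..g}" and inj: "inj_on l {1..g}"
  defines "e \<equiv> cofactor g l j" and "E \<equiv> trunc g t n (cofactor g l j)" and "\<phi> \<equiv> trunc_const g t n (cofactor g l j)"
  shows "((\<lambda>z. Ham g n t (l(j := z)) m) has_field_derivative
     (- poly (pderiv (I0 g t)) (l j) * \<phi> / poly e (l j)
      - ((m j)\<^sup>2 - poly (I0 g t) (l j)) * \<phi> * poly (pderiv e) (l j) / (poly e (l j))\<^sup>2
      - m j * (poly (pderiv E) (l j) / poly e (l j) - poly E (l j) * poly (pderiv e) (l j) / (poly e (l j))\<^sup>2)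
      + (\<Sum>k\<in>{1..g} - {j}. (((m k)\<^sup>2 - poly (I0 g t) (l k)) * \<phi> - m k * poly E (l k)) / (l k - l j)\<^sup>2 / poly (pderiv e) (l k))))
     (at (l j))"
proof -
  have e: "poly e (l j) \<noteq> 0"
    unfolding e_def by (rule poly_cofactor_root_neq_0[OF inj j])
  define F where "F z = ((m j)\<^sup>2 - poly (I0 g t) z) / poly e z * \<phi> - m j * poly E z / poly e z
    + (\<Sum>k\<in>{1..g} - {j}. (((m k)\<^sup>2 - poly (I0 g t) (l k)) * (poly E (l k) + \<phi> / (l k - z))
        - m k * (poly E (l k) / (l k - z) + poly (pderiv E) (l k))) / poly (pderiv e) (l k))" for z
  \<comment> \<open>The explicit formula is valid away from the other roots, hence near
    \<open>l j\<close>; that suffices for the derivative.\<close>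
  have op: "open (- (l ` ({1..g} - {j})))" by (intro open_Compl finite_imp_closed) simp
  have mem: "l j \<in> - (l ` ({1..g} - {j}))" using inj_onD[OF inj _ j] by auto
  have eq: "F z = Ham g n t (l(j := z)) m" if "z \<in> - (l ` ({1..g} - {j}))" for z
    unfolding F_def e_def E_def \<phi>_def by (rule Ham_upd[OF n j, symmetric]) (use that in auto)
  have der: "(F has_field_derivative
     (- poly (pderiv (I0 g t)) (l j) * \<phi> / poly e (l j)
      - ((m j)\<^sup>2 - poly (I0 g t) (l j)) * \<phi> * poly (pderiv e) (l j) / (poly e (l j))\<^sup>2
      - m j * (poly (pderiv E) (l j) / poly e (l j) - poly E (l j) * poly (pderiv e) (l j) / (poly e (l j))\<^sup>2)
      + (\<Sum>k\<in>{1..g} - {j}. (((m k)\<^sup>2 - poly (I0 g t) (l k)) * \<phi> - m k * poly E (l k)) / (l k - l j)\<^sup>2 / poly (pderiv e) (l k))))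
     (at (l j))"
    unfolding F_def
  proof (intro DERIV_add DERIV_sum)
    show "((\<lambda>z. ((m j)\<^sup>2 - poly (I0 g t) z) / poly e z * \<phi> - m j * poly E z / poly e z) has_field_derivative
      (- poly (pderiv (I0 g t)) (l j) * \<phi> / poly e (l j)
      - ((m j)\<^sup>2 - poly (I0 g t) (l j)) * \<phi> * poly (pderiv e) (l j) / (poly e (l j))\<^sup>2
      - m j * (poly (pderiv E) (l j) / poly e (l j) - poly E (l j) * poly (pderiv e) (l j) / (poly e (l j))\<^sup>2))) (at (l j))"
      using e by (auto intro!: derivative_eq_intros simp: field_simps power2_eq_square)
  next
    fix k assume k: "k \<in> {1..g} - {j}"
    then have "l k - l j \<noteq> 0" using inj_onD[OF inj, of k j] j by auto
    then have inv: "((\<lambda>z. a / (l k - z)) has_field_derivative a / (l k - l j)\<^sup>2) (at (l j))" for a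
      by (auto intro!: derivative_eq_intros simp: field_simps power2_eq_square)
    have "((\<lambda>z. (V * (x + \<phi> / (l k - z)) - M * (x / (l k - z) + w)) / p) has_field_derivative
       (V * (0 + \<phi> / (l k - l j)\<^sup>2) - M * (x / (l k - l j)\<^sup>2 + 0)) / p) (at (l j))" for V x M w p
      by (intro DERIV_cdivide DERIV_diff DERIV_cmult DERIV_add DERIV_const inv)
    then show "((\<lambda>z. (((m k)\<^sup>2 - poly (I0 g t) (l k)) * (poly E (l k) + \<phi> / (l k - z))
        - m k * (poly E (l k) / (l k - z) + poly (pderiv E) (l k))) / poly (pderiv e) (l k)) has_field_derivative
       (((m k)\<^sup>2 - poly (I0 g t) (l k)) * \<phi> - m k * poly E (l k)) / (l k - l j)\<^sup>2 / poly (pderiv e) (l k)) (at (l j))"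
      by (simp add: diff_divide_distrib)
  qed
  show ?thesis by (rule has_field_derivative_transform_within_open[OF der op mem eq])
qed

text \<open>The derivative computed above contains only values at the roots. Since
  \<open>\<alpha>\<close> and \<open>h - I0 g t\<close> have degree below \<open>g\<close>,
  interpolation expresses the derivatives of \<open>\<alpha>\<close>, \<open>h\<close> and the
  truncation of \<open>\<alpha>\<close> by the same values.\<close>

lemma Ham_partial_l:
  assumes n: "n \<le> g" and j: "j \<in> {1..g}" and inj: "inj_on l {1..g}"
    and \<alpha>: "degree \<alpha> < g" "\<And>k. k \<in> {1..g} \<Longrightarrow> poly \<alpha> (l k) = m k"
    and h: "degree (h - I0 g t) < g" "\<And>k. k \<in> {1..g} \<Longrightarrow> poly h (l k) = (m k)\<^sup>2"
  shows "((\<lambda>z. Ham g n t (l(j := z)) m) has_field_derivative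
    - (poly (pderiv h) (l j) * poly (R_poly_of_roots g n l t) (l j) / poly (pderiv (beta_of_roots g l)) (l j)
       - poly (pderiv \<alpha>) (l j) * poly (pderiv (R_poly_of_roots g n l t)) (l j) / poly (pderiv (beta_of_roots g l)) (l j)
       + poly (pderiv (trunc g t n \<alpha>)) (l j))) (at (l j))"
proof -
  define e where "e k = cofactor g l k" for k
  define E where "E k = trunc g t n (e k)" for k
  define \<phi> where "\<phi> = trunc_const g t n (e j)"
  define b where "b k = poly (pderiv (beta_of_roots g l)) (l k)" for k
  define V where "V k = (m k)\<^sup>2 - poly (I0 g t) (l k)" for k
  define I' where "I' = {1..g} - {j}"
  have bk: "poly (e k) (l k) = b k" if "k \<in> {1..g}" for k
    unfolding b_def e_def using pderiv_beta_of_roots[OF that, of l "l k"] by simp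
  have b0: "b k \<noteq> 0" if "k \<in> {1..g}" for k
    unfolding bk[OF that, symmetric] e_def by (rule poly_cofactor_root_neq_0[OF inj that])
  have d0: "l k - l j \<noteq> 0" if "k \<in> I'" for k
    using inj_onD[OF inj, of k j] j that by (auto simp: I'_def)
  have ekj: "poly (e i) (l k) = 0" if "i \<noteq> k" "i \<in> {1..g}" "k \<in> {1..g}" for i k
    using that unfolding e_def poly_cofactor_eq_0_iff by auto
  have e'j: "poly (pderiv (e j)) (l k) = b k / (l k - l j)" if "k \<in> I'" for k
    using pderiv_beta_of_roots[OF j, of l "l k"] ekj[of j k] that d0[OF that] j
    by (simp add: b_def[symmetric] e_def[symmetric] I'_def)
  have e'k: "poly (pderiv (e k)) (l j) = - b j / (l k - l j)" if "k \<in> I'" for k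
  proof -
    have "k \<in> {1..g}" "k \<noteq> j" using that by (auto simp: I'_def)
    then have "b j = (l j - l k) * poly (pderiv (e k)) (l j)"
      using pderiv_beta_of_roots[of k g l "l j"] ekj[of k j] j by (simp add: b_def[symmetric] e_def[symmetric])
    then show ?thesis using d0[OF that] by (simp add: field_simps)
  qed
  have interp_poly: "p = (\<Sum>k=1..g. smult (poly p (l k) / b k) (e k))" if "degree p < g" for p
  proof -
    have "(\<Sum>k=1..g. smult (poly p (l k) / b k) (e k)) =
        (\<Sum>k=1..g. smult (poly p (l k) / poly (cofactor g l k) (l k)) (cofactor g l k))"
      by (intro sum.cong refl) (simp only: bk[symmetric] e_def)
    then show ?thesis using lagrange_interpolation[OF inj that] by (simp only:)
  qed
  have interp: "poly (pderiv p) (l j) = poly p (l j) * poly (pderiv (e j)) (l j) / b j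
     - b j * (\<Sum>k\<in>I'. poly p (l k) / b k / (l k - l j))" if "degree p < g" for p
  proof -
    from interp_poly[OF that] have "poly (pderiv p) (l j) = poly (pderiv (\<Sum>k=1..g. smult (poly p (l k) / b k) (e k))) (l j)"
      by (rule arg_cong)
    also have "\<dots> = (\<Sum>k=1..g. poly p (l k) / b k * poly (pderiv (e k)) (l j))"
      by (simp add: pderiv_sum pderiv_smult poly_sum)
    also have "\<dots> = poly p (l j) / b j * poly (pderiv (e j)) (l j) + (\<Sum>k\<in>I'. poly p (l k) / b k * poly (pderiv (e k)) (l j))"
      unfolding I'_def by (rule sum.remove) (use j in auto)
    also have "(\<Sum>k\<in>I'. poly p (l k) / b k * poly (pderiv (e k)) (l j)) = - b j * (\<Sum>k\<in>I'. poly p (l k) / b k / (l k - l j))"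
      unfolding sum_distrib_left by (intro sum.cong refl) (simp add: e'k)
    finally show ?thesis by simp
  qed
  have R: "poly (R_poly_of_roots g n l t) (l j) = \<phi>"
    using poly_R_poly_of_roots[OF n j, of l t "l j"] by (simp add: \<phi>_def e_def)
  have R': "poly (pderiv (R_poly_of_roots g n l t)) (l j) = poly (E j) (l j)"
    using poly_pderiv_R_poly_of_roots[OF n j, of l t "l j"] by (simp add: E_def e_def)
  \<comment> \<open>R_n has one factorization for each of the roots \<open>l j\<close> and
    \<open>l k\<close>. Comparing them at both roots gives E_k(l_j) = E_j(l_k), and comparing the
    derivatives at \<open>l j\<close> gives the claim.\<close>
  have E'k: "poly (pderiv (E k)) (l j) = (poly (E j) (l k) - poly (E j) (l j)) / (l k - l j)" if k: "k \<in> I'" for k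
  proof -
    have k': "k \<in> {1..g}" using k by (simp add: I'_def)
    have "poly (R_poly_of_roots g n l t) (l k) = trunc_const g t n (e k)"
      using poly_R_poly_of_roots[OF n k', of l t "l k"] by (simp add: e_def)
    then have "(l k - l j) * poly (E j) (l k) + \<phi> = trunc_const g t n (e k)"
      using poly_R_poly_of_roots[OF n j, of l t "l k"] by (simp add: \<phi>_def e_def E_def)
    moreover have "\<phi> = (l j - l k) * poly (E k) (l j) + trunc_const g t n (e k)"
      using poly_R_poly_of_roots[OF n k', of l t "l j"] R by (simp add: e_def E_def)
    ultimately have "(l k - l j) * poly (E j) (l k) + \<phi> = \<phi> - (l j - l k) * poly (E k) (l j)"
      by simp
    then have "(l k - l j) * (poly (E j) (l k) - poly (E k) (l j)) = 0" by (simp add: algebra_simps)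
    then have "poly (E k) (l j) = poly (E j) (l k)" using d0[OF k] by simp
    then have "poly (E j) (l j) = poly (E j) (l k) + (l j - l k) * poly (pderiv (E k)) (l j)"
      using poly_pderiv_R_poly_of_roots[OF n k', of l t "l j"] R' by (simp add: E_def e_def)
    then show ?thesis using d0[OF k] by (simp add: field_simps)
  qed
  have A': "poly (pderiv (trunc g t n \<alpha>)) (l j) = m j / b j * poly (pderiv (E j)) (l j)
      + (\<Sum>k\<in>I'. m k / b k * ((poly (E j) (l k) - poly (E j) (l j)) / (l k - l j)))"
  proof -
    have "\<alpha> = (\<Sum>k=1..g. smult (poly \<alpha> (l k) / b k) (e k))"
      by (rule interp_poly[OF \<alpha>(1)])
    also have "\<dots> = (\<Sum>k=1..g. smult (m k / b k) (e k))"
      by (intro sum.cong refl) (simp only: \<alpha>(2))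
    finally have "\<alpha> = (\<Sum>k=1..g. smult (m k / b k) (e k))" .
    \<comment> \<open>Truncation is linear, so it can be applied to the interpolation formula term
      by term.\<close>
    then have "poly (pderiv (trunc g t n \<alpha>)) (l j) = poly (pderiv (trunc g t n (\<Sum>k=1..g. smult (m k / b k) (e k)))) (l j)"
      by (rule arg_cong)
    also have "\<dots> = (\<Sum>k=1..g. m k / b k * poly (pderiv (E k)) (l j))"
      by (simp add: trunc_sum trunc_smult pderiv_sum pderiv_smult poly_sum E_def)
    also have "\<dots> = m j / b j * poly (pderiv (E j)) (l j) + (\<Sum>k\<in>I'. m k / b k * poly (pderiv (E k)) (l j))"
      unfolding I'_def by (rule sum.remove) (use j in auto)
    finally show ?thesis by (simp add: E'k)
  qed
  have \<alpha>': "poly (pderiv \<alpha>) (l j) = m j * poly (pderiv (e j)) (l j) / b j - b j * (\<Sum>k\<in>I'. m k / b k / (l k - l j))"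
    unfolding interp[OF \<alpha>(1)] using j by (simp add: \<alpha>(2) I'_def)
  have h': "poly (pderiv h) (l j) = poly (pderiv (I0 g t)) (l j) + V j * poly (pderiv (e j)) (l j) / b j
     - b j * (\<Sum>k\<in>I'. V k / b k / (l k - l j))"
  proof -
    have "poly (pderiv h) (l j) - poly (pderiv (I0 g t)) (l j) = V j * poly (pderiv (e j)) (l j) / b j
       - b j * (\<Sum>k\<in>I'. V k / b k / (l k - l j))"
      using interp[OF h(1)] j by (simp add: pderiv_diff h(2) I'_def V_def)
    then show ?thesis by (simp only: diff_eq_eq) (simp add: algebra_simps)
  qed
  \<comment> \<open>\<open>S2\<close> enters through the derivatives of \<open>\<alpha>\<close> and
    of its truncation and cancels between them; \<open>S1\<close> from \<open>h\<close> and
    \<open>S3\<close> from the truncation match the sum over the other roots in the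
    Hamiltonian.\<close>
  define S1 S2 S3 where "S1 = (\<Sum>k\<in>I'. V k / b k / (l k - l j))" and "S2 = (\<Sum>k\<in>I'. m k / b k / (l k - l j))"
    and "S3 = (\<Sum>k\<in>I'. m k / b k * poly (E j) (l k) / (l k - l j))"
  have s1: "(\<Sum>k\<in>I'. (V k * \<phi> - m k * poly (E j) (l k)) / (l k - l j)\<^sup>2 / poly (pderiv (e j)) (l k)) = \<phi> * S1 - S3"
    unfolding S1_def S3_def sum_distrib_left sum_subtractf[symmetric]
  proof (intro sum.cong refl)
    fix k assume k: "k \<in> I'"
    then have "b k \<noteq> 0" using b0 by (simp add: I'_def)
    then show "(V k * \<phi> - m k * poly (E j) (l k)) / (l k - l j)\<^sup>2 / poly (pderiv (e j)) (l k) =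
       \<phi> * (V k / b k / (l k - l j)) - m k / b k * poly (E j) (l k) / (l k - l j)"
      using d0[OF k] unfolding e'j[OF k] by (simp add: divide_simps power2_eq_square)
  qed
  have s2: "(\<Sum>k\<in>I'. m k / b k * ((poly (E j) (l k) - poly (E j) (l j)) / (l k - l j))) = S3 - poly (E j) (l j) * S2"
    unfolding S2_def S3_def sum_distrib_left sum_subtractf[symmetric]
    by (intro sum.cong refl) (simp add: diff_divide_distrib algebra_simps)
  have "((\<lambda>z. Ham g n t (l(j := z)) m) has_field_derivative
     (- poly (pderiv (I0 g t)) (l j) * \<phi> / b j - V j * \<phi> * poly (pderiv (e j)) (l j) / (b j)\<^sup>2
      - m j * (poly (pderiv (E j)) (l j) / b j - poly (E j) (l j) * poly (pderiv (e j)) (l j) / (b j)\<^sup>2)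
      + (\<phi> * S1 - S3))) (at (l j))"
    using Ham_deriv_l[OF n j inj, of t m] unfolding e_def[symmetric] E_def[symmetric] \<phi>_def[symmetric] bk[OF j] V_def[symmetric]
      I'_def[symmetric] s1 .
  also have "- poly (pderiv (I0 g t)) (l j) * \<phi> / b j - V j * \<phi> * poly (pderiv (e j)) (l j) / (b j)\<^sup>2
      - m j * (poly (pderiv (E j)) (l j) / b j - poly (E j) (l j) * poly (pderiv (e j)) (l j) / (b j)\<^sup>2)
      + (\<phi> * S1 - S3) = - (poly (pderiv h) (l j) * \<phi> / b j - poly (pderiv \<alpha>) (l j) * poly (E j) (l j) / b j
       + poly (pderiv (trunc g t n \<alpha>)) (l j))"
    unfolding h' \<alpha>' A' s2 S1_def[symmetric] S2_def[symmetric]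
    using b0[OF j] by (simp add: field_simps power2_eq_square)
  finally show ?thesis by (simp only: R R' b_def)
qed

lemma Ham_partial_m:
  assumes "j \<in> {1..g}"
  shows "((\<lambda>z. Ham g n t l (m(j := z))) has_field_derivative
    2 * m j * poly (R_poly_of_roots g n l t) (l j) / poly (pderiv (beta_of_roots g l)) (l j)
    - poly (pderiv (R_poly_of_roots g n l t)) (l j) / poly (pderiv (beta_of_roots g l)) (l j)) (at (m j))"
proof -
  define b where "b k = poly (pderiv (beta_of_roots g l)) (l k)" for k
  define R where "R k = poly (R_poly_of_roots g n l t) (l k)" for k
  define R' where "R' k = poly (pderiv (R_poly_of_roots g n l t)) (l k)" for k
  define f where "f k z = (z\<^sup>2 - poly (I0 g t) (l k)) / b k * R k - z * R' k / b k" for k z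
  have Ham: "Ham g n t l m = (\<Sum>k=1..g. f k (m k))" for m
    by (simp add: Ham_def f_def sum_subtractf b_def R_def R'_def)
  have "Ham g n t l (m(j := z)) = f j z + (\<Sum>k\<in>{1..g} - {j}. f k (m k))" for z
    unfolding Ham by (subst sum.remove[OF _ assms]) auto
  moreover have "((\<lambda>z. (z\<^sup>2 - c) / d * r - z * r' / d + e) has_field_derivative 2 * x * r / d - r' / d) (at x)"
    for c d r r' e x :: complex
    by (auto intro!: derivative_eq_intros simp: divide_inverse)
  ultimately show ?thesis unfolding f_def b_def R_def R'_def by simp
qed

section \<open>Derivatives of roots\<close>

lemma poly_sum_bound:
  fixes p :: "complex poly"
  assumes "degree p \<le> N" shows "poly p x = (\<Sum>i\<le>N. coeff p i * x ^ i)"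
  unfolding poly_altdef using assms
  by (intro sum.mono_neutral_left) (auto simp: coeff_eq_0)

context time_field
begin

text \<open>The common degree bound turns evaluation into a sum of fixed length, so the chain rule
  follows from sums, products and powers.\<close>

lemma has_partial_poly_eval:
  assumes t: "t k \<in> K" and P: "has_poly_partial K k P Q t" and l: "has_partial K k l d t"
    and deg: "\<And>t. degree (P t) \<le> N" "degree Q \<le> N"
  shows "has_partial K k (\<lambda>t. poly (P t) (l t)) (poly Q (l t) + poly (pderiv (P t)) (l t) * d) t"
proof -
  have pd: "poly (pderiv p) x = (\<Sum>i\<le>N. coeff p i * (of_nat i * x ^ (i - 1)))" if "degree p \<le> N" for p and x :: complex
  proof -
    have "((\<lambda>x. poly p x) has_field_derivative (\<Sum>i\<le>N. coeff p i * (of_nat i * x ^ (i - 1)))) (at x)"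
      unfolding poly_sum_bound[OF that] by (auto intro!: derivative_eq_intros sum.cong)
    with poly_DERIV show ?thesis by (rule DERIV_unique)
  qed
  have pow: "has_partial K k (\<lambda>t. l t ^ i) (of_nat i * l t ^ (i - 1) * d) t" for i
    using l unfolding has_partial_def by (auto intro!: derivative_eq_intros)
  have "has_partial K k (\<lambda>t. \<Sum>i\<le>N. coeff (P t) i * l t ^ i)
     (\<Sum>i\<le>N. coeff Q i * l t ^ i + coeff (P t) i * (of_nat i * l t ^ (i - 1) * d)) t"
    using P by (intro has_partial_sum has_partial_mult pow) (simp add: has_poly_partial_def)
  then show ?thesis
    unfolding poly_sum_bound[OF deg(1)] poly_sum_bound[OF deg(2)] pd[OF deg(1)]
    by (simp add: sum.distrib sum_distrib_right mult.assoc)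
qed

text \<open>Implicit differentiation from continuity of the root alone. With P_t = (lambda - l) q,
  the vanishing of P_s at L_s gives (L_s - l) q(L_s) = -(P_s - P_t)(L_s). Divide by the time
  increment; q(L_s) tends to q(l), the nonzero derivative of P_t at l.\<close>

lemma has_partial_root:
  assumes D: "open_times K g D" "t \<in> D" "k \<in> time_indices g"
    and l: "continuous_on D l" and root: "\<And>t. t \<in> D \<Longrightarrow> poly (P t) (l t) = 0"
    and P: "has_poly_partial K k P Q t" and deg: "\<And>t. degree (P t) \<le> N" "degree Q \<le> N"
    and simple: "poly (pderiv (P t)) (l t) \<noteq> 0"
  shows "has_partial K k l (- poly Q (l t) / poly (pderiv (P t)) (l t)) t"
proof -
  define F where "F = at (t k) within K"
  define L where "L s = l (t(k := s))" for s
  define PP where "PP s = P (t(k := s))" for s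
  have L0: "L (t k) = l t" and P0: "PP (t k) = P t" by (simp_all add: L_def PP_def)
  obtain q where q: "P t = [:- l t, 1:] * q" using root[OF D(2)] unfolding poly_eq_0_iff_dvd by (rule dvdE)
  have q0: "poly q (l t) = poly (pderiv (P t)) (l t)" unfolding q pderiv_linear_factor by simp
  have ev_D: "\<forall>\<^sub>F s in F. t(k := s) \<in> D" unfolding F_def by (rule eventually_open_times[OF D])
  have L_lim: "(L \<longlongrightarrow> l t) F"
  proof -
    have "((\<lambda>s. t(k := s)) \<longlongrightarrow> t(k := t k)) (at (t k) within UNIV)"
      using continuous_fun_upd[of t k] unfolding continuous_on_def by blast
    then have lim: "((\<lambda>s. t(k := s)) \<longlongrightarrow> t) F"
      unfolding F_def fun_upd_triv by (rule tendsto_within_subset) simp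
    have cont: "continuous (at t within D) l" using l D(2) by (simp add: continuous_on_eq_continuous_within)
    show ?thesis
      unfolding L_def by (rule continuous_within_tendsto_compose[OF cont ev_D lim])
  qed
  have qL: "((\<lambda>s. poly q (L s)) \<longlongrightarrow> poly q (l t)) F" using L_lim by (rule tendsto_poly)
  then have ev_q: "\<forall>\<^sub>F s in F. poly q (L s) \<noteq> 0"
    by (rule tendsto_imp_eventually_ne) (simp add: q0 simple)
  have lim: "((\<lambda>s. - (\<Sum>i\<le>N. (coeff (PP s) i - coeff (PP (t k)) i) / (s - t k) * L s ^ i) / poly q (L s))
       \<longlongrightarrow> - (\<Sum>i\<le>N. coeff Q i * l t ^ i) / poly q (l t)) F"
  proof (intro tendsto_intros qL L_lim)
    fix i
    show "((\<lambda>s. (coeff (PP s) i - coeff (PP (t k)) i) / (s - t k)) \<longlongrightarrow> coeff Q i) F"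
      using P unfolding has_poly_partial_def has_partial_def has_field_derivative_iff F_def PP_def by blast
  qed (simp add: q0 simple)
  have "\<forall>\<^sub>F s in F. s \<noteq> t k" by (simp add: F_def eventually_at_filter)
  with ev_D ev_q have "\<forall>\<^sub>F s in F. - (\<Sum>i\<le>N. (coeff (PP s) i - coeff (PP (t k)) i) / (s - t k) * L s ^ i) / poly q (L s)
      = (L s - L (t k)) / (s - t k)"
  proof eventually_elim
    case (elim s)
    have "0 = poly (PP s) (L s)" unfolding PP_def L_def by (simp add: root elim)
    also have "\<dots> = (\<Sum>i\<le>N. (coeff (PP s) i - coeff (P t) i) * L s ^ i) + poly (P t) (L s)"
      unfolding poly_sum_bound[OF deg(1), of "t(k := s)", folded PP_def] poly_sum_bound[OF deg(1)]
      by (simp add: algebra_simps sum_subtractf)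
    also have "poly (P t) (L s) = (L s - l t) * poly q (L s)" unfolding q by (simp add: algebra_simps)
    finally have "(L s - l t) * poly q (L s) = - (\<Sum>i\<le>N. (coeff (PP s) i - coeff (P t) i) * L s ^ i)"
      by (simp add: eq_neg_iff_add_eq_0 add.commute)
    moreover have "(\<Sum>i\<le>N. (coeff (PP s) i - coeff (P t) i) / (s - t k) * L s ^ i) =
       (\<Sum>i\<le>N. (coeff (PP s) i - coeff (P t) i) * L s ^ i) / (s - t k)"
      by (simp add: sum_divide_distrib)
    ultimately show ?case using elim unfolding L0 P0 by (simp add: field_simps)
  qed
  from Lim_transform_eventually[OF lim this]
  have "((\<lambda>s. (L s - L (t k)) / (s - t k)) \<longlongrightarrow> - poly Q (l t) / poly (pderiv (P t)) (l t)) F"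
    unfolding poly_sum_bound[OF deg(2)] q0 .
  then show ?thesis by (simp add: has_partial_def has_field_derivative_iff F_def L_def)
qed

end

section \<open>The Hamiltonians along a solution\<close>

context PI_flow
begin

lemma c_ser_mult_ev_fps:
  assumes "k \<le> g" shows "fps_nth (c_ser g t * ev_fps t p) k = coeff (CS p t) (g - k)"
  unfolding coeff_CS[OF assms] fps_mult_nth
  by (intro sum.cong refl) (use assms in \<open>auto simp: c_fps_nth c_ser_def\<close>)

text \<open>R from the roots and R from the solution solve the same triangular system up to order
  \<open>g\<close>.\<close>

lemma R_poly_of_roots_eq_B:
  assumes n: "n \<le> g" and beta: "beta_poly K u g t = beta_of_roots g l"
  shows "R_poly_of_roots g n l t = B_poly K u n t"
proof -
  have "R_of_roots g l t k = ev t (gd k)" if k: "k \<le> g" for k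
  proof -
    have "fps_nth (ev_fps t gd) k = fps_nth (inverse (c_ser g t) * rev_fps g (beta_of_roots g l)) k"
    proof (rule c_ser_solve[OF _ k])
      fix i assume "i \<le> g"
      then show "fps_nth (c_ser g t * ev_fps t gd) i = fps_nth (rev_fps g (beta_of_roots g l)) i"
        unfolding c_ser_mult_ev_fps[OF \<open>i \<le> g\<close>] beta_poly_CS[symmetric] beta by (simp add: rev_fps_nth)
    qed
    then show ?thesis unfolding R_of_roots_fps[OF k] by (simp add: ev_fps_def)
  qed
  then show ?thesis unfolding R_poly_of_roots_def B_poly_LP LP_def
    using n by (auto simp: poly_eq_iff coeff_lambda_poly)
qed

lemma gd1_0: "gd1 0 = 0"
  by (simp add: gd_0 dp_dx_simps)

text \<open>Dividing alpha by the series of the c_m recovers the x-derivatives of the R_k, and the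
  truncation keeps those belonging to A_n.\<close>

lemma trunc_alpha_eq_A:
  assumes n: "n \<le> g" and t: "t \<in> D"
  shows "trunc g t n (alpha_poly K u g t) = A_poly K u n t"
proof -
  \<comment> \<open>The index starts at 1 because the derivative of R_0 vanishes; correspondingly
    alpha is reversed in degree g - 1 rather than g.\<close>
  define x where "x = Abs_fps (\<lambda>k. - (1 / 2) * ev t (gd1 (Suc k)))"
  have x: "fps_nth (inverse (c_ser g t) * rev_fps (g - 1) (alpha_poly K u g t)) k = - (1 / 2) * ev t (gd1 (Suc k))"
    if k: "Suc k \<le> g" for k
  proof -
    have "fps_nth x k = fps_nth (inverse (c_ser g t) * rev_fps (g - 1) (alpha_poly K u g t)) k"
    proof (rule c_ser_solve[of "g - 1"])
      fix i assume "i \<le> g - 1"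
      then have i: "Suc i \<le> g" using k by simp
      have "fps_nth (c_ser g t * x) i = - (1 / 2) * fps_nth (c_ser g t * ev_fps t gd1) (Suc i)"
        unfolding fps_mult_nth sum_distrib_left
        by (simp add: x_def ev_fps_def gd1_0 ev_simps Suc_diff_le)
      also have "\<dots> = fps_nth (rev_fps (g - 1) (alpha_poly K u g t)) i"
        unfolding c_ser_mult_ev_fps[OF i] alpha_poly_CS[OF t] using i by (simp add: rev_fps_nth)
      finally show "fps_nth (c_ser g t * x) i = fps_nth (rev_fps (g - 1) (alpha_poly K u g t)) i" .
    qed (use k in simp)
    then show ?thesis by (simp add: x_def)
  qed
  show ?thesis
  proof (rule poly_eqI)
    fix i
    consider "i < n" | "i = n" | "i > n" by linarith
    then show "coeff (trunc g t n (alpha_poly K u g t)) i = coeff (A_poly K u n t) i"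
    proof cases
      case 1
      then have "Suc (n - 1 - i) = n - i" by simp
      then show ?thesis using 1 n x[of "n - 1 - i"]
        by (simp add: coeff_trunc A_poly_LP[OF t] LP_def coeff_lambda_poly)
    qed (simp_all add: coeff_trunc A_poly_LP[OF t] LP_def coeff_lambda_poly gd1_0 ev_simps)
  qed
qed

lemma degree_alpha:
  assumes g: "g \<ge> 1" and t: "t \<in> D"
  shows "degree (alpha_poly K u g t) < g"
proof -
  have "coeff (CS gd1 t) g = 0"
    using coeff_CS[of 0 gd1 t] by (simp add: ev_fps_def gd1_0 ev_simps)
  then have "coeff (alpha_poly K u g t) g = 0" by (simp add: alpha_poly_CS[OF t])
  moreover have "degree (alpha_poly K u g t) \<le> g"
    unfolding alpha_poly_CS[OF t] by (rule order_trans[OF degree_smult_le degree_CS])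
  ultimately show ?thesis using g
    by (metis One_nat_def Suc_le_lessD degree_0 le_neq_implies_less leading_coeff_0_iff)
qed

lemma degree_h_diff_I0:
  assumes g: "g \<ge> 1" and t: "t \<in> D"
  shows "degree (h_poly K u g t - I0 g t) < g"
proof -
  have "degree (h_poly K u g t - I0 g t) \<le> g - 1"
    by (rule degree_le) (auto simp: coeff_h_poly[OF t])
  then show ?thesis using g by linarith
qed

end

locale PI_roots = PI_flow K g D u for K g D u +
  fixes D' :: "(nat \<Rightarrow> complex) set" and lam mu :: "nat \<Rightarrow> (nat \<Rightarrow> complex) \<Rightarrow> complex"
  assumes g: "g \<ge> 1" and D'_D: "D' \<subseteq> D" and open_D': "open_times K g D'"
    and lam_cont: "\<And>j. j \<in> {1..g} \<Longrightarrow> continuous_on D' (lam j)"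
    and beta_prod: "\<And>t. t \<in> D' \<Longrightarrow> beta_poly K u g t = (\<Prod>j=1..g. [:- lam j t, 1:])"
    and lam_inj: "\<And>t. t \<in> D' \<Longrightarrow> inj_on (\<lambda>j. lam j t) {1..g}"
    and mu: "\<And>j t. j \<in> {1..g} \<Longrightarrow> t \<in> D' \<Longrightarrow> mu j t = poly (alpha_poly K u g t) (lam j t)"
begin

lemma beta_roots: "t \<in> D' \<Longrightarrow> beta_poly K u g t = beta_of_roots g (\<lambda>i. lam i t)"
  by (simp add: beta_prod beta_of_roots_def)

lemma beta_root: "t \<in> D' \<Longrightarrow> j \<in> {1..g} \<Longrightarrow> poly (beta_poly K u g t) (lam j t) = 0"
  by (auto simp: beta_prod poly_prod)

lemma beta_simple:
  assumes "t \<in> D'" "j \<in> {1..g}" shows "poly (pderiv (beta_poly K u g t)) (lam j t) \<noteq> 0"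
  unfolding beta_roots[OF assms(1)] pderiv_beta_of_roots[OF assms(2)]
  using poly_cofactor_root_neq_0[OF lam_inj[OF assms(1)] assms(2)] by simp

lemma lam_flow:
  assumes n: "n \<le> g" and j: "j \<in> {1..g}" and t: "t \<in> D'"
  shows "has_partial K (2 * n + 1) (lam j)
      (2 * mu j t * poly (B_poly K u n t) (lam j t) / poly (pderiv (beta_poly K u g t)) (lam j t)
       - poly (pderiv (B_poly K u n t)) (lam j t) / poly (pderiv (beta_poly K u g t)) (lam j t)) t"
proof -
  have tD: "t \<in> D" using t D'_D by auto
  let ?l = "lam j t"
  have "has_partial K (2 * n + 1) (lam j) (- poly (CS_flow n gd t) ?l / poly (pderiv (beta_poly K u g t)) ?l) t"
  proof (rule has_partial_root[OF open_D' t odd_index[OF n] lam_cont[OF j]])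
    show "poly (beta_poly K u g s) (lam j s) = 0" if "s \<in> D'" for s by (rule beta_root[OF that j])
    show "has_poly_partial K (2 * n + 1) (beta_poly K u g) (CS_flow n gd t) t"
      using has_poly_partial_CS_flow[OF n tD, of gd] by (simp add: beta_poly_CS[abs_def])
    \<comment> \<open>One bound must serve the polynomial at all times and its time derivative,
      hence the sum.\<close>
    show "degree (beta_poly K u g s) \<le> g + degree (CS_flow n gd t)" for s
      unfolding beta_poly_CS by (rule trans_le_add1[OF degree_CS])
  qed (use beta_simple[OF t j] in simp_all)
  \<comment> \<open>At a root of beta the terms with beta drop out, and \<open>CS gd1\<close> equals
    -2 alpha, whose value there is -2 mu_j.\<close>
  also have "poly (CS_flow n gd t) ?l = - 2 * mu j t * poly (B_poly K u n t) ?l + poly (pderiv (B_poly K u n t)) ?l"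
    unfolding beta_flow[OF n tD] using beta_root[OF t j] mu[OF j t]
    by (simp add: B_poly_LP beta_poly_CS alpha_poly_CS[OF tD])
  finally show ?thesis by (simp add: diff_divide_distrib)
qed

text \<open>Chain rule for alpha at the moving root: the time derivative at fixed lambda from
  \<open>alpha_flow\<close>, plus alpha' times the velocity of the root.\<close>

lemma mu_flow:
  assumes n: "n \<le> g" and j: "j \<in> {1..g}" and t: "t \<in> D'"
  shows "has_partial K (2 * n + 1) (mu j)
      (poly (pderiv (h_poly K u g t)) (lam j t) * poly (B_poly K u n t) (lam j t)
         / poly (pderiv (beta_poly K u g t)) (lam j t)
       - poly (pderiv (alpha_poly K u g t)) (lam j t) * poly (pderiv (B_poly K u n t)) (lam j t)
         / poly (pderiv (beta_poly K u g t)) (lam j t)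
       + poly (pderiv (A_poly K u n t)) (lam j t)) t"
proof -
  have tD: "t \<in> D" using t D'_D by auto
  let ?l = "lam j t" and ?P = "\<lambda>t. smult (- 1 / 2) (CS gd1 t)" and ?Q = "smult (- 1 / 2) (CS_flow n gd1 t)"
  let ?d = "2 * mu j t * poly (B_poly K u n t) ?l / poly (pderiv (beta_poly K u g t)) ?l
       - poly (pderiv (B_poly K u n t)) ?l / poly (pderiv (beta_poly K u g t)) ?l"
  have "has_partial K (2 * n + 1) (\<lambda>t. poly (?P t) (lam j t)) (poly ?Q ?l + poly (pderiv (?P t)) ?l * ?d) t"
  proof (rule has_partial_poly_eval[OF open_times_mem[OF open_D tD odd_index[OF n]] _ lam_flow[OF n j t]])
    show "has_poly_partial K (2 * n + 1) ?P ?Q t"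
      by (rule has_poly_partial_smult_const[OF has_poly_partial_CS_flow[OF n tD]])
    show "degree (?P s) \<le> g + degree ?Q" for s
      by (rule trans_le_add1[OF order_trans[OF degree_smult_le degree_CS]])
  qed simp
  then have "has_partial K (2 * n + 1) (mu j) (poly ?Q ?l + poly (pderiv (?P t)) ?l * ?d) t"
    by (rule has_partial_cong[OF open_D' t odd_index[OF n], rotated])
      (use D'_D in \<open>auto simp: mu[OF j] alpha_poly_CS\<close>)
  also have "poly ?Q ?l + poly (pderiv (?P t)) ?l * ?d =
      poly (pderiv (h_poly K u g t)) ?l * poly (B_poly K u n t) ?l / poly (pderiv (beta_poly K u g t)) ?l
       - poly (pderiv (alpha_poly K u g t)) ?l * poly (pderiv (B_poly K u n t)) ?l / poly (pderiv (beta_poly K u g t)) ?l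
       + poly (pderiv (A_poly K u n t)) ?l"
  proof -
    have gamma: "poly (gamma_poly K u g t) ?l = - 1 / 2 * poly (CS gd2 t) ?l"
      using beta_root[OF t j] unfolding gamma_poly_CS[OF tD] beta_poly_CS by (simp del: mult_pCons_left)
    have Q: "poly ?Q ?l = poly (B_poly K u n t) ?l * poly (gamma_poly K u g t) ?l + poly (pderiv (A_poly K u n t)) ?l"
      using beta_root[OF t j] unfolding alpha_flow[OF n tD] gamma A_poly_LP[OF tD] B_poly_LP beta_poly_CS
      by (simp add: pderiv_smult pderiv_minus algebra_simps)
    \<comment> \<open>At a root of beta h' is 2 mu_j alpha' + beta' gamma; this trades the value of
      gamma in the Lax equation for h'.\<close>
    have h: "poly (pderiv (h_poly K u g t)) ?l = 2 * mu j t * poly (pderiv (alpha_poly K u g t)) ?l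
        + poly (pderiv (beta_poly K u g t)) ?l * poly (gamma_poly K u g t) ?l"
      using beta_root[OF t j] unfolding h_poly_def power2_eq_square
      by (simp add: pderiv_add pderiv_mult mu[OF j t])
    show ?thesis
      unfolding Q h alpha_poly_CS[OF tD, symmetric] using beta_simple[OF t j] by (simp add: field_simps)
  qed
  finally show ?thesis .
qed

lemma Ham_lam:
  assumes n: "n \<le> g" and j: "j \<in> {1..g}" and t: "t \<in> D'"
  shows "((\<lambda>z. Ham g n t ((\<lambda>i. lam i t)(j := z)) (\<lambda>i. mu i t)) has_field_derivative
    - (poly (pderiv (h_poly K u g t)) (lam j t) * poly (B_poly K u n t) (lam j t)
         / poly (pderiv (beta_poly K u g t)) (lam j t)
       - poly (pderiv (alpha_poly K u g t)) (lam j t) * poly (pderiv (B_poly K u n t)) (lam j t)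
         / poly (pderiv (beta_poly K u g t)) (lam j t)
       + poly (pderiv (A_poly K u n t)) (lam j t))) (at (lam j t))"
proof -
  have tD: "t \<in> D" using t D'_D by auto
  have "poly (h_poly K u g t) (lam k t) = (mu k t)\<^sup>2" if "k \<in> {1..g}" for k
    using beta_root[OF t that] by (simp add: h_poly_def mu[OF that t])
  from Ham_partial_l[OF n j lam_inj[OF t] degree_alpha[OF g tD] mu[OF _ t, symmetric] degree_h_diff_I0[OF g tD] this]
  show ?thesis
    unfolding R_poly_of_roots_eq_B[OF n beta_roots[OF t]] trunc_alpha_eq_A[OF n tD] beta_roots[OF t, symmetric] .
qed

lemma Ham_mu:
  assumes n: "n \<le> g" and j: "j \<in> {1..g}" and t: "t \<in> D'"
  shows "((\<lambda>z. Ham g n t (\<lambda>i. lam i t) ((\<lambda>i. mu i t)(j := z))) has_field_derivative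
      (2 * mu j t * poly (B_poly K u n t) (lam j t) / poly (pderiv (beta_poly K u g t)) (lam j t)
       - poly (pderiv (B_poly K u n t)) (lam j t) / poly (pderiv (beta_poly K u g t)) (lam j t))) (at (mu j t))"
  using Ham_partial_m[OF j, of n t "\<lambda>i. lam i t" "\<lambda>i. mu i t"]
  unfolding R_poly_of_roots_eq_B[OF n beta_roots[OF t]] beta_roots[OF t, symmetric] .

end

theorem theorem3:
  fixes g :: nat and K :: "complex set"
    and u :: "(nat \<Rightarrow> complex) \<Rightarrow> complex"
    and D D' :: "(nat \<Rightarrow> complex) set"
    and lam mu :: "nat \<Rightarrow> (nat \<Rightarrow> complex) \<Rightarrow> complex"
  assumes "g \<ge> 1"
    and "K = \<real> \<or> K = UNIV"
    and "PI_solution K g D u"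
    and "D' \<subseteq> D" and "open_times K g D'"
    and "\<And>j. j \<in> {1..g} \<Longrightarrow> continuous_on D' (lam j)"
    and "\<And>t. t \<in> D' \<Longrightarrow> beta_poly K u g t = (\<Prod>j=1..g. [:- lam j t, 1:])"
    and "\<And>t. t \<in> D' \<Longrightarrow> inj_on (\<lambda>j. lam j t) {1..g}"
    and "\<And>j t. j \<in> {1..g} \<Longrightarrow> t \<in> D' \<Longrightarrow> mu j t = poly (alpha_poly K u g t) (lam j t)"
  shows "\<forall>n\<in>{0..g-1}. \<forall>j\<in>{1..g}. \<forall>t\<in>D'.
    has_partial K (2 * n + 1) (lam j)
      (2 * mu j t * poly (B_poly K u n t) (lam j t) / poly (pderiv (beta_poly K u g t)) (lam j t)
       - poly (pderiv (B_poly K u n t)) (lam j t) / poly (pderiv (beta_poly K u g t)) (lam j t)) t \<and>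
    has_partial K (2 * n + 1) (mu j)
      (poly (pderiv (h_poly K u g t)) (lam j t) * poly (B_poly K u n t) (lam j t)
         / poly (pderiv (beta_poly K u g t)) (lam j t)
       - poly (pderiv (alpha_poly K u g t)) (lam j t) * poly (pderiv (B_poly K u n t)) (lam j t)
         / poly (pderiv (beta_poly K u g t)) (lam j t)
       + poly (pderiv (A_poly K u n t)) (lam j t)) t \<and>
    (\<lambda>z. Ham g n t ((\<lambda>i. lam i t)(j := z)) (\<lambda>i. mu i t)) field_differentiable at (lam j t) \<and>
    (\<lambda>z. Ham g n t (\<lambda>i. lam i t) ((\<lambda>i. mu i t)(j := z))) field_differentiable at (mu j t) \<and>
    has_partial K (2 * n + 1) (lam j)
      (poisson g (coord_l j) (Ham g n t) (\<lambda>i. lam i t) (\<lambda>i. mu i t)) t \<and>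
    has_partial K (2 * n + 1) (mu j)
      (poisson g (coord_m j) (Ham g n t) (\<lambda>i. lam i t) (\<lambda>i. mu i t)) t"
proof (intro ballI)
  fix n j t assume "n \<in> {0..g-1}" and j: "j \<in> {1..g}" and t: "t \<in> D'"
  then have n: "n \<le> g" by simp
  interpret PI_roots K g D u D' lam mu
    using assms by unfold_locales
  note l = lam_flow[OF n j t] and m = mu_flow[OF n j t] and hl = Ham_lam[OF n j t] and hm = Ham_mu[OF n j t]
  have "poisson g (coord_l j) (Ham g n t) (\<lambda>i. lam i t) (\<lambda>i. mu i t) =
      2 * mu j t * poly (B_poly K u n t) (lam j t) / poly (pderiv (beta_poly K u g t)) (lam j t)
       - poly (pderiv (B_poly K u n t)) (lam j t) / poly (pderiv (beta_poly K u g t)) (lam j t)"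
    unfolding poisson_coord(1)[OF j] d_m_def by (rule DERIV_imp_deriv[OF hm])
  moreover have "poisson g (coord_m j) (Ham g n t) (\<lambda>i. lam i t) (\<lambda>i. mu i t) =
      poly (pderiv (h_poly K u g t)) (lam j t) * poly (B_poly K u n t) (lam j t)
         / poly (pderiv (beta_poly K u g t)) (lam j t)
       - poly (pderiv (alpha_poly K u g t)) (lam j t) * poly (pderiv (B_poly K u n t)) (lam j t)
         / poly (pderiv (beta_poly K u g t)) (lam j t)
       + poly (pderiv (A_poly K u n t)) (lam j t)"
    unfolding poisson_coord(2)[OF j] d_l_def DERIV_imp_deriv[OF hl] by simp
  ultimately show "has_partial K (2 * n + 1) (lam j)
      (2 * mu j t * poly (B_poly K u n t) (lam j t) / poly (pderiv (beta_poly K u g t)) (lam j t)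
       - poly (pderiv (B_poly K u n t)) (lam j t) / poly (pderiv (beta_poly K u g t)) (lam j t)) t \<and>
    has_partial K (2 * n + 1) (mu j)
      (poly (pderiv (h_poly K u g t)) (lam j t) * poly (B_poly K u n t) (lam j t)
         / poly (pderiv (beta_poly K u g t)) (lam j t)
       - poly (pderiv (alpha_poly K u g t)) (lam j t) * poly (pderiv (B_poly K u n t)) (lam j t)
         / poly (pderiv (beta_poly K u g t)) (lam j t)
       + poly (pderiv (A_poly K u n t)) (lam j t)) t \<and>
    (\<lambda>z. Ham g n t ((\<lambda>i. lam i t)(j := z)) (\<lambda>i. mu i t)) field_differentiable at (lam j t) \<and>
    (\<lambda>z. Ham g n t (\<lambda>i. lam i t) ((\<lambda>i. mu i t)(j := z))) field_differentiable at (mu j t) \<and>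
    has_partial K (2 * n + 1) (lam j)
      (poisson g (coord_l j) (Ham g n t) (\<lambda>i. lam i t) (\<lambda>i. mu i t)) t \<and>
    has_partial K (2 * n + 1) (mu j)
      (poisson g (coord_m j) (Ham g n t) (\<lambda>i. lam i t) (\<lambda>i. mu i t)) t"
    using l m hl hm by (auto simp only: field_differentiable_def)
qed

end
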